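(* Let $(X_1,M_1),\dots,(X_n,M_n)$ be i.i.d. copies of $(X,M)\sim\mathbb{P}_{X,M}$ (no assumption on the missingness mechanism), let $\{P_\theta:\theta\in\Theta\}$, $\Theta\subset\mathbb{R}^p$, be a model of distributions on $\mathbb{R}^d$, and let $$ \theta_n^{\mathrm{MMD}}\in\arg\min_{\theta\in\Theta}\frac1n\sum_{i=1}^n \mathbb{D}^2\big(P_\theta^{(M_i)},\delta_{\{X_i^{(M_i)}\}}\big). $$ Assume: (1) $\Theta$ is compact and the minimizer $\theta_\infty^{\mathrm{MMD}}=\arg\min_{\theta\in\Theta}\mathbb{E}_{M\sim\mathbb{P}_M}\big[\mathbb{D}^2(P_\theta^{(M)},\mathbb{P}_{X\mid M}^{(M)})\big]$ exists and is unique; (2) for each $m$ in the support of $\mathbb{P}_M$, $\theta\mapsto\Phi(P_\theta^{(m)})$ is continuous on $\Theta$; (3) $\theta_\infty^{\mathrm{MMD}}$ is an interior point of $\Theta$; (4) there is an open neighborhood $O\subset\Theta$ of $\theta_\infty^{\mathrm{MMD}}$ such that for each $m$ in the support of $\mathbb{P}_M$ the map $\theta\mapsto\Phi(P_\theta^{(m)})$ is twice continuously Fréchet differentiable on $O$, and differentiation can be interchanged with the integrals (expectations) involved; (5) there is a compact set $K\subset O$ whose interior contains $\theta_\infty^{\mathrm{MMD}}$ such that for every pair $(j,k)$ and every $m$ in the support of $\mathbb{P}_M$, $\sup_{\theta\in K}\big\|\partial^2\Phi(P_\theta^{(m)})/\partial\theta_j\partial\theta_k\big\|_{\mathcal{H}}<+\infty$;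 (6) the matrix $H=\mathbb{E}_{M\sim\mathbb{P}_M}\big[\nabla^2_{\theta,\theta}\mathbb{D}^2(P_{\theta}^{(M)},\mathbb{P}_{X\mid M}^{(M)})\big|_{\theta=\theta_\infty^{\mathrm{MMD}}}\big]$ is nonsingular; (7) the matrices $\Sigma_1=\mathbb{E}_{M\sim\mathbb{P}_M}\Big[\mathbb{V}_{X\sim\mathbb{P}_{X\mid M}}\big[\nabla_\theta\mathbb{D}^2(P_{\theta}^{(M)},\delta_{\{X^{(M)}\}})\big|_{\theta=\theta_\infty^{\mathrm{MMD}}}\big]\Big]$ and $\Sigma_2=\mathbb{V}_{M\sim\mathbb{P}_M}\Big[\nabla_\theta\mathbb{D}^2(P_{\theta}^{(M)},\mathbb{P}_{X\mid M}^{(M)})\big|_{\theta=\theta_\infty^{\mathrm{MMD}}}\Big]$ are nonsingular. Then $$ \sqrt n\big(\theta_n^{\mathrm{MMD}}-\theta_\infty^{\mathrm{MMD}}\big)\xrightarrow{\ \mathcal{L}\ }\mathcal{N}\big(0,\,H^{-1}\Sigma_1H^{-1}+H^{-1}\Sigma_2H^{-1}\big)\quad(n\to\infty). $$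
   Context: $X\in\mathbb{R}^d$ is the data vector, $M\in\{0,1\}^d$ the missingness mask ($M_j=0$: $X_j$ observed; $M_j=1$: missing); $\mathbb{P}_{X,M}$ is their joint law, $\mathbb{P}_M$ the law of $M$, $\mathbb{P}_{X\mid M=m}$ the conditional law of $X$ given $M=m$. For $m\in\{0,1\}^d$, $x^{(m)}$ is the subvector of observed coordinates $\{j:m_j=0\}$, and for a distribution $Q$ on $\mathbb{R}^d$, $Q^{(m)}$ is the law of $Y^{(m)}$ for $Y\sim Q$. Convention: in every expectation or variance over $M$ the empty pattern $(1,\dots,1)$ is excluded, i.e. $\mathbb{E}_M[f(M)]=\sum_{m\neq(1,\dots,1)}\mathbb{P}[M=m]f(m)$. $k$ is a positive definite kernel bounded by $1$, characteristic and dimension-independent (same formula in every dimension, e.g. Gaussian kernel), with RKHS $\mathcal{H}$; $\Phi(Q)=\mathbb{E}_{Y\sim Q}[k(Y,\cdot)]$ is the kernel mean embedding, and $\mathbb{D}(Q_1,Q_2)=\|\Phi(Q_1)-\Phi(Q_2)\|_{\mathcal{H}}$ the maximum mean discrepancy. *)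

theory Defs
  imports "HOL-Probability.Probability"
begin

text \<open>Missingness masks: m j = True means coordinate j is missing.
  The observed subvector x^(m) is the list of observed coordinates in increasing index order.
  A single kernel on real lists is "the same formula in every dimension".\<close>

definition subvec :: "('d \<Rightarrow> bool) \<Rightarrow> real^('d::{finite,linorder}) \<Rightarrow> real list" where
  "subvec m x = map (\<lambda>j. x $ j) (sorted_list_of_set {j. \<not> m j})"

text \<open>Zero-padding of missing coordinates: a measurable copy of the subvector inside R^d.\<close>
definition zpad :: "('d \<Rightarrow> bool) \<Rightarrow> real^('d::finite) \<Rightarrow> real^'d" where
  "zpad m x = (\<chi> j. if m j then 0 else x $ j)"

text \<open>Kernel mean embedding of Q^(m) w.r.t. the kernel k(u,v) = inner (phi u) (phi v).\<close>
definition emb :: "(real list \<Rightarrow> 'h::{real_inner,banach,second_countable_topology})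
    \<Rightarrow> ('d \<Rightarrow> bool) \<Rightarrow> (real^('d::{finite,linorder})) measure \<Rightarrow> 'h" where
  "emb \<phi> m Q = (\<integral>x. \<phi> (subvec m x) \<partial>Q)"

definition mmd2 where
  "mmd2 \<phi> m P Q = (norm (emb \<phi> m P - emb \<phi> m Q))\<^sup>2"

definition pM :: "((real^('d::finite)) \<times> ('d \<Rightarrow> bool)) measure \<Rightarrow> ('d \<Rightarrow> bool) \<Rightarrow> real" where
  "pM PXM m = measure PXM (UNIV \<times> {m})"

definition condX :: "((real^('d::finite)) \<times> ('d \<Rightarrow> bool)) measure \<Rightarrow> ('d \<Rightarrow> bool) \<Rightarrow> (real^'d) measure" where
  "condX PXM m = distr (uniform_measure PXM (UNIV \<times> {m})) borel fst"

definition obs_patterns :: "((real^('d::finite)) \<times> ('d \<Rightarrow> bool)) measure \<Rightarrow> ('d \<Rightarrow> bool) set" where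
  "obs_patterns PXM = {m. pM PXM m > 0 \<and> m \<noteq> (\<lambda>_. True)}"

definition pop_risk where
  "pop_risk \<phi> P PXM \<theta> = (\<Sum>m\<in>obs_patterns PXM. pM PXM m * mmd2 \<phi> m (P \<theta>) (condX PXM m))"

definition emp_risk where
  "emp_risk \<phi> P X M n \<theta> \<omega> =
     (1 / real n) * (\<Sum>i<n. mmd2 \<phi> (M i \<omega>) (P \<theta>) (return borel (X i \<omega>)))"

definition gradient :: "(real^('p::finite) \<Rightarrow> real) \<Rightarrow> real^'p \<Rightarrow> real^'p" where
  "gradient f t = (THE g. (f has_derivative (\<lambda>h. g \<bullet> h)) (at t))"

definition hessian :: "(real^('p::finite) \<Rightarrow> real) \<Rightarrow> real^'p \<Rightarrow> real^'p^'p" where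
  "hessian f t = (THE H. ((\<lambda>s. gradient f s) has_derivative (\<lambda>h. H *v h)) (at t))"

definition outer :: "real^('p::finite) \<Rightarrow> real^'p \<Rightarrow> real^'p^'p" where
  "outer u v = (\<chi> i j. u $ i * v $ j)"

definition cov_mat :: "'a measure \<Rightarrow> ('a \<Rightarrow> real^('p::finite)) \<Rightarrow> real^'p^'p" where
  "cov_mat Q g = (\<chi> i j. \<integral>x. (g x $ i - (\<integral>y. g y $ i \<partial>Q)) * (g x $ j - (\<integral>y. g y $ j \<partial>Q)) \<partial>Q)"

definition Hmat where
  "Hmat \<phi> P PXM t0 = (\<Sum>m\<in>obs_patterns PXM.
      pM PXM m *\<^sub>R hessian (\<lambda>t. mmd2 \<phi> m (P t) (condX PXM m)) t0)"

definition Sigma1 where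
  "Sigma1 \<phi> P PXM t0 = (\<Sum>m\<in>obs_patterns PXM.
      pM PXM m *\<^sub>R cov_mat (condX PXM m) (\<lambda>x. gradient (\<lambda>t. mmd2 \<phi> m (P t) (return borel x)) t0))"

text \<open>Variance over M of the gradient (the empty pattern has zero gradient, so
  restricting sums to obs_patterns gives the true variance).\<close>
definition Sigma2 where
  "Sigma2 \<phi> P PXM t0 =
     (let g = (\<lambda>m. gradient (\<lambda>t. mmd2 \<phi> m (P t) (condX PXM m)) t0);
          gbar = (\<Sum>m\<in>obs_patterns PXM. pM PXM m *\<^sub>R g m)
      in (\<Sum>m\<in>obs_patterns PXM. pM PXM m *\<^sub>R outer (g m) (g m)) - outer gbar gbar)"

definition normal1 :: "real \<Rightarrow> real measure" where
  "normal1 v = (if v = 0 then return borel 0 else density lborel (normal_density 0 (sqrt v)))"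

definition is_mvnormal :: "(real^('p::finite)) measure \<Rightarrow> real^'p^'p \<Rightarrow> bool" where
  "is_mvnormal N S \<longleftrightarrow> sets N = sets borel \<and> prob_space N \<and>
     (\<forall>t. distr N borel (\<lambda>x. t \<bullet> x) = normal1 (t \<bullet> (S *v t)))"

definition conv_in_law :: "'w measure \<Rightarrow> (nat \<Rightarrow> 'w \<Rightarrow> real^('p::finite)) \<Rightarrow> (real^'p) measure \<Rightarrow> bool" where
  "conv_in_law \<Omega> Z N \<longleftrightarrow> (\<forall>f :: real^'p \<Rightarrow> real. continuous_on UNIV f \<and> bounded (range f) \<longrightarrow>
      (\<lambda>n. \<integral>\<omega>. f (Z n \<omega>) \<partial>\<Omega>) \<longlonglongrightarrow> (\<integral>x. f x \<partial>N))"

end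

theory Submission
  imports Defs
begin

text \<open>In the Hilbert space the squared MMD to a point mass expands as
  \<open>|\<Phi>\<^sub>m(\<theta>)|\<^sup>2 - 2 \<langle>\<Phi>\<^sub>m(\<theta>), \<phi>(x)\<rangle> + const\<close>. Hence, up to terms that do not depend on \<open>\<theta>\<close>, the
  empirical risk is \<open>\<langle>\<Psi>(\<theta>), V\<^sub>n\<rangle>\<close>, where \<open>\<Psi>(\<theta>)\<close> collects the pairs \<open>(|\<Phi>\<^sub>m(\<theta>)|\<^sup>2, - 2 \<Phi>\<^sub>m(\<theta>))\<close> over the
  masks \<open>m\<close> and \<open>V\<^sub>n\<close> is the average of the i.i.d. bounded vectors with \<open>m\<close>-th entry
  \<open>1[M\<^sub>i = m] (1, \<phi>(X\<^sub>i))\<close>; the population risk is the same expression with \<open>V\<^sub>n\<close> replaced by its mean \<open>v\<close>.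
  Since the data enter linearly, no uniform law of large numbers is needed: a deterministic argument
  shows that any minimiser of \<open>\<langle>\<Psi>(\<theta>), w\<rangle>\<close> with \<open>w\<close> close to \<open>v\<close> is
  \<open>\<theta>\<^sub>\<infinity> - H\<^sup>-\<^sup>1 G(w - v) + o(|w - v|)\<close>, where \<open>G\<close> is linear, and \<open>|V\<^sub>n - v| = O(n\<^sup>-\<^sup>1\<^sup>/\<^sup>2)\<close> in \<open>L\<^sup>2\<close>. The
  central limit theorem for the linear term is reduced to dimension one by trigonometric
  approximation. The covariance of the gradient splits as \<open>\<Sigma>\<^sub>1 + \<Sigma>\<^sub>2\<close> by conditioning on the mask,
  because the mean gradient vanishes at the minimiser.\<close>

text \<open>The empirical and population contrasts are one function of the weight \<open>w\<close>,
  so the analysis of minimisers is done at a fixed sample point; probability enters only through the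
  size of \<open>V_n - v\<close>. The remainder is relative to \<open>|w - v|\<close> and uniform
  over all minimisers: multiplied by \<open>sqrt n\<close> it is an arbitrarily small multiple of a
  quantity bounded in mean square, hence negligible in probability.

  The mask indicator is kept as a separate entry beside the embedded observation because the
  empirical mask frequencies fluctuate too; this fluctuation produces the second covariance term.
  Masks of probability zero, for which nothing is assumed about the model, and the fully missing
  mask, whose loss is constant in \<open>\<theta>\<close>, are both coded by zero entries.

  Convergence in law is tested on all bounded continuous functions, whereas the scalar limit theorem
  controls only cosines of linear forms. The passage from one to the other needs tightness, which
  the mean square bound supplies. The limit law itself has to be constructed, and of its covariance
  only the quadratic form matters.\<close>

section \<open>Multivariate normal distributions\<close>

text \<open>Cholesky factorisation: pivot on one index and recurse on the Schur complement.\<close>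

lemma psd_factorization:
  fixes a :: "'i \<Rightarrow> 'i \<Rightarrow> real"
  assumes "finite J"
    and "\<And>i j. i \<in> J \<Longrightarrow> j \<in> J \<Longrightarrow> a i j = a j i"
    and "\<And>x. 0 \<le> (\<Sum>i\<in>J. \<Sum>j\<in>J. x i * x j * a i j)"
  shows "\<exists>B. \<forall>i\<in>J. \<forall>j\<in>J. a i j = (\<Sum>k\<in>J. B i k * B j k)"
  using assms
proof (induction J arbitrary: a rule: finite_induct)
  case empty
  then show ?case by simp
next
  case (insert q J)
  note sym = insert.prems(1) and psd = insert.prems(2)
  have expand: "(\<Sum>i\<in>insert q J. \<Sum>j\<in>insert q J. x i * x j * a i j) =
      x q * x q * a q q + 2 * x q * (\<Sum>i\<in>J. x i * a i q) + (\<Sum>i\<in>J. \<Sum>j\<in>J. x i * x j * a i j)" for x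
  proof -
    have "(\<Sum>j\<in>J. x q * x j * a q j) = x q * (\<Sum>i\<in>J. x i * a i q)"
      unfolding sum_distrib_left by (intro sum.cong refl) (simp add: sym[of q])
    moreover have "(\<Sum>i\<in>J. x i * x q * a i q) = x q * (\<Sum>i\<in>J. x i * a i q)"
      unfolding sum_distrib_left by (intro sum.cong refl) simp
    ultimately show ?thesis
      using insert.hyps by (simp add: sum.distrib)
  qed
  have aqq: "0 \<le> a q q"
  proof -
    define x :: "'i \<Rightarrow> real" where "x = (\<lambda>i. if i = q then 1 else 0)"
    have "x i = 0" if "i \<in> J" for i using that insert.hyps by (auto simp: x_def)
    then show ?thesis using psd[of x] by (simp add: expand) (simp add: x_def)
  qed
  \<comment> \<open>With pivot 0 the form at the vector \<open>e_i + c e_q\<close> is affine in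
    \<open>c\<close>, so a nonzero \<open>a i q\<close> could drive it below zero; the
    \<open>c\<close> chosen here gives the value -1.\<close>
  have zero: "a i q = 0" if "a q q = 0" "i \<in> J" for i
  proof (rule ccontr)
    assume ne: "a i q \<noteq> 0"
    define c where "c = - (a i i + 1) / (2 * a i q)"
    define x where "x = (\<lambda>k. if k = i then 1 else if k = q then c else 0)"
    have "i \<noteq> q" using that insert.hyps by auto
    have s1: "(\<Sum>k\<in>J. x k * f k) = f i" for f
    proof -
      have "(\<Sum>k\<in>J. x k * f k) = (\<Sum>k\<in>J. if k = i then f k else 0)"
        using insert.hyps by (intro sum.cong refl) (auto simp: x_def)
      then show ?thesis using that insert.hyps by simp
    qed
    have xq: "x q = c" using \<open>i \<noteq> q\<close> by (simp add: x_def)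
    have "(\<Sum>i\<in>insert q J. \<Sum>j\<in>insert q J. x i * x j * a i j) =
        x q * x q * a q q + 2 * x q * (\<Sum>i\<in>J. x i * a i q) + (\<Sum>i\<in>J. x i * (\<Sum>j\<in>J. x j * a i j))"
      unfolding expand by (simp add: sum_distrib_left mult.assoc)
    also have "\<dots> = 2 * c * a i q + a i i"
      using that(1) by (simp add: s1 xq)
    also have "\<dots> = - 1" using ne by (simp add: c_def field_simps)
    finally show False using psd[of x] by simp
  qed
  \<comment> \<open>For a zero pivot, \<open>x / 0 = 0\<close> switches the correction off, in
    agreement with \<open>zero\<close>; both cases thus run through the same formulas.\<close>
  define b where "b = (\<lambda>i j. a i j - a i q * a j q / a q q)"
  have "\<exists>B. \<forall>i\<in>J. \<forall>j\<in>J. b i j = (\<Sum>k\<in>J. B i k * B j k)"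
  proof (rule insert.IH)
    show "b i j = b j i" if "i \<in> J" "j \<in> J" for i j
      using sym[of i j] that by (simp add: b_def)
    fix x :: "'i \<Rightarrow> real"
    define s where "s = (\<Sum>i\<in>J. x i * a i q)"
    \<comment> \<open>The value at \<open>q\<close> minimises the form of \<open>a\<close> with the
      other coordinates fixed; at this point it equals the form of the Schur complement.\<close>
    define y where "y = (\<lambda>k. if k = q then - s / a q q else x k)"
    have yx: "y k = x k" if "k \<in> J" for k using that insert.hyps by (auto simp: y_def)
    have "(\<Sum>i\<in>J. \<Sum>j\<in>J. x i * x j * b i j)
        = (\<Sum>i\<in>J. \<Sum>j\<in>J. x i * x j * a i j) - (\<Sum>i\<in>J. \<Sum>j\<in>J. (x i * a i q) * (x j * a j q)) / a q q"
      by (simp add: b_def sum_subtractf[symmetric] sum_divide_distrib algebra_simps)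
    also have "(\<Sum>i\<in>J. \<Sum>j\<in>J. (x i * a i q) * (x j * a j q)) = s * s"
      by (simp add: s_def sum_product)
    also have "(\<Sum>i\<in>J. \<Sum>j\<in>J. x i * x j * a i j) - s * s / a q q
        = y q * y q * a q q + 2 * y q * (\<Sum>i\<in>J. y i * a i q) + (\<Sum>i\<in>J. \<Sum>j\<in>J. y i * y j * a i j)"
      by (simp add: yx s_def[symmetric] cong: sum.cong) (simp add: y_def field_simps)
    also have "\<dots> \<ge> 0" using psd[of y] by (simp add: expand)
    finally show "0 \<le> (\<Sum>i\<in>J. \<Sum>j\<in>J. x i * x j * b i j)" .
  qed
  then obtain B where B: "\<And>i j. i \<in> J \<Longrightarrow> j \<in> J \<Longrightarrow> b i j = (\<Sum>k\<in>J. B i k * B j k)" by blast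
  define C where "C = (\<lambda>i k. if k = q then (if i = q then sqrt (a q q) else a i q / sqrt (a q q))
      else if i = q then 0 else B i k)"
  have CJ: "(\<Sum>k\<in>J. C i k * C j k) = (if i = q \<or> j = q then 0 else \<Sum>k\<in>J. B i k * B j k)" for i j
    using insert.hyps by (auto simp: C_def intro!: sum.cong sum.neutral)
  have "a i j = (\<Sum>k\<in>insert q J. C i k * C j k)" if "i \<in> insert q J" "j \<in> insert q J" for i j
  proof -
    have aqj: "a q j = a j q" using sym[of q j] that by auto
    have 1: "(\<Sum>k\<in>insert q J. C i k * C j k) = C i q * C j q + (\<Sum>k\<in>J. C i k * C j k)"
      using insert.hyps by simp
    consider "i = q" "j = q" | "i = q" "j \<noteq> q" | "i \<noteq> q" "j = q" | "i \<noteq> q" "j \<noteq> q" by blast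
    then show ?thesis
    proof cases
      case 4
      then have "i \<in> J" "j \<in> J" using that by auto
      then have "a i j = a i q * a j q / a q q + (\<Sum>k\<in>J. B i k * B j k)"
        by (simp add: B[symmetric] b_def)
      then show ?thesis using 1 4 aqq by (simp add: CJ) (simp add: C_def)
    qed (use that 1 CJ aqq zero aqj in \<open>auto simp: C_def\<close>)
  qed
  then show ?case by blast
qed

lemma borel_measurable_vecI:
  fixes f :: "'a \<Rightarrow> real^('p::finite)"
  assumes "\<And>j. (\<lambda>x. f x $ j) \<in> borel_measurable M"
  shows "f \<in> borel_measurable M"
  unfolding borel_measurable_euclidean_space[of f]
  using assms by (auto simp: Basis_vec_def cart_eq_inner_axis)

lemma prob_space_normal1: "0 \<le> v \<Longrightarrow> prob_space (normal1 v)"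
  by (auto simp: normal1_def prob_space_return prob_space_normal_density)

lemma real_distribution_normal1: "0 \<le> v \<Longrightarrow> real_distribution (normal1 v)"
  by (auto simp: real_distribution_def real_distribution_axioms_def prob_space_normal1)
     (auto simp: normal1_def split: if_splits)

text \<open>Scaling a standard normal variable also covers the Dirac case \<open>v = 0\<close>, so
  later computations avoid the case split in \<open>normal1\<close>.\<close>

lemma normal1_eq_distr:
  assumes "0 \<le> v"
  shows "normal1 v = distr std_normal_distribution borel (\<lambda>x. sqrt v * x)"
proof (cases "v = 0")
  case True
  interpret prob_space std_normal_distribution by (rule prob_space_normal_density) simp
  show ?thesis using True by (simp add: normal1_def distr_const)
next
  case False
  then have v: "sqrt v > 0" using assms by simp
  interpret prob_space std_normal_distribution by (rule prob_space_normal_density) simp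
  have d: "distributed std_normal_distribution lborel (\<lambda>x. x) (normal_density 0 1)"
    by (auto simp: distributed_def distr_id2)
  have "distributed std_normal_distribution lborel (\<lambda>x. 0 + sqrt v * x) (normal_density (0 + sqrt v * 0) (\<bar>sqrt v\<bar> * 1))"
    using v by (intro normal_density_affine d) auto
  then have "normal1 v = distr std_normal_distribution lborel (\<lambda>x. sqrt v * x)"
    using False v by (simp add: normal1_def distributed_def)
  also have "\<dots> = distr std_normal_distribution borel (\<lambda>x. sqrt v * x)"
    by (intro distr_cong) auto
  finally show ?thesis .
qed

lemma char_normal1:
  assumes "0 \<le> v"
  shows "char (normal1 v) t = of_real (exp (- v * t\<^sup>2 / 2))"
proof -
  have "char (normal1 v) t = char std_normal_distribution (t * sqrt v)"
    by (simp add: normal1_eq_distr[OF assms] char_def integral_distr mult.assoc)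
  then show ?thesis
    using assms by (simp add: char_std_normal_distribution power_mult_distrib mult.commute)
qed

text \<open>The law is that of \<open>B g\<close>, where \<open>B\<close> factorises
  \<open>S\<close> and \<open>g\<close> has independent standard normal coordinates. Each linear
  form of it has a characteristic function that factorises over these coordinates, and Levy
  uniqueness identifies its law.\<close>

lemma mvnormal_exists:
  fixes S :: "real^'p^('p::finite)"
  assumes "\<And>i j. S $ i $ j = S $ j $ i" and "\<And>x. 0 \<le> x \<bullet> (S *v x)"
  shows "\<exists>N. is_mvnormal N S"
proof -
  have quad: "x \<bullet> (S *v x) = (\<Sum>i\<in>UNIV. \<Sum>j\<in>UNIV. x $ i * x $ j * S $ i $ j)" for x
    by (simp add: inner_vec_def matrix_vector_mult_def sum_distrib_left algebra_simps)
  have "\<exists>B. \<forall>i\<in>(UNIV::'p set). \<forall>j\<in>UNIV. S $ i $ j = (\<Sum>k\<in>(UNIV::'p set). B i k * B j k)"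
  proof (rule psd_factorization[of UNIV "\<lambda>i j. S $ i $ j"])
    fix x :: "'p \<Rightarrow> real"
    show "0 \<le> (\<Sum>i\<in>UNIV. \<Sum>j\<in>UNIV. x i * x j * S $ i $ j)"
      using assms(2)[of "\<chi> i. x i"] by (simp add: quad)
  qed (use assms(1) in auto)
  then obtain B :: "'p \<Rightarrow> 'p \<Rightarrow> real" where B: "\<And>i j. S $ i $ j = (\<Sum>k\<in>UNIV. B i k * B j k)"
    by auto
  define Q where "Q = PiM (UNIV :: 'p set) (\<lambda>_. std_normal_distribution)"
  interpret std: prob_space std_normal_distribution by (rule prob_space_normal_density) simp
  interpret PP: product_prob_space "\<lambda>_. std_normal_distribution" "UNIV :: 'p set" ..
  interpret Q: prob_space Q unfolding Q_def by (rule PP.prob_space_axioms)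
  have [measurable]: "(\<lambda>g. g i) \<in> borel_measurable Q" for i
  proof -
    have "(\<lambda>g. g i) \<in> measurable Q std_normal_distribution"
      unfolding Q_def by (rule measurable_component_singleton) simp
    then show ?thesis
      by (subst measurable_cong_sets[OF refl, of borel std_normal_distribution]) auto
  qed
  have law: "distr Q borel (\<lambda>g. g i) = std_normal_distribution" for i
  proof -
    have "distr Q borel (\<lambda>g. g i) = distr Q std_normal_distribution (\<lambda>g. g i)"
      by (intro distr_cong) auto
    also have "\<dots> = std_normal_distribution"
      unfolding Q_def by (rule PP.PiM_component) simp
    finally show ?thesis .
  qed
  have law': "distr Q std_normal_distribution (\<lambda>g. g i) = std_normal_distribution" for i
    unfolding Q_def by (rule PP.PiM_component) simp
  have indep: "Q.indep_vars (\<lambda>_. borel) (\<lambda>i g. g i) UNIV"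
  proof -
    have "Q.indep_vars (\<lambda>_. std_normal_distribution) (\<lambda>i g. g i) UNIV"
      using Q.indep_vars_iff_distr_eq_PiM[of UNIV "\<lambda>i g. g i" "\<lambda>_. std_normal_distribution"]
      by (simp add: law' Q_def[symmetric] restrict_def distr_id del: sets_density space_density)
    then show ?thesis
      by (rule Q.indep_vars_compose2[where Y="\<lambda>_ x. x"]) auto
  qed
  define A where "A = (\<lambda>g. \<chi> i. \<Sum>k\<in>UNIV. B i k * g k)"
  have [measurable]: "A \<in> borel_measurable Q"
    unfolding A_def by (rule borel_measurable_vecI) simp
  have "distr (distr Q borel A) borel (\<lambda>x. t \<bullet> x) = normal1 (t \<bullet> (S *v t))" for t
  proof -
    \<comment> \<open>The transpose of \<open>B\<close> applied to \<open>t\<close>; the squared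
      length of this vector is the variance of the projection on \<open>t\<close>.\<close>
    define c where "c = (\<lambda>k. \<Sum>i\<in>UNIV. t $ i * B i k)"
    have tA: "t \<bullet> A g = (\<Sum>k\<in>UNIV. c k * g k)" for g
      unfolding A_def c_def inner_vec_def
      by (simp add: sum_distrib_left sum_distrib_right mult.assoc) (rule sum.swap)
    have ct: "(\<Sum>k\<in>UNIV. (c k)\<^sup>2) = t \<bullet> (S *v t)"
    proof -
      have "(\<Sum>k\<in>UNIV. (c k)\<^sup>2) = (\<Sum>k\<in>UNIV. \<Sum>i\<in>UNIV. \<Sum>j\<in>UNIV. t $ i * t $ j * (B i k * B j k))"
        by (simp add: c_def power2_eq_square sum_product algebra_simps)
      also have "\<dots> = (\<Sum>i\<in>UNIV. \<Sum>j\<in>UNIV. \<Sum>k\<in>UNIV. t $ i * t $ j * (B i k * B j k))"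
        by (subst sum.swap, intro sum.cong refl sum.swap)
      finally show ?thesis by (simp add: quad B sum_distrib_left)
    qed
    have nn: "0 \<le> t \<bullet> (S *v t)" by fact
    have "char (distr Q borel (\<lambda>g. t \<bullet> A g)) u = char (normal1 (t \<bullet> (S *v t))) u" for u
    proof -
      have "char (distr Q borel (\<lambda>g. t \<bullet> A g)) u = (\<Prod>k\<in>UNIV. char (distr Q borel (\<lambda>g. c k * g k)) u)"
        unfolding tA by (intro Q.char_distr_sum Q.indep_vars_compose2[OF indep, where Y="\<lambda>k x. c k * x"]) auto
      also have "\<dots> = (\<Prod>k\<in>UNIV. of_real (exp (- (c k)\<^sup>2 * u\<^sup>2 / 2)))"
      proof (intro prod.cong refl)
        fix k
        have "char (distr Q borel (\<lambda>g. c k * g k)) u = char (distr Q borel (\<lambda>g. g k)) (u * c k)"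
          by (simp add: char_def integral_distr mult.assoc)
        then show "char (distr Q borel (\<lambda>g. c k * g k)) u = of_real (exp (- (c k)\<^sup>2 * u\<^sup>2 / 2))"
          by (simp add: law char_std_normal_distribution power_mult_distrib mult.commute)
      qed
      also have "\<dots> = of_real (exp (\<Sum>k\<in>UNIV. - (c k)\<^sup>2 * u\<^sup>2 / 2))"
        by (simp add: exp_sum)
      also have "(\<Sum>k\<in>UNIV. - (c k)\<^sup>2 * u\<^sup>2 / 2) = - (t \<bullet> (S *v t)) * u\<^sup>2 / 2"
        by (simp add: ct[symmetric] sum_negf sum_distrib_right sum_divide_distrib)
      finally show ?thesis by (simp add: char_normal1[OF nn])
    qed
    then have "distr Q borel (\<lambda>g. t \<bullet> A g) = normal1 (t \<bullet> (S *v t))"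
      by (intro Levy_uniqueness real_distribution_normal1 nn ext Q.real_distribution_distr) auto
    then show ?thesis by (simp add: distr_distr comp_def)
  qed
  then have "is_mvnormal (distr Q borel A) S"
    by (simp add: is_mvnormal_def Q.prob_space_distr)
  then show ?thesis by blast
qed

section \<open>Trigonometric approximation\<close>

text \<open>The phase \<open>a\<close> brings in sines, and \<open>t = 0\<close> the constants.
  Product-to-sum formulas make the set an algebra, as polynomial approximation requires, while it
  still consists of finite sums of functions whose expectations the scalar limit theorem
  controls.\<close>

inductive_set trig_sums :: "('a::real_inner \<Rightarrow> real) set" where
  cos: "(\<lambda>x. c * cos (t \<bullet> x + a)) \<in> trig_sums"
| add: "f \<in> trig_sums \<Longrightarrow> g \<in> trig_sums \<Longrightarrow> (\<lambda>x. f x + g x) \<in> trig_sums"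

lemma trig_sums_mult:
  assumes "f \<in> trig_sums" "g \<in> trig_sums"
  shows "(\<lambda>x. f x * g x) \<in> trig_sums"
  using assms(1)
proof induction
  case (cos c t a)
  show ?case using assms(2)
  proof induction
    case (cos d s b)
    have "(\<lambda>x. c * cos (t \<bullet> x + a) * (d * cos (s \<bullet> x + b))) =
        (\<lambda>x. (c * d / 2) * cos ((t - s) \<bullet> x + (a - b)) + (c * d / 2) * cos ((t + s) \<bullet> x + (a + b)))"
    proof
      fix x
      have "(t - s) \<bullet> x + (a - b) = (t \<bullet> x + a) - (s \<bullet> x + b)"
        "(t + s) \<bullet> x + (a + b) = (t \<bullet> x + a) + (s \<bullet> x + b)"
        by (auto simp: inner_simps)
      then show "c * cos (t \<bullet> x + a) * (d * cos (s \<bullet> x + b)) =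
        (c * d / 2) * cos ((t - s) \<bullet> x + (a - b)) + (c * d / 2) * cos ((t + s) \<bullet> x + (a + b))"
        by (simp only: cos_diff cos_add) (simp add: field_simps)
    qed
    then show ?case by (simp only:) (intro trig_sums.intros)
  next
    case (add f g)
    then show ?case by (simp only: distrib_left) (rule trig_sums.add)
  qed
next
  case (add f1 f2)
  then show ?case by (simp only: distrib_right) (rule trig_sums.add)
qed

lemma trig_sums_sum:
  "finite I \<Longrightarrow> (\<And>i. i \<in> I \<Longrightarrow> f i \<in> trig_sums) \<Longrightarrow> (\<lambda>x. \<Sum>i\<in>I. f i x) \<in> trig_sums"
proof (induction I rule: finite_induct)
  case empty
  then show ?case using trig_sums.cos[of 0 0 0] by simp
qed (simp add: trig_sums.add)

lemma real_polynomial_function_sin_trig_sums: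
  fixes p :: "real^('n::finite) \<Rightarrow> real"
  assumes "real_polynomial_function p"
  shows "(\<lambda>x. p (\<chi> j. sin (l * x $ j))) \<in> trig_sums"
  using assms
proof induction
  case (linear f)
  then interpret bounded_linear f .
  \<comment> \<open>Since \<open>sin y = cos (pi / 2 - y)\<close>, the frequency carries a minus
    sign.\<close>
  have "(\<lambda>x. f (\<chi> j. sin (l * x $ j))) = (\<lambda>x. \<Sum>j\<in>UNIV. f (axis j 1) * cos ((- l *\<^sub>R axis j 1) \<bullet> x + pi / 2))"
  proof
    fix x :: "real^'n"
    have "(\<chi> j. sin (l * x $ j)) = (\<Sum>j\<in>UNIV. sin (l * x $ j) *\<^sub>R axis j 1)"
      by (simp add: vec_eq_iff axis_def if_distrib cong: if_cong)
    moreover have "sin (l * x $ j) = cos ((- l *\<^sub>R axis j 1) \<bullet> x + pi / 2)" for j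
      by (simp add: inner_axis' cos_add cos_diff)
    ultimately show "f (\<chi> j. sin (l * x $ j)) = (\<Sum>j\<in>UNIV. f (axis j 1) * cos ((- l *\<^sub>R axis j 1) \<bullet> x + pi / 2))"
      by (simp add: sum scale mult.commute)
  qed
  then show ?case by (simp only:) (intro trig_sums_sum trig_sums.intros, simp)
next
  case (const c)
  then show ?case using trig_sums.cos[of c 0 0] by simp
next
  case (add f g) then show ?case by (intro trig_sums.add)
next
  case (mult f g) then show ?case by (intro trig_sums_mult)
qed

lemma trig_sums_bounded_continuous:
  assumes "f \<in> trig_sums"
  shows "continuous_on UNIV f" "\<exists>B. \<forall>x. \<bar>f x\<bar> \<le> B"
proof -
  show "continuous_on UNIV f"
    using assms by induction (auto intro!: continuous_intros)
  show "\<exists>B. \<forall>x. \<bar>f x\<bar> \<le> B"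
    using assms
  proof induction
    case (cos c t a)
    have "\<bar>c * cos (t \<bullet> x + a)\<bar> \<le> \<bar>c\<bar>" for x
      using mult_left_mono[OF abs_cos_le_one, of "\<bar>c\<bar>" "t \<bullet> x + a"] by (simp add: abs_mult)
    then show ?case by blast
  next
    case (add f g)
    then obtain B C where "\<And>x. \<bar>f x\<bar> \<le> B" "\<And>x. \<bar>g x\<bar> \<le> C" by blast
    then have "\<bar>f x + g x\<bar> \<le> B + C" for x by (meson abs_triangle_ineq add_mono order.trans)
    then show ?case by blast
  qed
qed

text \<open>\<open>x \<mapsto> f (L sin (x\<^sub>j / L))\<close> is close to \<open>f\<close> on compacta for large \<open>L\<close>, and, being a continuous
  function of the bounded vector of sines, is uniformly close on the whole space to a polynomial in
  sines.\<close>

lemma trig_sums_approx: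
  fixes f :: "real^('n::finite) \<Rightarrow> real"
  assumes f: "continuous_on UNIV f" "\<And>x. \<bar>f x\<bar> \<le> B" and "R > 0" "e > 0"
  obtains g where "g \<in> trig_sums" "\<And>x. \<bar>g x\<bar> \<le> B + e" "\<And>x. norm x \<le> R \<Longrightarrow> \<bar>f x - g x\<bar> \<le> e"
proof -
  define s where "s = (\<lambda>l (x::real^'n). \<chi> j. sin (l * x $ j))"
  \<comment> \<open>Bounding the norm by the sum of the coordinates, a point of norm at most
    \<open>R\<close> and its sine image both stay in this ball.\<close>
  have "uniformly_continuous_on (cball 0 (2 * R * real CARD('n))) f"
    by (intro compact_uniformly_continuous continuous_on_subset[OF f(1)]) auto
  then obtain d where d: "d > 0" "\<And>x y. norm x \<le> 2 * R * real CARD('n) \<Longrightarrow> norm y \<le> 2 * R * real CARD('n) \<Longrightarrow>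
      norm (x - y) < d \<Longrightarrow> \<bar>f x - f y\<bar> < e / 2"
    unfolding uniformly_continuous_on_def using \<open>e > 0\<close>
    by (auto simp: dist_norm norm_minus_commute dist_real_def dest!: spec[of _ "e / 2"])
  define n where "n = real CARD('n)"
  have "n > 0" "n \<ge> 1" by (auto simp: n_def Suc_leI)
  \<comment> \<open>Here \<open>l\<close> is \<open>1 / L\<close>. A coordinate moves by at most
    \<open>l * R\<^sup>2\<close>, so this choice keeps the total displacement below the modulus
    \<open>d\<close>.\<close>
  obtain l where l: "l > 0" "n * (l * R\<^sup>2) < d" 
  proof -
    have "n * R\<^sup>2 > 0" using \<open>n > 0\<close> \<open>R > 0\<close> by simp
    then show ?thesis using that[of "d / (2 * (n * R\<^sup>2))"] d(1) by (simp add: field_simps)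
  qed
  have sin_approx: "\<bar>y - sin (l * y) / l\<bar> \<le> l * y\<^sup>2" "\<bar>sin (l * y) / l\<bar> \<le> \<bar>y\<bar>" for y :: real
  proof -
    have "\<bar>sin (l * y) - l * y\<bar> \<le> (l * y)\<^sup>2 / 2"
      using Maclaurin_sin_bound[of "l * y" 2] by (simp add: numeral_2_eq_2 sin_coeff_def)
    moreover have "\<bar>y - sin (l * y) / l\<bar> = \<bar>sin (l * y) - l * y\<bar> / l"
    proof -
      have "y - sin (l * y) / l = - (sin (l * y) - l * y) / l" using l(1) by (simp add: field_simps)
      then show ?thesis using l(1) by (simp only: abs_divide abs_minus_cancel abs_of_pos)
    qed
    ultimately have "\<bar>y - sin (l * y) / l\<bar> \<le> (l * y)\<^sup>2 / 2 / l"
      using l(1) by (simp only: divide_right_mono less_imp_le)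
    also have "\<dots> \<le> l * y\<^sup>2" using l(1) by (simp add: power2_eq_square)
    finally show "\<bar>y - sin (l * y) / l\<bar> \<le> l * y\<^sup>2" .
    show "\<bar>sin (l * y) / l\<bar> \<le> \<bar>y\<bar>"
      using Maclaurin_sin_bound[of "l * y" 1] l(1) by (simp add: sin_coeff_def abs_mult field_simps)
  qed
  have close: "norm (x - (1 / l) *\<^sub>R s l x) < d \<and> norm ((1 / l) *\<^sub>R s l x) \<le> 2 * R * n" if "norm x \<le> R" for x
  proof -
    have xj: "\<bar>x $ j\<bar> \<le> R" for j using component_le_norm_cart[of x j] that by linarith
    have "norm (x - (1 / l) *\<^sub>R s l x) \<le> (\<Sum>j\<in>UNIV. \<bar>(x - (1 / l) *\<^sub>R s l x) $ j\<bar>)"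
      by (rule norm_le_l1_cart)
    also have "\<dots> \<le> (\<Sum>j\<in>(UNIV::'n set). l * R\<^sup>2)"
    proof (rule sum_mono)
      fix j
      have "\<bar>(x - (1 / l) *\<^sub>R s l x) $ j\<bar> \<le> l * (x $ j)\<^sup>2"
        using sin_approx(1)[of "x $ j"] by (simp add: s_def)
      also have "\<dots> \<le> l * R\<^sup>2"
        using l(1) power_mono[OF xj[of j], of 2] by (intro mult_left_mono) auto
      finally show "\<bar>(x - (1 / l) *\<^sub>R s l x) $ j\<bar> \<le> l * R\<^sup>2" .
    qed
    also have "\<dots> < d" using l by (simp add: n_def)
    finally have 1: "norm (x - (1 / l) *\<^sub>R s l x) < d" .
    have "norm ((1 / l) *\<^sub>R s l x) \<le> (\<Sum>j\<in>UNIV. \<bar>((1 / l) *\<^sub>R s l x) $ j\<bar>)"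
      by (rule norm_le_l1_cart)
    also have "\<dots> \<le> (\<Sum>j\<in>(UNIV::'n set). R)"
    proof (rule sum_mono)
      fix j
      have "\<bar>((1 / l) *\<^sub>R s l x) $ j\<bar> \<le> \<bar>x $ j\<bar>"
        using sin_approx(2)[of "x $ j"] by (simp add: s_def)
      then show "\<bar>((1 / l) *\<^sub>R s l x) $ j\<bar> \<le> R" using xj[of j] by linarith
    qed
    also have "\<dots> \<le> 2 * R * n" using \<open>R > 0\<close> \<open>n > 0\<close> by (simp add: n_def)
    finally show ?thesis using 1 by blast
  qed
  \<comment> \<open>All vectors of sines lie in one compact ball, so approximating on that ball
    already gives a bound valid for every \<open>x\<close>.\<close>
  obtain p where p: "real_polynomial_function p" "\<And>y. y \<in> cball 0 n \<Longrightarrow> \<bar>f ((1 / l) *\<^sub>R y) - p y\<bar> < e / 2"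
    by (rule Stone_Weierstrass_real_polynomial_function[of "cball 0 n" "\<lambda>y. f ((1 / l) *\<^sub>R y)" "e / 2"])
       (use \<open>e > 0\<close> in \<open>auto intro!: continuous_intros continuous_on_compose2[OF f(1)]\<close>)
  have sn: "s l x \<in> cball 0 n" for x
  proof -
    have "norm (s l x) \<le> (\<Sum>j\<in>UNIV. \<bar>s l x $ j\<bar>)" by (rule norm_le_l1_cart)
    also have "\<dots> \<le> (\<Sum>j\<in>(UNIV::'n set). 1)" by (intro sum_mono) (simp add: s_def)
    finally show ?thesis by (simp add: n_def)
  qed
  show ?thesis
  proof (rule that[of "\<lambda>x. p (s l x)"])
    show "(\<lambda>x. p (s l x)) \<in> trig_sums"
      unfolding s_def by (rule real_polynomial_function_sin_trig_sums[OF p(1)])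
    show "\<bar>p (s l x)\<bar> \<le> B + e" for x
      using p(2)[OF sn[of x]] f(2)[of "(1 / l) *\<^sub>R s l x"] \<open>e > 0\<close> by linarith
    fix x :: "real^'n" assume x: "norm x \<le> R"
    have "R \<le> 2 * R * n" using \<open>R > 0\<close> \<open>n \<ge> 1\<close> by (simp add: mult_le_cancel_left1[of R "2 * n", simplified])
    then have "\<bar>f x - f ((1 / l) *\<^sub>R s l x)\<bar> < e / 2"
      using d(2)[of x "(1 / l) *\<^sub>R s l x"] close[OF x] x by (simp add: n_def)
    then show "\<bar>f x - p (s l x)\<bar> \<le> e"
      using p(2)[OF sn[of x]] by linarith
  qed
qed

section \<open>Sums of independent bounded vectors\<close>

lemma (in prob_space) indep_vars_imp_indep_var:
  assumes "indep_vars M' X I" "i \<in> I" "j \<in> I" "i \<noteq> j"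
  shows "indep_var (M' i) (X i) (M' j) (X j)"
proof -
  have "indep_var (M' i) ((\<lambda>g. g i) \<circ> (\<lambda>\<omega>. restrict (\<lambda>i. X i \<omega>) {i})) (M' j) ((\<lambda>g. g j) \<circ> (\<lambda>\<omega>. restrict (\<lambda>i. X i \<omega>) {j}))"
    by (rule indep_var_compose[OF indep_var_restrict[OF assms(1)]]) (use assms in auto)
  then show ?thesis by (simp add: comp_def)
qed

text \<open>Fubini for the joint law, which independence makes a product: for fixed \<open>x\<close>
  the inner product passes through the expectation of \<open>Y\<close>, and then likewise for
  \<open>X\<close>.\<close>

lemma (in prob_space) indep_var_expectation_inner:
  fixes X Y :: "'a \<Rightarrow> 'e::{real_inner,banach,second_countable_topology}"
  assumes ind: "indep_var borel X borel Y"
    and b: "\<And>\<omega>. norm (X \<omega>) \<le> b" "\<And>\<omega>. norm (Y \<omega>) \<le> b"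
  shows "expectation (\<lambda>\<omega>. X \<omega> \<bullet> Y \<omega>) = expectation X \<bullet> expectation Y"
proof -
  have [measurable]: "X \<in> borel_measurable M" "Y \<in> borel_measurable M"
    using ind by (blast dest: indep_var_rv1 indep_var_rv2)+
  interpret X: prob_space "distr M borel X" by (rule prob_space_distr) simp
  interpret Y: prob_space "distr M borel Y" by (rule prob_space_distr) simp
  interpret XY: pair_prob_space "distr M borel X" "distr M borel Y" ..
  have eq: "distr M borel X \<Otimes>\<^sub>M distr M borel Y = distr M (borel \<Otimes>\<^sub>M borel) (\<lambda>x. (X x, Y x))"
    using ind by (simp add: indep_var_distribution_eq)
  have iY: "integrable M Y" by (rule integrable_const_bound[of _ b]) (use b in auto)
  have iX: "integrable M X" by (rule integrable_const_bound[of _ b]) (use b in auto)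
  have "b \<ge> 0" using order.trans[OF norm_ge_zero b(1)] .
  have int: "integrable (distr M borel X \<Otimes>\<^sub>M distr M borel Y) (\<lambda>z. fst z \<bullet> snd z)"
    unfolding eq
  proof (subst integrable_distr_eq)
    show "integrable M (\<lambda>x. fst (X x, Y x) \<bullet> snd (X x, Y x))"
      by (rule integrable_const_bound[of _ "b * b"])
         (use b \<open>b \<ge> 0\<close> in \<open>auto intro!: order.trans[OF Cauchy_Schwarz_ineq2] mult_mono\<close>)
  qed simp_all
  have "expectation (\<lambda>\<omega>. X \<omega> \<bullet> Y \<omega>) = integral\<^sup>L (distr M borel X \<Otimes>\<^sub>M distr M borel Y) (\<lambda>z. fst z \<bullet> snd z)"
    unfolding eq by (subst integral_distr) auto
  also have "\<dots> = (\<integral>x. (\<integral>y. x \<bullet> y \<partial>distr M borel Y) \<partial>distr M borel X)"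
    using XY.integral_fst'[OF int] by simp
  also have "\<dots> = (\<integral>x. x \<bullet> expectation Y \<partial>distr M borel X)"
    using iY by (intro Bochner_Integration.integral_cong refl) (simp add: integral_distr)
  also have "\<dots> = expectation X \<bullet> expectation Y"
    using iX by (simp add: integral_distr)
  finally show ?thesis .
qed

text \<open>Centred independent vectors are orthogonal in mean square, so only the \<open>n\<close>
  diagonal terms survive. This gives the rate \<open>n^(-1/2)\<close> for averages in a Hilbert
  space, whatever its dimension.\<close>

lemma (in prob_space) expectation_norm_sum_sq_le:
  fixes V :: "nat \<Rightarrow> 'a \<Rightarrow> 'e::{real_inner,banach,second_countable_topology}"
  assumes ind: "indep_vars (\<lambda>_. borel) V UNIV"
    and b: "\<And>i \<omega>. norm (V i \<omega>) \<le> b" and mean: "\<And>i. expectation (V i) = 0"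
  shows "expectation (\<lambda>\<omega>. (norm (\<Sum>i<n. V i \<omega>))\<^sup>2) \<le> real n * b\<^sup>2"
proof -
  have [measurable]: "V i \<in> borel_measurable M" for i
    using ind by (simp add: indep_vars_def)
  have "b \<ge> 0" using order.trans[OF norm_ge_zero b] .
  have bb: "\<bar>V i \<omega> \<bullet> V j \<omega>\<bar> \<le> b\<^sup>2" for i j \<omega>
    unfolding power2_eq_square
    by (intro order.trans[OF Cauchy_Schwarz_ineq2] mult_mono b \<open>b \<ge> 0\<close> norm_ge_zero)
  have int: "integrable M (\<lambda>\<omega>. V i \<omega> \<bullet> V j \<omega>)" for i j
    by (rule integrable_const_bound[of _ "b\<^sup>2"]) (use bb in auto)
  have cov: "expectation (\<lambda>\<omega>. V i \<omega> \<bullet> V j \<omega>) \<le> (if i = j then b\<^sup>2 else 0)" for i j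
  proof (cases "i = j")
    case True
    have "expectation (\<lambda>\<omega>. V i \<omega> \<bullet> V j \<omega>) \<le> expectation (\<lambda>_. b\<^sup>2)"
      by (intro integral_mono int) (use bb[of i _ j] in \<open>auto simp: abs_le_iff\<close>)
    then show ?thesis using True by (simp add: prob_space)
  next
    case False
    show ?thesis
      using indep_var_expectation_inner[OF indep_vars_imp_indep_var[OF ind _ _ False] b b] mean False by simp
  qed
  have "expectation (\<lambda>\<omega>. (norm (\<Sum>i<n. V i \<omega>))\<^sup>2) = (\<Sum>i<n. \<Sum>j<n. expectation (\<lambda>\<omega>. V i \<omega> \<bullet> V j \<omega>))"
    by (simp add: power2_norm_eq_inner inner_sum_left inner_sum_right int)
       (rule sum.swap)
  also have "\<dots> \<le> (\<Sum>i<n. \<Sum>j<n. if i = j then b\<^sup>2 else 0)"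
    by (intro sum_mono cov)
  also have "\<dots> = real n * b\<^sup>2" by simp
  finally show ?thesis .
qed

text \<open>For positive variance this is the classical limit theorem tested on a bounded continuous
  function. For \<open>v = 0\<close> all summands vanish almost surely, and the limit is the Dirac
  measure at 0.\<close>

lemma (in prob_space) clt_cos:
  fixes Z :: "nat \<Rightarrow> 'a \<Rightarrow> real"
  assumes ind: "indep_vars (\<lambda>_. borel) Z UNIV"
    and law: "\<And>i. distr M borel (Z i) = \<mu>"
    and b: "\<And>i \<omega>. \<bar>Z i \<omega>\<bar> \<le> b" and mean: "\<And>i. expectation (Z i) = 0"
    and v: "\<And>i. expectation (\<lambda>\<omega>. (Z i \<omega>)\<^sup>2) = v"
  shows "(\<lambda>n. expectation (\<lambda>\<omega>. cos ((\<Sum>i<n. Z i \<omega>) / sqrt (real n) + a))) \<longlonglongrightarrow> (\<integral>y. cos (y + a) \<partial>normal1 v)"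
proof -
  have [measurable]: "Z i \<in> borel_measurable M" for i
    using ind by (simp add: indep_vars_def)
  have int: "integrable M (\<lambda>\<omega>. (Z i \<omega>)\<^sup>2)" for i
  proof (rule integrable_const_bound[of _ "b\<^sup>2"])
    have "(Z i \<omega>)\<^sup>2 \<le> b\<^sup>2" for \<omega> using power_mono[OF b[of i \<omega>], of 2] by simp
    then show "AE \<omega> in M. norm ((Z i \<omega>)\<^sup>2) \<le> b\<^sup>2" by simp
  qed simp
  have v0: "v \<ge> 0" using v[of 0] by (metis integral_nonneg_AE zero_le_power2 AE_I2)
  have lim: "(\<integral>y. cos (y + a) \<partial>normal1 v) = (\<integral>y. cos (sqrt v * y + a) \<partial>std_normal_distribution)"
    unfolding normal1_eq_distr[OF v0] by (subst integral_distr) auto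
  show ?thesis
  proof (cases "v = 0")
    case True
    have "AE \<omega> in M. Z i \<omega> = 0" for i
      using integral_nonneg_eq_0_iff_AE[OF int[of i]] v[of i] True by simp
    then have AE: "AE \<omega> in M. \<forall>i. Z i \<omega> = 0" by (simp add: AE_all_countable)
    have "expectation (\<lambda>\<omega>. cos ((\<Sum>i<n. Z i \<omega>) / sqrt (real n) + a)) = expectation (\<lambda>\<omega>. cos a)" for n
      by (rule integral_cong_AE) (use AE in \<open>auto elim!: eventually_mono\<close>)
    then show ?thesis using True by (simp add: prob_space normal1_def integral_return)
  next
    case False
    then have sv: "sqrt v > 0" using v0 by simp
    have "weak_conv_m (\<lambda>n. distr M borel (\<lambda>x. (\<Sum>i<n. Z i x) / sqrt (real n * (sqrt v)\<^sup>2))) std_normal_distribution"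
      by (rule central_limit_theorem_zero_mean[OF ind mean sv int _ law]) (use mean v v0 in simp)
    \<comment> \<open>The factor \<open>sqrt v\<close> moves from the normalisation into the test
      function.\<close>
    then have "(\<lambda>n. \<integral>y. cos (sqrt v * y + a) \<partial>distr M borel (\<lambda>x. (\<Sum>i<n. Z i x) / sqrt (real n * v)))
        \<longlonglongrightarrow> (\<integral>y. cos (sqrt v * y + a) \<partial>std_normal_distribution)"
      using v0 by (intro weak_conv_imp_integral_bdd_continuous_conv[where B=1])
        (auto intro!: real_distribution_distr real_dist_normal_dist)
    moreover have "(\<integral>y. cos (sqrt v * y + a) \<partial>distr M borel (\<lambda>x. (\<Sum>i<n. Z i x) / sqrt (real n * v)))
        = expectation (\<lambda>\<omega>. cos ((\<Sum>i<n. Z i \<omega>) / sqrt (real n) + a))" for n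
      using sv by (subst integral_distr) (auto simp: real_sqrt_mult)
    ultimately show ?thesis by (simp add: lim)
  qed
qed

section \<open>Convergence in law\<close>

text \<open>The exceptional event \<open>P\<close> will be either a tail event, when one test
  function replaces another, or a large discrepancy, when one random vector replaces
  another.\<close>

lemma (in prob_space) expectation_diff_bound:
  fixes f g :: "'a \<Rightarrow> real"
  assumes [measurable]: "f \<in> borel_measurable M" "g \<in> borel_measurable M" "{\<omega>\<in>space M. P \<omega>} \<in> sets M"
    and b: "\<And>\<omega>. \<bar>f \<omega>\<bar> \<le> b" "\<And>\<omega>. \<bar>g \<omega>\<bar> \<le> c"
    and e: "\<And>\<omega>. \<not> P \<omega> \<Longrightarrow> \<bar>f \<omega> - g \<omega>\<bar> \<le> e" and "e \<ge> 0"
  shows "\<bar>expectation f - expectation g\<bar> \<le> e + (b + c) * prob {\<omega>\<in>space M. P \<omega>}"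
proof -
  let ?S = "{\<omega>\<in>space M. P \<omega>}"
  have i: "integrable M f" "integrable M g"
    by (rule integrable_const_bound[of _ b] integrable_const_bound[of _ c]; use b in auto)+
  have "\<bar>expectation f - expectation g\<bar> = \<bar>expectation (\<lambda>\<omega>. f \<omega> - g \<omega>)\<bar>" using i by simp
  also have "\<dots> \<le> expectation (\<lambda>\<omega>. \<bar>f \<omega> - g \<omega>\<bar>)" by (rule integral_abs_bound)
  also have "\<dots> \<le> expectation (\<lambda>\<omega>. e + (b + c) * indicator ?S \<omega>)"
  proof (rule integral_mono)
    show "integrable M (\<lambda>\<omega>. \<bar>f \<omega> - g \<omega>\<bar>)" using i by simp
    show "integrable M (\<lambda>\<omega>. e + (b + c) * indicat_real ?S \<omega>)"
      by (intro Bochner_Integration.integrable_add integrable_const integrable_mult_right integrable_real_indicator)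
         (auto simp: emeasure_eq_measure)
    fix \<omega> assume "\<omega> \<in> space M"
    then show "\<bar>f \<omega> - g \<omega>\<bar> \<le> e + (b + c) * indicator ?S \<omega>"
      using b(1)[of \<omega>] b(2)[of \<omega>] e[of \<omega>] \<open>e \<ge> 0\<close> by (cases "P \<omega>") auto
  qed
  also have "\<dots> = e + (b + c) * prob ?S"
    by (subst Bochner_Integration.integral_add) (auto simp: prob_space emeasure_eq_measure)
  finally show ?thesis .
qed

text \<open>A trigonometric sum is close to the test function only on a ball. Tightness makes the
  mass outside small uniformly in large \<open>n\<close>, and there the global bound on the
  approximant takes over.\<close>

lemma (in prob_space) conv_in_law_of_cos:
  fixes W :: "nat \<Rightarrow> 'a \<Rightarrow> real^('p::finite)"
  assumes W[measurable]: "\<And>n. W n \<in> borel_measurable M"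
    and tight: "\<And>e. e > 0 \<Longrightarrow> \<exists>R. \<forall>\<^sub>F n in sequentially. prob {\<omega>\<in>space M. norm (W n \<omega>) > R} \<le> e"
    and N: "prob_space N" and sN[measurable_cong]: "sets N = sets borel"
    and cos: "\<And>t a. (\<lambda>n. expectation (\<lambda>\<omega>. cos (t \<bullet> W n \<omega> + a))) \<longlonglongrightarrow> (\<integral>x. cos (t \<bullet> x + a) \<partial>N)"
  shows "conv_in_law M W N"
  unfolding conv_in_law_def
proof (intro allI impI)
  interpret N: prob_space N by (rule N)
  fix f :: "real^'p \<Rightarrow> real"
  assume f: "continuous_on UNIV f \<and> bounded (range f)"
  then obtain B where B: "\<And>x. \<bar>f x\<bar> \<le> B" "B > 0"
    by (auto simp: bounded_pos)
  have fm[measurable]: "f \<in> borel_measurable borel"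
    using f by (simp add: borel_measurable_continuous_onI)
  have trig_meas: "g \<in> borel_measurable borel" if "g \<in> trig_sums" for g :: "real^'p \<Rightarrow> real"
    using trig_sums_bounded_continuous(1)[OF that] by (rule borel_measurable_continuous_onI)
  have trig: "(\<lambda>n. expectation (\<lambda>\<omega>. g (W n \<omega>))) \<longlonglongrightarrow> (\<integral>x. g x \<partial>N)" if "g \<in> trig_sums" for g :: "real^'p \<Rightarrow> real"
    using that
  proof induction
    case (cos c t a)
    show ?case using tendsto_mult_left[OF assms(5)[of t a], of c] by simp
  next
    case (add f g)
    have *: "integrable M (\<lambda>\<omega>. h (W n \<omega>)) \<and> integrable N h" if h: "h \<in> trig_sums" for h :: "real^'p \<Rightarrow> real" and n
    proof -
      obtain C where C: "\<And>x. \<bar>h x\<bar> \<le> C" using trig_sums_bounded_continuous(2)[OF h] by blast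
      note [measurable] = trig_meas[OF h]
      show ?thesis
        using C by (auto intro!: integrable_const_bound[of _ C] N.integrable_const_bound[of _ C])
    qed
    show ?case
      using tendsto_add[OF add.IH] *[OF add.hyps(1)] *[OF add.hyps(2)] by simp
  qed
  show "(\<lambda>n. expectation (\<lambda>\<omega>. f (W n \<omega>))) \<longlonglongrightarrow> (\<integral>x. f x \<partial>N)"
  proof (rule LIMSEQ_I)
    fix r :: real assume "r > 0"
    \<comment> \<open>Two replacements of \<open>f\<close> by \<open>g\<close>, under the law of
      \<open>W n\<close> and under \<open>N\<close>, and one convergence error add up to
      \<open>2 * (e + (2 * B + e) * e) + e\<close>, at most \<open>e * (5 + 4 * B)\<close> as
      \<open>e \<le> 1\<close>.\<close>
    define e where "e = min 1 (r / (2 * (5 + 4 * B)))"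
    have e: "e > 0" "e \<le> 1" using \<open>r > 0\<close> B(2) by (auto simp: e_def)
    have er: "e * (5 + 4 * B) < r"
    proof -
      have "e \<le> r / (2 * (5 + 4 * B))" by (simp add: e_def)
      then have "e * (5 + 4 * B) \<le> r / 2" using B(2) by (simp add: field_simps)
      then show ?thesis using \<open>r > 0\<close> by simp
    qed
    obtain R1 where R1: "\<forall>\<^sub>F n in sequentially. prob {\<omega>\<in>space M. norm (W n \<omega>) > R1} \<le> e"
      using tight[OF e(1)] by blast
    have "(\<lambda>k. N.prob {x\<in>space N. norm x > real k}) \<longlonglongrightarrow> N.prob (\<Inter>k. {x\<in>space N. norm x > real k})"
      by (rule N.finite_Lim_measure_decseq) (auto simp: decseq_def)
    also have "(\<Inter>k. {x\<in>space N. norm x > real k}) = {}"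
      by (auto simp: set_eq_iff not_less intro: real_arch_simple)
    finally have "(\<lambda>k. N.prob {x\<in>space N. norm x > real k}) \<longlonglongrightarrow> 0" by simp
    then have "\<forall>\<^sub>F k in sequentially. N.prob {x\<in>space N. norm x > real k} < e"
      using e(1) by (rule order_tendstoD)
    then obtain k where k: "N.prob {x\<in>space N. norm x > real k} < e"
      by (auto simp: eventually_sequentially)
    define R where "R = max 1 (max R1 (real k))"
    have "R > 0" by (simp add: R_def)
    obtain g where g: "g \<in> trig_sums" "\<And>x. \<bar>g x\<bar> \<le> B + e" "\<And>x. norm x \<le> R \<Longrightarrow> \<bar>f x - g x\<bar> \<le> e"
      using trig_sums_approx[of f B R e] f B \<open>R > 0\<close> e(1) by blast
    note [measurable] = trig_meas[OF g(1)]
    have Nfg: "\<bar>(\<integral>x. f x \<partial>N) - (\<integral>x. g x \<partial>N)\<bar> \<le> e + (B + (B + e)) * e"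
    proof -
      have "\<bar>(\<integral>x. f x \<partial>N) - (\<integral>x. g x \<partial>N)\<bar> \<le> e + (B + (B + e)) * N.prob {x\<in>space N. norm x > R}"
        by (rule N.expectation_diff_bound) (use B g e in \<open>auto simp: not_less\<close>)
      also have "N.prob {x\<in>space N. norm x > R} \<le> N.prob {x\<in>space N. norm x > real k}"
        by (rule N.finite_measure_mono) (auto simp: R_def)
      finally show ?thesis using k B(2) e mult_left_mono[of _ e "B + (B + e)"]
        by (smt (verit) mult_left_mono)
    qed
    have "\<forall>\<^sub>F n in sequentially. \<bar>expectation (\<lambda>\<omega>. g (W n \<omega>)) - (\<integral>x. g x \<partial>N)\<bar> < e"
      using trig[OF g(1)] e(1) by (auto simp: tendsto_iff dist_real_def)
    with R1 have "\<forall>\<^sub>F n in sequentially. \<bar>expectation (\<lambda>\<omega>. f (W n \<omega>)) - (\<integral>x. f x \<partial>N)\<bar> < r"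
    proof eventually_elim
      case (elim n)
      have "\<bar>expectation (\<lambda>\<omega>. f (W n \<omega>)) - expectation (\<lambda>\<omega>. g (W n \<omega>))\<bar>
          \<le> e + (B + (B + e)) * prob {\<omega>\<in>space M. norm (W n \<omega>) > R}"
        by (rule expectation_diff_bound) (use B g e in \<open>auto simp: not_less\<close>)
      moreover have "prob {\<omega>\<in>space M. norm (W n \<omega>) > R} \<le> prob {\<omega>\<in>space M. norm (W n \<omega>) > R1}"
        by (rule finite_measure_mono) (auto simp: R_def)
      ultimately have "\<bar>expectation (\<lambda>\<omega>. f (W n \<omega>)) - expectation (\<lambda>\<omega>. g (W n \<omega>))\<bar> \<le> e + (B + (B + e)) * e"
        using elim(1) B(2) e mult_left_mono[of "prob {\<omega>\<in>space M. norm (W n \<omega>) > R}" e "B + (B + e)"] by linarith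
      then have "\<bar>expectation (\<lambda>\<omega>. f (W n \<omega>)) - (\<integral>x. f x \<partial>N)\<bar> < 2 * (e + (B + (B + e)) * e) + e"
        using Nfg elim(2) unfolding abs_le_iff abs_less_iff by argo
      also have "\<dots> \<le> e * (5 + 4 * B)"
        using mult_left_mono[OF e(2), of e] e(1) by (simp add: algebra_simps)
      finally show ?case using er by linarith
    qed
    then show "\<exists>no. \<forall>n\<ge>no. norm (expectation (\<lambda>\<omega>. f (W n \<omega>)) - (\<integral>x. f x \<partial>N)) < r"
      by (simp add: eventually_sequentially)
  qed
qed

lemma abs_cos_diff_le: "\<bar>cos x - cos y\<bar> \<le> \<bar>x - y\<bar>" for x y :: real
proof -
  have "\<bar>sin ((y - x) / 2)\<bar> \<le> \<bar>(y - x) / 2\<bar>"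
    using Maclaurin_sin_bound[of "(y - x) / 2" 1] by (simp add: sin_coeff_def)
  then have "\<bar>sin ((x + y) / 2)\<bar> * \<bar>sin ((y - x) / 2)\<bar> \<le> 1 * \<bar>(y - x) / 2\<bar>"
    by (intro mult_mono) auto
  then show ?thesis by (simp add: cos_diff_cos abs_mult abs_minus_commute)
qed

text \<open>A Slutsky argument. By Markov, \<open>sqrt n * \<delta> n\<close> is bounded in
  probability and \<open>\<delta> n < d\<close> holds with probability tending to 1 for each fixed
  \<open>d\<close>. As \<open>\<eta>\<close> is arbitrary, \<open>W n - T n\<close> tends to 0 in
  probability; tightness of \<open>W\<close> and the limits of cosines are inherited from
  \<open>T\<close>.\<close>

lemma (in prob_space) conv_in_law_of_expansion:
  fixes W T :: "nat \<Rightarrow> 'a \<Rightarrow> real^('p::finite)" and \<delta> :: "nat \<Rightarrow> 'a \<Rightarrow> real"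
  assumes [measurable]: "\<And>n. W n \<in> borel_measurable M" "\<And>n. T n \<in> borel_measurable M"
    and \<delta>: "\<And>n \<omega>. 0 \<le> \<delta> n \<omega>" "\<And>n. integrable M (\<lambda>\<omega>. (\<delta> n \<omega>)\<^sup>2)"
      "\<And>n. n \<ge> 1 \<Longrightarrow> expectation (\<lambda>\<omega>. (\<delta> n \<omega>)\<^sup>2) \<le> C / real n"
    and \<delta>m[measurable]: "\<And>n. \<delta> n \<in> borel_measurable M"
    and T: "\<And>n \<omega>. norm (T n \<omega>) \<le> K * (sqrt (real n) * \<delta> n \<omega>)"
    and exp: "\<And>\<eta>. \<eta> > 0 \<Longrightarrow> \<exists>d>0. \<forall>n\<ge>1. AE \<omega> in M. \<delta> n \<omega> < d \<longrightarrow> norm (W n \<omega> - T n \<omega>) \<le> \<eta> * (sqrt (real n) * \<delta> n \<omega>)"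
    and N: "prob_space N" and sN: "sets N = sets borel"
    and cos: "\<And>t a. (\<lambda>n. expectation (\<lambda>\<omega>. cos (t \<bullet> T n \<omega> + a))) \<longlonglongrightarrow> (\<integral>x. cos (t \<bullet> x + a) \<partial>N)"
  shows "conv_in_law M W N"
proof -
  have C: "C \<ge> 0" using order.trans[OF integral_nonneg_AE \<delta>(3)[of 1]] by simp
  have cheb: "prob {\<omega>\<in>space M. (\<delta> n \<omega>)\<^sup>2 \<ge> c} \<le> C / real n / c" if "c > 0" "n \<ge> 1" for n c
  proof -
    have "prob {\<omega>\<in>space M. (\<delta> n \<omega>)\<^sup>2 \<ge> c} \<le> expectation (\<lambda>\<omega>. (\<delta> n \<omega>)\<^sup>2) / c"
      by (rule integral_Markov_inequality_measure[OF \<delta>(2) sets.top]) (use that in auto)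
    also have "\<dots> \<le> C / real n / c" using \<delta>(3)[OF that(2)] that(1) by (intro divide_right_mono) auto
    finally show ?thesis .
  qed
  have cheb': "prob {\<omega>\<in>space M. sqrt (real n) * \<delta> n \<omega> \<ge> c} \<le> C / c\<^sup>2" if "c > 0" "n \<ge> 1" for n c
  proof -
    have "prob {\<omega>\<in>space M. sqrt (real n) * \<delta> n \<omega> \<ge> c} \<le> prob {\<omega>\<in>space M. (\<delta> n \<omega>)\<^sup>2 \<ge> c\<^sup>2 / real n}"
    proof (rule finite_measure_mono)
      have "c\<^sup>2 / real n \<le> (\<delta> n \<omega>)\<^sup>2" if "c \<le> sqrt (real n) * \<delta> n \<omega>" for \<omega>
        using power_mono[OF that, of 2] \<open>c > 0\<close> \<open>n \<ge> 1\<close> by (simp add: power_mult_distrib field_simps)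
      then show "{\<omega>\<in>space M. sqrt (real n) * \<delta> n \<omega> \<ge> c} \<subseteq> {\<omega>\<in>space M. (\<delta> n \<omega>)\<^sup>2 \<ge> c\<^sup>2 / real n}" by auto
    qed simp
    also have "\<dots> \<le> C / real n / (c\<^sup>2 / real n)" by (rule cheb) (use that in auto)
    finally show ?thesis using that by simp
  qed
  have inprob: "(\<lambda>n. prob {\<omega>\<in>space M. norm (W n \<omega> - T n \<omega>) > \<epsilon>}) \<longlonglongrightarrow> 0" if "\<epsilon> > 0" for \<epsilon>
  proof (rule LIMSEQ_I)
    fix r :: real assume "r > 0"
    \<comment> \<open>Makes \<open>C / c\<^sup>2\<close> smaller than \<open>r / 2\<close>; the
      summand 1 keeps \<open>c\<close> positive when \<open>C = 0\<close>.\<close>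
    define c where "c = sqrt (2 * (C + 1) / r)"
    have c: "c > 0" using \<open>r > 0\<close> C by (simp add: c_def)
    have c2: "C / c\<^sup>2 < r / 2"
    proof -
      have "c\<^sup>2 = 2 * (C + 1) / r" using \<open>r > 0\<close> C by (simp add: c_def)
      then have "C / c\<^sup>2 = r / 2 * (C / (C + 1))" by simp
      also have "\<dots> < r / 2 * 1" using \<open>r > 0\<close> C by (intro mult_strict_left_mono) auto
      finally show ?thesis by simp
    qed
    \<comment> \<open>With \<open>\<eta> = \<epsilon> / c\<close> the error is at most
      \<open>\<epsilon>\<close> as soon as \<open>sqrt n * \<delta> n < c\<close>.\<close>
    obtain d where d: "d > 0" "\<forall>n\<ge>1. AE \<omega> in M. \<delta> n \<omega> < d \<longrightarrow> norm (W n \<omega> - T n \<omega>) \<le> (\<epsilon> / c) * (sqrt (real n) * \<delta> n \<omega>)"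
      using exp[OF divide_pos_pos[OF \<open>\<epsilon> > 0\<close> c]] by blast
    have "(\<lambda>n. C / real n / d\<^sup>2) \<longlonglongrightarrow> 0 / d\<^sup>2"
      by (intro tendsto_divide lim_const_over_n tendsto_const) (use d in auto)
    then have "\<forall>\<^sub>F n in sequentially. C / real n / d\<^sup>2 < r / 2"
      using \<open>r > 0\<close> by (intro order_tendstoD(2)[of _ "0 / d\<^sup>2"]) auto
    then have "\<forall>\<^sub>F n in sequentially. prob {\<omega>\<in>space M. norm (W n \<omega> - T n \<omega>) > \<epsilon>} < r"
      using eventually_ge_at_top[of 1]
    proof eventually_elim
      case (elim n)
      let ?A = "{\<omega>\<in>space M. (\<delta> n \<omega>)\<^sup>2 \<ge> d\<^sup>2}" and ?B = "{\<omega>\<in>space M. sqrt (real n) * \<delta> n \<omega> \<ge> c}"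
      have "prob {\<omega>\<in>space M. norm (W n \<omega> - T n \<omega>) > \<epsilon>} \<le> prob (?A \<union> ?B)"
      proof (rule finite_measure_mono_AE)
        show "AE \<omega> in M. \<omega> \<in> {\<omega>\<in>space M. norm (W n \<omega> - T n \<omega>) > \<epsilon>} \<longrightarrow> \<omega> \<in> ?A \<union> ?B"
          using d(2)[rule_format, OF elim(2)]
        proof eventually_elim
          case (elim \<omega>)
          show ?case
          proof (rule impI, rule ccontr)
            assume a: "\<omega> \<in> {\<omega>\<in>space M. norm (W n \<omega> - T n \<omega>) > \<epsilon>}" and na: "\<omega> \<notin> ?A \<union> ?B"
            then have 1: "(\<delta> n \<omega>)\<^sup>2 < d\<^sup>2" and 2: "sqrt (real n) * \<delta> n \<omega> < c" by auto
            have "\<delta> n \<omega> < d" using 1 d(1) power_less_imp_less_base[of "\<delta> n \<omega>" 2 d] by simp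
            then have "norm (W n \<omega> - T n \<omega>) \<le> (\<epsilon> / c) * (sqrt (real n) * \<delta> n \<omega>)" using elim by simp
            also have "\<dots> \<le> (\<epsilon> / c) * c" using 2 that c(1) by (intro mult_left_mono) auto
            also have "\<dots> = \<epsilon>" using c(1) by simp
            finally show False using a by simp
          qed
        qed
      qed simp
      also have "\<dots> \<le> prob ?A + prob ?B" by (rule measure_Un_le) auto
      also have "\<dots> < r" using cheb[OF zero_less_power[OF d(1)] elim(2), of 2] cheb'[OF c elim(2)] elim(1) c2 by linarith
      finally show ?case .
    qed
    then show "\<exists>no. \<forall>n\<ge>no. norm (prob {\<omega>\<in>space M. norm (W n \<omega> - T n \<omega>) > \<epsilon>} - 0) < r"
      by (simp add: eventually_sequentially)
  qed
  show ?thesis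
  proof (rule conv_in_law_of_cos[OF _ _ N sN])
    fix e :: real assume "e > 0"
    define c where "c = sqrt (2 * (C + 1) / e)"
    have c: "c > 0" using \<open>e > 0\<close> C by (simp add: c_def)
    have c2: "C / c\<^sup>2 < e / 2"
    proof -
      have "c\<^sup>2 = 2 * (C + 1) / e" using \<open>e > 0\<close> C by (simp add: c_def)
      then have "C / c\<^sup>2 = e / 2 * (C / (C + 1))" by simp
      also have "\<dots> < e / 2 * 1" using \<open>e > 0\<close> C by (intro mult_strict_left_mono) auto
      finally show ?thesis by simp
    qed
    have "\<forall>\<^sub>F n in sequentially. prob {\<omega>\<in>space M. norm (W n \<omega> - T n \<omega>) > 1} < e / 2"
      using order_tendstoD(2)[OF inprob[of 1], of "e / 2"] \<open>e > 0\<close> by simp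
    \<comment> \<open>The radius adds the bound 1 on \<open>W n - T n\<close> to the bound
      \<open>\<bar>K\<bar> * c\<close> on \<open>T n\<close>.\<close>
    then have "\<forall>\<^sub>F n in sequentially. prob {\<omega>\<in>space M. norm (W n \<omega>) > 1 + \<bar>K\<bar> * c} \<le> e"
      using eventually_ge_at_top[of 1]
    proof eventually_elim
      case (elim n)
      let ?A = "{\<omega>\<in>space M. norm (W n \<omega> - T n \<omega>) > 1}" and ?B = "{\<omega>\<in>space M. sqrt (real n) * \<delta> n \<omega> \<ge> c}"
      have "prob {\<omega>\<in>space M. norm (W n \<omega>) > 1 + \<bar>K\<bar> * c} \<le> prob (?A \<union> ?B)"
      proof (rule finite_measure_mono)
        show "{\<omega>\<in>space M. norm (W n \<omega>) > 1 + \<bar>K\<bar> * c} \<subseteq> ?A \<union> ?B"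
        proof (rule subsetI, rule ccontr)
          fix \<omega> assume a: "\<omega> \<in> {\<omega>\<in>space M. norm (W n \<omega>) > 1 + \<bar>K\<bar> * c}" and na: "\<omega> \<notin> ?A \<union> ?B"
          then have 1: "norm (W n \<omega> - T n \<omega>) \<le> 1" and 2: "sqrt (real n) * \<delta> n \<omega> < c" by auto
          have "norm (T n \<omega>) \<le> \<bar>K\<bar> * (sqrt (real n) * \<delta> n \<omega>)"
            using T[of n \<omega>] \<delta>(1)[of n \<omega>] by (intro order.trans[OF T] mult_right_mono) auto
          also have "\<dots> \<le> \<bar>K\<bar> * c" using 2 by (intro mult_left_mono) auto
          finally have "norm (W n \<omega>) \<le> 1 + \<bar>K\<bar> * c"
            using 1 norm_triangle_ineq[of "W n \<omega> - T n \<omega>" "T n \<omega>"] by simp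
          then show False using a by simp
        qed
      qed simp
      also have "\<dots> \<le> prob ?A + prob ?B" by (rule measure_Un_le) auto
      also have "\<dots> \<le> e" using cheb'[OF c elim(2)] elim(1) c2 by linarith
      finally show ?case .
    qed
    then show "\<exists>R. \<forall>\<^sub>F n in sequentially. prob {\<omega>\<in>space M. norm (W n \<omega>) > R} \<le> e" by blast
  next
    fix t :: "real^'p" and a :: real
    have "(\<lambda>n. expectation (\<lambda>\<omega>. cos (t \<bullet> W n \<omega> + a)) - expectation (\<lambda>\<omega>. cos (t \<bullet> T n \<omega> + a))) \<longlonglongrightarrow> 0"
    proof (rule LIMSEQ_I)
      fix r :: real assume "r > 0"
      \<comment> \<open>The Lipschitz error is then at most \<open>r / 2\<close>; the exceptional
        event, of probability below \<open>r / 4\<close>, counts twice because cosines differ by at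
        most 2.\<close>
      define \<epsilon> where "\<epsilon> = r / (2 * (norm t + 1))"
      have n1: "norm t + 1 > 0" using norm_ge_zero[of t] by linarith
      have half: "m * (r / (2 * m)) = r / 2" if "m > 0" for m :: real using that by simp
      have \<epsilon>: "\<epsilon> > 0" "norm t * \<epsilon> \<le> r / 2"
      proof -
        show "\<epsilon> > 0" using n1 \<open>r > 0\<close> by (simp add: \<epsilon>_def)
        then have "norm t * \<epsilon> \<le> (norm t + 1) * \<epsilon>" by (intro mult_right_mono) auto
        also have "\<dots> = r / 2" by (simp only: \<epsilon>_def half[OF n1])
        finally show "norm t * \<epsilon> \<le> r / 2" .
      qed
      have "\<forall>\<^sub>F n in sequentially. prob {\<omega>\<in>space M. norm (W n \<omega> - T n \<omega>) > \<epsilon>} < r / 4"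
        using order_tendstoD(2)[OF inprob[OF \<epsilon>(1)], of "r / 4"] \<open>r > 0\<close> by simp
      then have "\<forall>\<^sub>F n in sequentially. norm (expectation (\<lambda>\<omega>. cos (t \<bullet> W n \<omega> + a)) - expectation (\<lambda>\<omega>. cos (t \<bullet> T n \<omega> + a)) - 0) < r"
      proof eventually_elim
        case (elim n)
        have "\<bar>expectation (\<lambda>\<omega>. cos (t \<bullet> W n \<omega> + a)) - expectation (\<lambda>\<omega>. cos (t \<bullet> T n \<omega> + a))\<bar>
            \<le> norm t * \<epsilon> + (1 + 1) * prob {\<omega>\<in>space M. norm (W n \<omega> - T n \<omega>) > \<epsilon>}"
        proof (rule expectation_diff_bound)
          fix \<omega> assume "\<not> norm (W n \<omega> - T n \<omega>) > \<epsilon>"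
          then have "norm t * norm (W n \<omega> - T n \<omega>) \<le> norm t * \<epsilon>" by (intro mult_left_mono) auto
          moreover have "\<bar>cos (t \<bullet> W n \<omega> + a) - cos (t \<bullet> T n \<omega> + a)\<bar> \<le> \<bar>(t \<bullet> W n \<omega> + a) - (t \<bullet> T n \<omega> + a)\<bar>"
            by (rule abs_cos_diff_le)
          moreover have "(t \<bullet> W n \<omega> + a) - (t \<bullet> T n \<omega> + a) = t \<bullet> (W n \<omega> - T n \<omega>)"
            by (simp add: inner_diff_right)
          ultimately show "\<bar>cos (t \<bullet> W n \<omega> + a) - cos (t \<bullet> T n \<omega> + a)\<bar> \<le> norm t * \<epsilon>"
            using Cauchy_Schwarz_ineq2[of t "W n \<omega> - T n \<omega>"] by linarith
        qed (use \<epsilon>(1) in auto)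
        then show ?case using elim \<epsilon>(2) by simp
      qed
      then show "\<exists>no. \<forall>n\<ge>no. norm (expectation (\<lambda>\<omega>. cos (t \<bullet> W n \<omega> + a)) - expectation (\<lambda>\<omega>. cos (t \<bullet> T n \<omega> + a)) - 0) < r"
        by (simp add: eventually_sequentially)
    qed
    from tendsto_add[OF this cos[of t a]]
    show "(\<lambda>n. expectation (\<lambda>\<omega>. cos (t \<bullet> W n \<omega> + a))) \<longlonglongrightarrow> (\<integral>x. cos (t \<bullet> x + a) \<partial>N)" by simp
  qed simp
qed

section \<open>Minimisers of linear contrasts\<close>

text \<open>The second difference of \<open>f\<close> over the parallelogram spanned by \<open>s h\<close> and \<open>s k\<close> is
  \<open>s\<^sup>2 (A k \<bullet> h) + o(s\<^sup>2)\<close> by the mean value theorem, and it is symmetric in \<open>h\<close> and \<open>k\<close>.\<close>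

lemma hessian_symmetric:
  fixes f :: "'a::euclidean_space \<Rightarrow> real" and g A :: "'a \<Rightarrow> 'a"
  assumes U: "open U" "x \<in> U"
    and f: "\<And>t. t \<in> U \<Longrightarrow> (f has_derivative (\<lambda>h. g t \<bullet> h)) (at t)"
    and g: "(g has_derivative A) (at x)"
  shows "A k \<bullet> h = A h \<bullet> k"
proof -
  have "\<bar>A k \<bullet> h - A h \<bullet> k\<bar> \<le> e" if "e > 0" for e
  proof -
    define c where "c = norm h + norm k + 1"
    have c: "c > 0" "norm h \<le> c" "norm k \<le> c"
      using norm_ge_zero[of h] norm_ge_zero[of k] unfolding c_def by linarith+
    \<comment> \<open>Two linearisation errors of size \<open>\<eta> * (s * c)\<close>, tested
      against a vector of length at most \<open>c\<close>, total \<open>s * (e / 2)\<close>.\<close>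
    define \<eta> where "\<eta> = e / (4 * c * c)"
    have \<eta>: "\<eta> > 0" using c that by (simp add: \<eta>_def)
    obtain r where r: "r > 0" "\<And>y. norm (y - x) < r \<Longrightarrow> norm (g y - g x - A (y - x)) \<le> \<eta> * norm (y - x)"
      using g \<eta> unfolding has_derivative_at_alt by blast
    obtain r' where r': "r' > 0" "ball x r' \<subseteq> U"
      using U by (meson open_contains_ball)
    \<comment> \<open>Keeps the whole parallelogram inside \<open>U\<close> and inside the ball
      where the linearisation of \<open>g\<close> is valid.\<close>
    define s where "s = min r r' / (2 * c)"
    have s: "s > 0" using r r' c by (simp add: s_def)
    have sc: "2 * s * c = min r r'" using c by (simp add: s_def)
    interpret A: bounded_linear A by (rule has_derivative_bounded_linear[OF g])
    have small: "norm (a *\<^sub>R h' + b *\<^sub>R k') < 2 * s * c \<and> norm (a *\<^sub>R h' + b *\<^sub>R k') \<le> s * c"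
      if "0 \<le> a" "a \<le> s" "0 \<le> b" "b \<le> s" "norm h' + norm k' < c" for a b h' k'
    proof -
      have "norm (a *\<^sub>R h' + b *\<^sub>R k') \<le> a * norm h' + b * norm k'"
        using that norm_triangle_ineq[of "a *\<^sub>R h'" "b *\<^sub>R k'"] by simp
      also have "\<dots> \<le> s * norm h' + s * norm k'"
        using that by (intro add_mono mult_right_mono) auto
      finally have 1: "norm (a *\<^sub>R h' + b *\<^sub>R k') \<le> s * (norm h' + norm k')" by (simp add: algebra_simps)
      have "s * (norm h' + norm k') < s * c" using that s by simp
      moreover have "s * c > 0" using s c by simp
      ultimately show ?thesis using 1 by linarith
    qed
    define \<Delta> where "\<Delta> = f (x + s *\<^sub>R h + s *\<^sub>R k) - f (x + s *\<^sub>R h) - f (x + s *\<^sub>R k) + f x"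
    \<comment> \<open>Claimed for both orders of the directions: the second difference
      \<open>\<Delta>\<close> is the same, so comparing the two estimates eliminates it.\<close>
    have key: "\<bar>\<Delta> - s * s * (A k' \<bullet> h')\<bar> \<le> s * s * (e / 2)"
      if hk: "(h' = h \<and> k' = k) \<or> (h' = k \<and> k' = h)" for h' k'
    proof -
      have n: "norm h' + norm k' < c" "norm h' \<le> c" using hk c by (auto simp: c_def)
      have D: "\<Delta> = (f (x + s *\<^sub>R h' + s *\<^sub>R k') - f (x + s *\<^sub>R h')) - (f (x + 0 *\<^sub>R h' + s *\<^sub>R k') - f (x + 0 *\<^sub>R h'))"
        using hk by (auto simp: \<Delta>_def add_ac)
      have inU: "x + a *\<^sub>R h' + b *\<^sub>R k' \<in> U" if "0 \<le> a" "a \<le> s" "0 \<le> b" "b \<le> s" for a b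
        using small[OF that n(1)] sc r' by (auto simp: subset_iff dist_norm add.assoc norm_minus_commute)
      have der: "((\<lambda>a. f (x + a *\<^sub>R h' + b *\<^sub>R k')) has_derivative (\<lambda>d. g (x + a *\<^sub>R h' + b *\<^sub>R k') \<bullet> (d *\<^sub>R h'))) (at a)"
        if "0 \<le> a" "a \<le> s" "0 \<le> b" "b \<le> s" for a b
      proof (rule has_derivative_compose[where f="\<lambda>a. x + a *\<^sub>R h' + b *\<^sub>R k'" and f'="\<lambda>d. d *\<^sub>R h'" and g'="\<lambda>d. g (x + a *\<^sub>R h' + b *\<^sub>R k') \<bullet> d"])
        show "((\<lambda>a. x + a *\<^sub>R h' + b *\<^sub>R k') has_derivative (\<lambda>d. d *\<^sub>R h')) (at a)"
          by (auto intro!: derivative_eq_intros)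
      qed (rule f[OF inU[OF that]])
      \<comment> \<open>The mean value theorem is applied along \<open>h'\<close> to the increment
        in direction \<open>k'\<close>, which leaves gradients at two points near
        \<open>x\<close>.\<close>
      have "\<exists>a. 0 < a \<and> a < s \<and>
          (f (x + s *\<^sub>R h' + s *\<^sub>R k') - f (x + s *\<^sub>R h')) - (f (x + 0 *\<^sub>R h' + s *\<^sub>R k') - f (x + 0 *\<^sub>R h'))
          = (s - 0) * ((g (x + a *\<^sub>R h' + s *\<^sub>R k') - g (x + a *\<^sub>R h')) \<bullet> h')"
      proof (rule MVT2[OF s, where f="\<lambda>a. f (x + a *\<^sub>R h' + s *\<^sub>R k') - f (x + a *\<^sub>R h')"])
        fix a assume a: "0 \<le> a" "a \<le> s"
        show "((\<lambda>a. f (x + a *\<^sub>R h' + s *\<^sub>R k') - f (x + a *\<^sub>R h')) has_real_derivative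
            (g (x + a *\<^sub>R h' + s *\<^sub>R k') - g (x + a *\<^sub>R h')) \<bullet> h') (at a)"
          unfolding has_field_derivative_def
          by (rule has_derivative_eq_rhs[OF has_derivative_diff[OF der[OF a, of s] der[OF a, of 0, simplified]]])
             (use s in \<open>auto simp: inner_diff_left left_diff_distrib\<close>)
      qed
      then obtain a where a: "0 < a" "a < s"
          "\<Delta> = s * ((g (x + a *\<^sub>R h' + s *\<^sub>R k') - g (x + a *\<^sub>R h')) \<bullet> h')"
        unfolding D by auto
      define y z where "y = x + a *\<^sub>R h' + s *\<^sub>R k'" and "z = x + a *\<^sub>R h'"
      have "norm (g y - g x - A (y - x)) \<le> \<eta> * (s * c)"
      proof -
        have "norm (y - x) < r" "norm (y - x) \<le> s * c"
          using small[of a s h' k'] a s n sc by (auto simp: y_def add.assoc)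
        then show ?thesis
          using order.trans[OF r(2)[of y] mult_left_mono[of "norm (y - x)" "s * c" \<eta>]] \<eta> by simp
      qed
      moreover have "norm (g z - g x - A (z - x)) \<le> \<eta> * (s * c)"
      proof -
        have "norm (z - x) < r" "norm (z - x) \<le> s * c"
          using small[of a 0 h' k'] a s n sc by (auto simp: z_def add.assoc)
        then show ?thesis
          using order.trans[OF r(2)[of z] mult_left_mono[of "norm (z - x)" "s * c" \<eta>]] \<eta> by simp
      qed
      \<comment> \<open>As \<open>y - z = s *\<^sub>R k'\<close>, linearising both gradients at
        \<open>x\<close> leaves exactly \<open>s *\<^sub>R A k'\<close>.\<close>
      moreover have gyz: "g y - g z - s *\<^sub>R A k' = (g y - g x - A (y - x)) - (g z - g x - A (z - x))"
        by (simp add: y_def z_def A.add A.scaleR)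
      ultimately have "norm (g y - g z - s *\<^sub>R A k') \<le> 2 * (\<eta> * (s * c))"
        unfolding gyz using norm_triangle_ineq4[of "g y - g x - A (y - x)" "g z - g x - A (z - x)"] by linarith
      then have "\<bar>(g y - g z - s *\<^sub>R A k') \<bullet> h'\<bar> \<le> 2 * (\<eta> * (s * c)) * c"
        using n(2) \<eta> s c by (intro order.trans[OF Cauchy_Schwarz_ineq2] mult_mono) auto
      also have "\<dots> = s * (e / 2)" using c by (simp add: \<eta>_def)
      finally have "s * \<bar>(g y - g z - s *\<^sub>R A k') \<bullet> h'\<bar> \<le> s * (s * (e / 2))"
        using s by (intro mult_left_mono) auto
      moreover have "\<Delta> - s * s * (A k' \<bullet> h') = s * ((g y - g z - s *\<^sub>R A k') \<bullet> h')"
        by (simp add: a(3) y_def z_def inner_diff_left right_diff_distrib)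
      ultimately show ?thesis using s by (simp add: abs_mult)
    qed
    have "\<bar>s * s * (A k \<bullet> h) - s * s * (A h \<bullet> k)\<bar> \<le> s * s * (e / 2) + s * s * (e / 2)"
    proof -
      have "\<bar>\<Delta> - s * s * (A k \<bullet> h)\<bar> \<le> s * s * (e / 2)" "\<bar>\<Delta> - s * s * (A h \<bullet> k)\<bar> \<le> s * s * (e / 2)"
        by (intro key; simp)+
      then show ?thesis unfolding abs_le_iff by linarith
    qed
    moreover have "s * s * \<bar>A k \<bullet> h - A h \<bullet> k\<bar> = \<bar>s * s * (A k \<bullet> h) - s * s * (A h \<bullet> k)\<bar>"
      using abs_mult[of "s * s" "A k \<bullet> h - A h \<bullet> k"] by (simp add: right_diff_distrib)
    ultimately have "s * s * \<bar>A k \<bullet> h - A h \<bullet> k\<bar> \<le> s * s * e"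
      by (simp add: algebra_simps)
    then show ?thesis using s by simp
  qed
  then have "\<bar>A k \<bullet> h - A h \<bullet> k\<bar> \<le> 0"
    by (rule field_le_epsilon[where y=0, simplified]) 
  then show ?thesis by simp
qed

text \<open>A minimiser \<open>t\<close> for the weight \<open>w\<close> near \<open>v\<close> is
  interior, hence \<open>0 = G w t = G v t + G (w - v) t\<close>. The first term is linearised by
  \<open>H\<close>; the second is frozen at \<open>\<theta>0\<close>, with an error bounded by a
  multiple of the product of \<open>norm (t - \<theta>0)\<close> and \<open>norm (w - v)\<close>.
  Inverting \<open>H\<close> and absorbing the errors gives the expansion.\<close>

lemma linear_contrast_argmin_expansion:
  fixes \<Psi> :: "real^'p::finite \<Rightarrow> 'e::real_inner"
    and D1 :: "real^'p \<Rightarrow> real^'p \<Rightarrow> 'e"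
    and H :: "real^'p^'p"
  defines "G \<equiv> \<lambda>w t. \<chi> j. D1 t (axis j 1) \<bullet> w"
  assumes comp: "compact \<Theta>" and cont: "continuous_on \<Theta> \<Psi>"
    and uniq: "\<And>t. t \<in> \<Theta> \<Longrightarrow> t \<noteq> \<theta>0 \<Longrightarrow> \<Psi> \<theta>0 \<bullet> v < \<Psi> t \<bullet> v"
    and U: "open U" "U \<subseteq> \<Theta>" "\<theta>0 \<in> U"
    and D1: "\<And>t. t \<in> U \<Longrightarrow> (\<Psi> has_derivative D1 t) (at t)"
    and D2: "((\<lambda>t. \<chi> j. D1 t (axis j 1)) has_derivative D2) (at \<theta>0)"
    and H: "(G v has_derivative (\<lambda>h. H *v h)) (at \<theta>0)" "invertible H"
  shows "G v \<theta>0 = 0"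
    and "\<forall>\<eta>>0. \<exists>d>0. \<forall>w t. norm (w - v) < d \<longrightarrow> t \<in> \<Theta> \<longrightarrow> (\<forall>s\<in>\<Theta>. \<Psi> t \<bullet> w \<le> \<Psi> s \<bullet> w) \<longrightarrow>
           norm (t - \<theta>0 + matrix_inv H *v G (w - v) \<theta>0) \<le> \<eta> * norm (w - v)"
proof -
  define F where "F t = (\<chi> j. D1 t (axis j 1))" for t
  have D2: "(F has_derivative D2) (at \<theta>0)" using D2 by (simp add: F_def[abs_def])
  have Gdiff: "G (w - w') t = G w t - G w' t" for w w' t
    by (simp add: G_def vec_eq_iff inner_diff_right)
  \<comment> \<open>Fermat's condition, available because \<open>U\<close> is open and contained in
    \<open>\<Theta>\<close>.\<close>
  have G0: "G w t = 0" if "t \<in> U" and "\<forall>s\<in>\<Theta>. \<Psi> t \<bullet> w \<le> \<Psi> s \<bullet> w" for w t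
  proof -
    have "((\<lambda>s. \<Psi> s \<bullet> w) has_derivative (\<lambda>h. D1 t h \<bullet> w)) (at t)"
      by (intro has_derivative_inner_left D1 that)
    then have "(\<lambda>h. D1 t h \<bullet> w) = (\<lambda>v. 0)"
      by (rule differential_zero_maxmin[OF \<open>t \<in> U\<close> \<open>open U\<close>]) (use that U in blast)
    then show ?thesis
      by (simp add: G_def vec_eq_iff fun_eq_iff)
  qed
  have th0: "\<theta>0 \<in> \<Theta>" using U by auto
  show Gv0: "G v \<theta>0 = 0"
    by (rule G0[OF \<open>\<theta>0 \<in> U\<close>]) (metis uniq less_eq_real_def)
  \<comment> \<open>The factor \<open>CARD('p)\<close> comes from bounding the Euclidean norm by the
    sum of the coordinates.\<close>
  have bD1: "norm (G w t - G w \<theta>0) \<le> real CARD('p) * norm (F t - F \<theta>0) * norm w" for w t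
  proof -
    have "norm (G w t - G w \<theta>0) \<le> (\<Sum>j\<in>UNIV. \<bar>(G w t - G w \<theta>0) $ j\<bar>)"
      by (rule norm_le_l1_cart)
    also have "\<dots> \<le> (\<Sum>j\<in>(UNIV::'p set). norm (F t - F \<theta>0) * norm w)"
    proof (rule sum_mono)
      fix j :: 'p
      have "(G w t - G w \<theta>0) $ j = (F t - F \<theta>0) $ j \<bullet> w"
        by (simp add: G_def F_def inner_diff_left)
      also have "\<bar>\<dots>\<bar> \<le> norm ((F t - F \<theta>0) $ j) * norm w"
        by (rule Cauchy_Schwarz_ineq2)
      also have "norm ((F t - F \<theta>0) $ j) \<le> norm (F t - F \<theta>0)"
        by (rule Finite_Cartesian_Product.norm_nth_le)
      finally show "\<bar>(G w t - G w \<theta>0) $ j\<bar> \<le> norm (F t - F \<theta>0) * norm w"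
        by (simp add: mult_right_mono)
    qed
    finally show ?thesis by simp
  qed
  have bG0: "norm (G w \<theta>0) \<le> real CARD('p) * norm (F \<theta>0) * norm w" for w
  proof -
    have "norm (G w \<theta>0) \<le> (\<Sum>j\<in>UNIV. \<bar>G w \<theta>0 $ j\<bar>)"
      by (rule norm_le_l1_cart)
    also have "\<dots> \<le> (\<Sum>j\<in>(UNIV::'p set). norm (F \<theta>0) * norm w)"
    proof (rule sum_mono)
      fix j :: 'p
      have "\<bar>G w \<theta>0 $ j\<bar> \<le> norm (D1 \<theta>0 (axis j 1)) * norm w"
        by (simp add: G_def Cauchy_Schwarz_ineq2)
      also have "norm (D1 \<theta>0 (axis j 1)) \<le> norm (F \<theta>0)"
        using Finite_Cartesian_Product.norm_nth_le[of "F \<theta>0" j] by (simp add: F_def)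
      finally show "\<bar>G w \<theta>0 $ j\<bar> \<le> norm (F \<theta>0) * norm w"
        by (simp add: mult_right_mono)
    qed
    finally show ?thesis by simp
  qed
  define c where "c = real CARD('p)"
  have "c > 0" by (simp add: c_def)
  obtain L where L: "L > 0" "\<And>h. norm (D2 h) \<le> L * norm h"
    using bounded_linear.pos_bounded[OF has_derivative_bounded_linear[OF D2]] by (auto simp: mult.commute)
  obtain r1 where r1: "r1 > 0" "\<And>t. norm (t - \<theta>0) < r1 \<Longrightarrow> norm (F t - F \<theta>0 - D2 (t - \<theta>0)) \<le> 1 * norm (t - \<theta>0)"
    using D2 unfolding has_derivative_at_alt by (meson zero_less_one)
  \<comment> \<open>Differentiability at the single point \<open>\<theta>0\<close> suffices for a
    Lipschitz bound from that point; the extra 1 is the tolerance in \<open>r1\<close>.\<close>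
  have lip: "norm (F t - F \<theta>0) \<le> (L + 1) * norm (t - \<theta>0)" if "norm (t - \<theta>0) < r1" for t
  proof -
    have "norm (F t - F \<theta>0) \<le> norm (F t - F \<theta>0 - D2 (t - \<theta>0)) + norm (D2 (t - \<theta>0))"
      by (metis diff_add_cancel norm_triangle_ineq)
    then show ?thesis using r1(2)[OF that] L(2)[of "t - \<theta>0"] by (simp add: algebra_simps)
  qed
  define B where "B = matrix_inv H"
  have BH: "B *v (H *v x) = x" for x
    using someI_ex[OF H(2)[unfolded invertible_def]] by (simp add: B_def matrix_inv_def matrix_vector_mul_assoc)
  obtain \<kappa> where \<kappa>: "\<kappa> > 0" "\<And>x. norm (B *v x) \<le> \<kappa> * norm x"
    using bounded_linear.pos_bounded[OF matrix_vector_mul_bounded_linear[of B]] by (auto simp: mult.commute)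
  define C where "C = c * (L + 1) + c * norm (F \<theta>0)"
  have C: "C > 0" "c * (L + 1) \<le> C" "c * norm (F \<theta>0) \<le> C"
    using \<open>c > 0\<close> L(1) by (auto simp: C_def add_pos_nonneg)
  \<comment> \<open>Consistency. By compactness the contrast for \<open>v\<close> exceeds its
    minimum by a gap \<open>g\<close> away from \<open>\<theta>0\<close>. Changing the weight by
    less than \<open>g / (4 * b)\<close> moves each value by at most \<open>g / 4\<close>, too
    little to close the gap.\<close>
  have consist: "\<exists>d>0. \<forall>w t. norm (w - v) < d \<longrightarrow> t \<in> \<Theta> \<longrightarrow> (\<forall>s\<in>\<Theta>. \<Psi> t \<bullet> w \<le> \<Psi> s \<bullet> w) \<longrightarrow> norm (t - \<theta>0) < r"
    if "r > 0" for r
  proof -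
    obtain b where b: "b > 0" "\<And>t. t \<in> \<Theta> \<Longrightarrow> norm (\<Psi> t) \<le> b"
      using compact_imp_bounded[OF compact_continuous_image[OF cont comp]] unfolding bounded_pos by auto
    define K where "K = \<Theta> - ball \<theta>0 r"
    have "compact K" unfolding K_def using comp by (simp add: compact_diff)
    have contK: "continuous_on K (\<lambda>t. \<Psi> t \<bullet> v)"
      by (intro continuous_intros continuous_on_subset[OF cont]) (auto simp: K_def)
    obtain g where g: "g > 0" "\<And>t. t \<in> K \<Longrightarrow> \<Psi> \<theta>0 \<bullet> v + g \<le> \<Psi> t \<bullet> v"
    proof (cases "K = {}")
      case True then show ?thesis using that[of 1] by auto
    next
      case False
      obtain t0 where t0: "t0 \<in> K" "\<forall>t\<in>K. \<Psi> t0 \<bullet> v \<le> \<Psi> t \<bullet> v"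
        using continuous_attains_inf[OF \<open>compact K\<close> False contK] by auto
      have "\<Psi> \<theta>0 \<bullet> v < \<Psi> t0 \<bullet> v" using t0(1) \<open>r > 0\<close> by (intro uniq) (auto simp: K_def)
      then show ?thesis using that[of "\<Psi> t0 \<bullet> v - \<Psi> \<theta>0 \<bullet> v"] t0(2) by auto
    qed
    have "norm (t - \<theta>0) < r" if w: "norm (w - v) < g / (4 * b)" and t: "t \<in> \<Theta>" "\<forall>s\<in>\<Theta>. \<Psi> t \<bullet> w \<le> \<Psi> s \<bullet> w" for w t
    proof (rule ccontr)
      assume "\<not> norm (t - \<theta>0) < r"
      then have "t \<in> K" using t by (simp add: K_def dist_norm norm_minus_commute)
      then have 1: "\<Psi> \<theta>0 \<bullet> v + g \<le> \<Psi> t \<bullet> v" by (rule g)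
      have 2: "\<Psi> t \<bullet> w \<le> \<Psi> \<theta>0 \<bullet> w" using t(2) th0 by auto
      have 3: "\<bar>\<Psi> s \<bullet> (w - v)\<bar> \<le> g / 4" if "s \<in> \<Theta>" for s
      proof -
        have "\<bar>\<Psi> s \<bullet> (w - v)\<bar> \<le> norm (\<Psi> s) * norm (w - v)" by (rule Cauchy_Schwarz_ineq2)
        also have "\<dots> \<le> b * (g / (4 * b))"
          using b(2)[OF that] w b(1) by (intro mult_mono) auto
        finally show ?thesis using b(1) by simp
      qed
      show False using 1 2 3[OF t(1)] 3[OF th0] g(1) unfolding inner_diff_right abs_le_iff by linarith
    qed
    moreover have "g / (4 * b) > 0" using g(1) b(1) by simp
    ultimately show ?thesis by blast
  qed
  show "\<forall>\<eta>>0. \<exists>d>0. \<forall>w t. norm (w - v) < d \<longrightarrow> t \<in> \<Theta> \<longrightarrow> (\<forall>s\<in>\<Theta>. \<Psi> t \<bullet> w \<le> \<Psi> s \<bullet> w) \<longrightarrow>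
           norm (t - \<theta>0 + matrix_inv H *v G (w - v) \<theta>0) \<le> \<eta> * norm (w - v)"
  proof (intro allI impI)
    fix \<eta> :: real assume "\<eta> > 0"
    \<comment> \<open>The bound \<open>1 / 2\<close> lets \<open>\<epsilon> * norm h\<close> be
      absorbed on the left; the other bound turns the a priori estimate of \<open>h\<close> into the
      factor \<open>\<eta>\<close>.\<close>
    define \<epsilon> where "\<epsilon> = min (1 / 2) (\<eta> / (2 * \<kappa> * C))"
    have \<epsilon>: "\<epsilon> > 0" "\<epsilon> \<le> 1 / 2" "\<epsilon> * (2 * \<kappa> * C) \<le> \<eta>"
    proof -
      show "\<epsilon> > 0" "\<epsilon> \<le> 1 / 2" using \<open>\<eta> > 0\<close> \<kappa> C by (auto simp: \<epsilon>_def)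
      have "\<epsilon> \<le> \<eta> / (2 * \<kappa> * C)" by (simp add: \<epsilon>_def)
      then show "\<epsilon> * (2 * \<kappa> * C) \<le> \<eta>" using \<kappa> C by (simp add: field_simps)
    qed
    obtain r2 where r2: "r2 > 0" "\<And>t. norm (t - \<theta>0) < r2 \<Longrightarrow>
        norm (G v t - G v \<theta>0 - H *v (t - \<theta>0)) \<le> \<epsilon> / (2 * \<kappa>) * norm (t - \<theta>0)"
    proof -
      have "\<epsilon> / (2 * \<kappa>) > 0" using \<epsilon>(1) \<kappa>(1) by simp
      with H(1) show ?thesis unfolding has_derivative_at_alt using that by blast
    qed
    obtain r3 where r3: "r3 > 0" "ball \<theta>0 r3 \<subseteq> U"
      using U(1,3) by (meson open_contains_ball)
    obtain d where d: "d > 0" "\<And>w t. norm (w - v) < d \<Longrightarrow> t \<in> \<Theta> \<Longrightarrow> (\<forall>s\<in>\<Theta>. \<Psi> t \<bullet> w \<le> \<Psi> s \<bullet> w) \<Longrightarrow>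
        norm (t - \<theta>0) < min r1 (min r2 r3)"
    proof -
      have "min r1 (min r2 r3) > 0" using r1(1) r2(1) r3(1) by simp
      from consist[OF this] show ?thesis using that by blast
    qed
    have "norm (t - \<theta>0 + B *v G (w - v) \<theta>0) \<le> \<eta> * norm (w - v)"
      if w: "norm (w - v) < min d (\<epsilon> / (2 * \<kappa> * C))" and t: "t \<in> \<Theta>" "\<forall>s\<in>\<Theta>. \<Psi> t \<bullet> w \<le> \<Psi> s \<bullet> w" for w t
    proof -
      define h where "h = t - \<theta>0"
      define \<delta> where "\<delta> = norm (w - v)"
      have \<delta>: "0 \<le> \<delta>" "\<kappa> * C * \<delta> \<le> \<epsilon> / 2"
        using w \<kappa> C by (auto simp: \<delta>_def field_simps)
      have h: "norm h < r1" "norm h < r2" "norm h < r3"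
        using d(2)[of w t] w t by (auto simp: h_def)
      have "t \<in> U" using h r3 by (auto simp: h_def dist_norm norm_minus_commute subset_iff)
      then have Gw: "G w t = 0" by (rule G0[OF _ t(2)])
      \<comment> \<open>The residual of the linearised equation; applying \<open>B\<close> to it
        yields the very quantity to be estimated.\<close>
      define e where "e = H *v h + G (w - v) \<theta>0"
      have "e = - ((G v t - G v \<theta>0 - H *v h) + (G (w - v) t - G (w - v) \<theta>0))"
        using Gw Gv0 by (simp add: e_def Gdiff algebra_simps)
      then have "norm e \<le> norm (G v t - G v \<theta>0 - H *v h) + norm (G (w - v) t - G (w - v) \<theta>0)"
        using norm_triangle_ineq by (simp only: norm_minus_cancel)
      also have "\<dots> \<le> \<epsilon> / (2 * \<kappa>) * norm h + C * norm h * \<delta>"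
      proof (rule add_mono)
        show "norm (G v t - G v \<theta>0 - H *v h) \<le> \<epsilon> / (2 * \<kappa>) * norm h"
          using r2(2)[of t] h by (simp add: h_def)
        have "norm (G (w - v) t - G (w - v) \<theta>0) \<le> c * norm (F t - F \<theta>0) * \<delta>"
          using bD1 by (simp add: c_def \<delta>_def)
        also have "\<dots> \<le> c * ((L + 1) * norm h) * \<delta>"
          using lip[of t] h(1) \<delta>(1) \<open>c > 0\<close> unfolding h_def[symmetric]
          by (intro mult_right_mono mult_left_mono) auto
        also have "\<dots> = (c * (L + 1)) * norm h * \<delta>" by simp
        also have "\<dots> \<le> C * norm h * \<delta>"
          using C \<delta>(1) by (intro mult_right_mono) auto
        finally show "norm (G (w - v) t - G (w - v) \<theta>0) \<le> C * norm h * \<delta>" .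
      qed
      finally have e: "norm e \<le> \<epsilon> / (2 * \<kappa>) * norm h + C * norm h * \<delta>" .
      have Be: "norm (B *v e) \<le> \<epsilon> * norm h"
      proof -
        have "norm (B *v e) \<le> \<kappa> * norm e" by (rule \<kappa>)
        also have "\<dots> \<le> \<kappa> * (\<epsilon> / (2 * \<kappa>) * norm h + C * norm h * \<delta>)"
          using e \<kappa>(1) by (intro mult_left_mono) auto
        also have "\<dots> = (\<epsilon> / 2 + \<kappa> * C * \<delta>) * norm h" using \<kappa>(1) by (simp add: field_simps)
        also have "\<dots> \<le> (\<epsilon> / 2 + \<epsilon> / 2) * norm h" using \<delta>(2) by (intro mult_right_mono) auto
        finally show ?thesis by simp
      qed
      have Beq: "B *v e = h + B *v G (w - v) \<theta>0"
        by (simp add: e_def matrix_vector_right_distrib BH)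
      have "norm (B *v G (w - v) \<theta>0) \<le> \<kappa> * C * \<delta>"
      proof -
        have "norm (B *v G (w - v) \<theta>0) \<le> \<kappa> * norm (G (w - v) \<theta>0)" by (rule \<kappa>)
        also have "\<dots> \<le> \<kappa> * (C * \<delta>)"
          using bG0[of "w - v"] C(3) \<kappa>(1) mult_right_mono[OF C(3) \<delta>(1)]
          by (intro mult_left_mono) (auto simp: c_def \<delta>_def)
        finally show ?thesis by simp
      qed
      moreover have "norm h \<le> norm (B *v e) + norm (B *v G (w - v) \<theta>0)"
        using norm_triangle_ineq4[of "B *v e" "B *v G (w - v) \<theta>0"] by (simp add: Beq)
      moreover have "\<epsilon> * norm h \<le> 1 / 2 * norm h" using \<epsilon> by (intro mult_right_mono) auto
      \<comment> \<open>A crude linear bound on \<open>h\<close> by absorption. Reinserted in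
        \<open>Be\<close>, it improves the error from relative to \<open>h\<close> to relative to
        \<open>\<delta>\<close>.\<close>
      ultimately have hb: "norm h \<le> 2 * \<kappa> * C * \<delta>" using Be by simp
      have "norm (B *v e) \<le> \<epsilon> * (2 * \<kappa> * C * \<delta>)"
        using order_trans[OF Be mult_left_mono[OF hb]] \<epsilon>(1) by simp
      also have "\<dots> = (\<epsilon> * (2 * \<kappa> * C)) * \<delta>" by simp
      also have "\<dots> \<le> \<eta> * \<delta>" using \<epsilon>(3) \<delta>(1) by (intro mult_right_mono) auto
      finally show ?thesis by (simp add: Beq h_def \<delta>_def)
    qed
    moreover have "min d (\<epsilon> / (2 * \<kappa> * C)) > 0" using d(1) \<epsilon>(1) \<kappa> C by simp
    ultimately show "\<exists>d>0. \<forall>w t. norm (w - v) < d \<longrightarrow> t \<in> \<Theta> \<longrightarrow> (\<forall>s\<in>\<Theta>. \<Psi> t \<bullet> w \<le> \<Psi> s \<bullet> w) \<longrightarrow>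
           norm (t - \<theta>0 + matrix_inv H *v G (w - v) \<theta>0) \<le> \<eta> * norm (w - v)"
      unfolding B_def by blast
  qed
qed

text \<open>The observations enter through finitely many bounded features \<open>g m\<close>, whose
  averages form the random weight of the contrast. Minimality is required only almost surely, which
  leaves room for exceptional samples containing masks of probability zero. \<open>A\<close> is
  prescribed by its quadratic form, the variance of the linearised estimator.\<close>

lemma (in prob_space) linear_contrast_argmin_clt:
  fixes \<xi> :: "nat \<Rightarrow> 'a \<Rightarrow> 'b"
    and g :: "'m::finite \<Rightarrow> 'b \<Rightarrow> 'e::{real_inner,banach,second_countable_topology}"
    and \<Psi> :: "real^'p::finite \<Rightarrow> 'e^'m"
    and D1 :: "real^'p \<Rightarrow> real^'p \<Rightarrow> 'e^'m"
    and H A :: "real^'p^'p" and \<mu> :: "'b measure"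
  defines "v \<equiv> \<chi> m. \<integral>x. g m x \<partial>\<mu>"
    and "Vbar \<equiv> \<lambda>n \<omega>. \<chi> m. (1 / real n) *\<^sub>R (\<Sum>i<n. g m (\<xi> i \<omega>))"
    and "G \<equiv> \<lambda>w t. \<chi> j. D1 t (axis j 1) \<bullet> w"
  assumes ind: "indep_vars (\<lambda>_. S) \<xi> UNIV" and law: "\<And>i. distr M S (\<xi> i) = \<mu>"
    and gm[measurable]: "\<And>m. g m \<in> borel_measurable S" and gb: "\<And>m x. norm (g m x) \<le> b"
    and comp: "compact \<Theta>" and cont: "continuous_on \<Theta> \<Psi>"
    and uniq: "\<And>t. t \<in> \<Theta> \<Longrightarrow> t \<noteq> \<theta>0 \<Longrightarrow> \<Psi> \<theta>0 \<bullet> v < \<Psi> t \<bullet> v"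
    and U: "open U" "U \<subseteq> \<Theta>" "\<theta>0 \<in> U"
    and D1: "\<And>t. t \<in> U \<Longrightarrow> (\<Psi> has_derivative D1 t) (at t)"
    and D2: "((\<lambda>t. \<chi> j. D1 t (axis j 1)) has_derivative D2) (at \<theta>0)"
    and H: "(G v has_derivative (\<lambda>h. H *v h)) (at \<theta>0)" "invertible H"
    and est[measurable]: "\<And>n. \<theta>n n \<in> borel_measurable M"
    and est_min: "\<And>n. n \<ge> 1 \<Longrightarrow> AE \<omega> in M. \<theta>n n \<omega> \<in> \<Theta> \<and> (\<forall>s\<in>\<Theta>. \<Psi> (\<theta>n n \<omega>) \<bullet> Vbar n \<omega> \<le> \<Psi> s \<bullet> Vbar n \<omega>)"
    and A: "\<And>t. t \<bullet> (A *v t) = (\<integral>x. (t \<bullet> (matrix_inv H *v G (\<chi> m. g m x) \<theta>0))\<^sup>2 \<partial>\<mu>)"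
  shows "\<exists>N. is_mvnormal N A \<and> conv_in_law M (\<lambda>n \<omega>. sqrt (real n) *\<^sub>R (\<theta>n n \<omega> - \<theta>0)) N"
proof -
  define B where "B = matrix_inv H"
  have det: "G v \<theta>0 = 0"
    "\<forall>\<eta>>0. \<exists>d>0. \<forall>w t. norm (w - v) < d \<longrightarrow> t \<in> \<Theta> \<longrightarrow> (\<forall>s\<in>\<Theta>. \<Psi> t \<bullet> w \<le> \<Psi> s \<bullet> w) \<longrightarrow>
       norm (t - \<theta>0 + B *v G (w - v) \<theta>0) \<le> \<eta> * norm (w - v)"
    using linear_contrast_argmin_expansion[OF comp cont uniq U D1 D2 H[unfolded G_def]]
    unfolding G_def B_def by blast+
  have \<xi>m[measurable]: "\<xi> i \<in> measurable M S" for i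
    using ind by (simp add: indep_vars_def)
  have b0: "b \<ge> 0" using order.trans[OF norm_ge_zero gb] .
  have sets_\<mu>[measurable_cong]: "sets \<mu> = sets S" using law[of 0] by auto
  interpret \<mu>: prob_space \<mu> using prob_space_distr[OF \<xi>m[of 0]] by (simp add: law)
  have gint: "integrable \<mu> (g m)" for m
    by (rule \<mu>.integrable_const_bound[of _ b]) (use gb in auto)
  define \<Lambda> where "\<Lambda> w = B *v G w \<theta>0" for w
  \<comment> \<open>Written as an inner product with a fixed vector, the functional inherits
    measurability and its integral from the coordinates \<open>g m\<close>.\<close>
  have \<Lambda>_adj: "t \<bullet> \<Lambda> w = (\<Sum>j\<in>UNIV. (t v* B) $ j *\<^sub>R D1 \<theta>0 (axis j 1)) \<bullet> w" for t w
    by (simp add: \<Lambda>_def dot_lmul_matrix[symmetric] G_def inner_sum_left) (simp add: inner_vec_def)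
  have Gl: "bounded_linear (\<lambda>w. G w \<theta>0)"
    unfolding G_def
  proof (rule bounded_linear_intro[where K="\<Sum>j\<in>UNIV. norm (D1 \<theta>0 (axis j 1))"])
    fix w :: "'e^'m"
    show "norm (\<chi> j. D1 \<theta>0 (axis j 1) \<bullet> w) \<le> norm w * (\<Sum>j\<in>UNIV. norm (D1 \<theta>0 (axis j 1)))"
      by (rule order.trans[OF norm_le_l1_cart])
         (use Cauchy_Schwarz_ineq2[of _ w] in \<open>auto simp: sum_distrib_left mult.commute[of "norm w"] intro!: sum_mono\<close>)
  qed (simp_all add: vec_eq_iff inner_add_right)
  have \<Lambda>l: "bounded_linear \<Lambda>"
    unfolding \<Lambda>_def by (rule bounded_linear_compose[OF matrix_vector_mul_bounded_linear Gl])
  then interpret \<Lambda>: bounded_linear \<Lambda> .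
  obtain K where K: "K > 0" "\<And>w. norm (\<Lambda> w) \<le> norm w * K"
    using \<Lambda>.pos_bounded by blast
  have vec_b: "norm (\<chi> m. g m x) \<le> real CARD('m) * b" for x
    using sum_mono[of UNIV "\<lambda>m. norm (g m x)" "\<lambda>_. b"] gb
    by (auto simp: norm_vec_def intro!: order.trans[OF L2_set_le_sum])
  define \<delta> where "\<delta> n \<omega> = norm (Vbar n \<omega> - v)" for n \<omega>
  define T where "T n \<omega> = - sqrt (real n) *\<^sub>R \<Lambda> (Vbar n \<omega> - v)" for n \<omega>
  \<comment> \<open>The gradient vanishes at the minimiser, so the summands of \<open>T\<close> are
    centred without subtracting the mean.\<close>
  have \<Lambda>v: "\<Lambda> v = 0"
    using det(1) by (simp add: \<Lambda>_def)
  have adj_meas: "(\<lambda>x. u \<bullet> (\<chi> m. g m x)) \<in> borel_measurable S" for u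
    by (simp add: inner_vec_def)
  have Vm: "Vbar n \<omega> = (1 / real n) *\<^sub>R (\<Sum>i<n. \<chi> m. g m (\<xi> i \<omega>))" for n \<omega>
    by (simp add: Vbar_def vec_eq_iff)
  have T_sum: "t \<bullet> T n \<omega> = (\<Sum>i<n. - (t \<bullet> \<Lambda> (\<chi> m. g m (\<xi> i \<omega>)))) / sqrt (real n)" for t n \<omega>
  proof -
    have "t \<bullet> T n \<omega> = - (sqrt (real n) / real n) * (\<Sum>i<n. t \<bullet> \<Lambda> (\<chi> m. g m (\<xi> i \<omega>)))"
      by (simp add: T_def \<Lambda>.diff \<Lambda>v Vm \<Lambda>.scaleR \<Lambda>.sum inner_sum_right)
    \<comment> \<open>For \<open>n = 0\<close> both sides are 0, as division by zero gives
      0.\<close>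
    also have "sqrt (real n) / real n = 1 / sqrt (real n)"
      by (cases "n = 0") (auto simp: field_simps)
    finally show ?thesis by (simp add: sum_negf)
  qed
  have tZm[measurable]: "(\<lambda>x. t \<bullet> \<Lambda> (\<chi> m. g m x)) \<in> borel_measurable S" for t
    unfolding \<Lambda>_adj by (rule adj_meas)
  have tZb: "\<bar>t \<bullet> \<Lambda> (\<chi> m. g m x)\<bar> \<le> norm t * (real CARD('m) * b * K)" for t x
  proof -
    have "norm (\<Lambda> (\<chi> m. g m x)) \<le> real CARD('m) * b * K"
      using K mult_right_mono[OF vec_b, of K] by (meson less_imp_le order.trans)
    then show ?thesis
      by (intro order.trans[OF Cauchy_Schwarz_ineq2] mult_left_mono) auto
  qed
  have A': "t \<bullet> (A *v t) = (\<integral>x. (t \<bullet> \<Lambda> (\<chi> m. g m x))\<^sup>2 \<partial>\<mu>)" for t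
    using A by (simp add: \<Lambda>_def B_def)
  have tZint: "integrable \<mu> (\<lambda>x. (t \<bullet> \<Lambda> (\<chi> m. g m x)) * (s \<bullet> \<Lambda> (\<chi> m. g m x)))" for s t
    by (rule \<mu>.integrable_const_bound[of _ "(norm t * (real CARD('m) * b * K)) * (norm s * (real CARD('m) * b * K))"])
       (use tZb b0 K in \<open>auto simp: abs_mult intro!: mult_mono\<close>)
  have "\<exists>N. is_mvnormal N A"
  proof -
    \<comment> \<open>This second-moment matrix is symmetric by construction, while \<open>A\<close>
      is known through its quadratic form. The predicate \<open>is_mvnormal\<close> reads off only
      that form, so a normal law for \<open>A0\<close> is one for \<open>A\<close>.\<close>
    define A0 :: "real^'p^'p" where "A0 = (\<chi> i j. \<integral>x. (axis i 1 \<bullet> \<Lambda> (\<chi> m. g m x)) * (axis j 1 \<bullet> \<Lambda> (\<chi> m. g m x)) \<partial>\<mu>)"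
    have quad: "t \<bullet> (A0 *v t) = t \<bullet> (A *v t)" for t
    proof -
      have t: "t = (\<Sum>i\<in>UNIV. t $ i *\<^sub>R axis i 1)"
        by (simp add: vec_eq_iff axis_def if_distrib cong: if_cong)
      have "t \<bullet> y = (\<Sum>i\<in>UNIV. t $ i * (axis i 1 \<bullet> y))" for y
        by (subst t) (simp add: inner_sum_left)
      then have "(t \<bullet> \<Lambda> (\<chi> m. g m x))\<^sup>2 = (\<Sum>i\<in>UNIV. \<Sum>j\<in>UNIV. t $ i * t $ j *
          ((axis i 1 \<bullet> \<Lambda> (\<chi> m. g m x)) * (axis j 1 \<bullet> \<Lambda> (\<chi> m. g m x))))" for x
        by (simp add: power2_eq_square sum_product mult_ac)
      then have "t \<bullet> (A *v t) = (\<Sum>i\<in>UNIV. \<Sum>j\<in>UNIV. t $ i * t $ j * A0 $ i $ j)"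
        unfolding A' by (simp add: tZint A0_def)
      also have "\<dots> = t \<bullet> (A0 *v t)"
        by (simp add: inner_vec_def matrix_vector_mult_def sum_distrib_left mult_ac)
      finally show ?thesis by simp
    qed
    have "\<exists>N. is_mvnormal N A0"
    proof (rule mvnormal_exists)
      show "A0 $ i $ j = A0 $ j $ i" for i j by (simp add: A0_def mult.commute)
      show "0 \<le> t \<bullet> (A0 *v t)" for t by (simp add: quad A')
    qed
    then show ?thesis by (simp add: is_mvnormal_def quad)
  qed
  then obtain N where N: "is_mvnormal N A" by blast
  have sN[measurable_cong]: "sets N = sets borel" and pN: "prob_space N"
    and Nt: "distr N borel (\<lambda>x. t \<bullet> x) = normal1 (t \<bullet> (A *v t))" for t
    using N by (auto simp: is_mvnormal_def)
  have E\<mu>: "expectation (\<lambda>\<omega>. f (\<xi> i \<omega>)) = (\<integral>x. f x \<partial>\<mu>)" if "f \<in> borel_measurable S" for f :: "'b \<Rightarrow> real" and i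
    using that by (subst law[of i, symmetric]) (simp add: integral_distr)
  have "conv_in_law M (\<lambda>n \<omega>. sqrt (real n) *\<^sub>R (\<theta>n n \<omega> - \<theta>0)) N"
  \<comment> \<open>The constant \<open>C\<close> sums, over the \<open>CARD('m)\<close> components,
    the squared bound \<open>2 * b\<close> on a centred feature.\<close>
  proof (rule conv_in_law_of_expansion[where T=T and \<delta>=\<delta> and C="real CARD('m) * (2 * b)\<^sup>2" and K=K])
    show "T n \<in> borel_measurable M" for n
    proof (rule borel_measurable_vecI)
      fix j
      have "T n \<omega> $ j = axis j 1 \<bullet> T n \<omega>" for \<omega> by (simp add: inner_axis')
      then show "(\<lambda>\<omega>. T n \<omega> $ j) \<in> borel_measurable M"
        unfolding T_sum by simp
    qed
    have \<delta>sq: "(\<delta> n \<omega>)\<^sup>2 = (\<Sum>m\<in>UNIV. (norm ((1 / real n) *\<^sub>R (\<Sum>i<n. g m (\<xi> i \<omega>)) - v $ m))\<^sup>2)" for n \<omega>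
      by (simp add: \<delta>_def norm_vec_def L2_set_def Vbar_def sum_nonneg)
    have "\<delta> n = (\<lambda>\<omega>. sqrt (\<Sum>m\<in>UNIV. (norm ((1 / real n) *\<^sub>R (\<Sum>i<n. g m (\<xi> i \<omega>)) - v $ m))\<^sup>2))" for n
      unfolding \<delta>sq[symmetric] by (simp add: \<delta>_def fun_eq_iff)
    then show [measurable]: "\<delta> n \<in> borel_measurable M" for n by simp
    show "0 \<le> \<delta> n \<omega>" for n \<omega> by (simp add: \<delta>_def)
    have vb: "norm (v $ m) \<le> b" for m
    proof -
      have "norm (v $ m) \<le> (\<integral>x. norm (g m x) \<partial>\<mu>)" by (simp add: v_def integral_norm_bound)
      also have "\<dots> \<le> (\<integral>x. b \<partial>\<mu>)" by (intro integral_mono) (use gb gint in auto)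
      finally show ?thesis by (simp add: \<mu>.prob_space)
    qed
    have comp_eq: "(norm ((1 / real n) *\<^sub>R (\<Sum>i<n. g m (\<xi> i \<omega>)) - v $ m))\<^sup>2 = (norm (\<Sum>i<n. g m (\<xi> i \<omega>) - v $ m))\<^sup>2 / (real n)\<^sup>2"
      if "n \<ge> 1" for n m \<omega>
    proof -
      have "(1 / real n) *\<^sub>R (\<Sum>i<n. g m (\<xi> i \<omega>)) - v $ m = (1 / real n) *\<^sub>R (\<Sum>i<n. g m (\<xi> i \<omega>) - v $ m)"
        using that by (simp add: sum_subtractf scaleR_diff_right sum_constant_scaleR)
      then show ?thesis by (simp add: power_divide)
    qed
    have cb: "norm (g m x - v $ m) \<le> 2 * b" for m x
      using norm_triangle_ineq4[of "g m x" "v $ m"] gb[of m x] vb[of m] by linarith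
    have int_comp: "integrable M (\<lambda>\<omega>. (norm ((1 / real n) *\<^sub>R (\<Sum>i<n. g m (\<xi> i \<omega>)) - v $ m))\<^sup>2)" for n m
    proof (rule integrable_const_bound[of _ "(2 * b)\<^sup>2"])
      have mb: "norm ((1 / real n) *\<^sub>R (\<Sum>i<n. g m (\<xi> i \<omega>))) \<le> b" for \<omega>
      proof -
        have "norm (\<Sum>i<n. g m (\<xi> i \<omega>)) \<le> real n * b"
          using sum_norm_le[of "{..<n}" "\<lambda>i. g m (\<xi> i \<omega>)" "\<lambda>_. b"] gb by simp
        then show ?thesis using b0 by (cases "n = 0") (auto simp: field_simps)
      qed
      have "norm ((1 / real n) *\<^sub>R (\<Sum>i<n. g m (\<xi> i \<omega>)) - v $ m) \<le> 2 * b" for \<omega>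
        using norm_triangle_ineq4[of "(1 / real n) *\<^sub>R (\<Sum>i<n. g m (\<xi> i \<omega>))" "v $ m"] vb[of m] mb[of \<omega>] by linarith
      then show "AE \<omega> in M. norm ((norm ((1 / real n) *\<^sub>R (\<Sum>i<n. g m (\<xi> i \<omega>)) - v $ m))\<^sup>2) \<le> (2 * b)\<^sup>2"
        by (intro AE_I2) (simp only: real_norm_def abs_of_nonneg[OF zero_le_power2] power_mono norm_ge_zero)
    qed simp
    show "integrable M (\<lambda>\<omega>. (\<delta> n \<omega>)\<^sup>2)" for n
      unfolding \<delta>sq by (intro Bochner_Integration.integrable_sum int_comp)
    show "expectation (\<lambda>\<omega>. (\<delta> n \<omega>)\<^sup>2) \<le> real CARD('m) * (2 * b)\<^sup>2 / real n" if n: "n \<ge> 1" for n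
    proof -
      have "expectation (\<lambda>\<omega>. (norm (\<Sum>i<n. g m (\<xi> i \<omega>) - v $ m))\<^sup>2) \<le> real n * (2 * b)\<^sup>2" for m
      proof (rule expectation_norm_sum_sq_le[OF _ cb])
        show "indep_vars (\<lambda>_. borel) (\<lambda>i \<omega>. g m (\<xi> i \<omega>) - v $ m) UNIV"
          by (rule indep_vars_compose2[OF ind, where Y="\<lambda>_ x. g m x - v $ m"]) simp
        fix i
        have "integrable M (\<lambda>\<omega>. g m (\<xi> i \<omega>))"
          by (rule integrable_const_bound[of _ b]) (use gb in auto)
        moreover have "expectation (\<lambda>\<omega>. g m (\<xi> i \<omega>)) = v $ m"
          unfolding v_def by (subst law[of i, symmetric]) (simp add: integral_distr)
        ultimately show "expectation (\<lambda>\<omega>. g m (\<xi> i \<omega>) - v $ m) = 0"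
          by (simp add: prob_space)
      qed
      then have "expectation (\<lambda>\<omega>. (norm (\<Sum>i<n. g m (\<xi> i \<omega>) - v $ m))\<^sup>2) / (real n)\<^sup>2 \<le> (2 * b)\<^sup>2 / real n" for m
        using n by (simp add: power2_eq_square field_simps)
      then have "(\<Sum>m\<in>(UNIV::'m set). expectation (\<lambda>\<omega>. (norm (\<Sum>i<n. g m (\<xi> i \<omega>) - v $ m))\<^sup>2) / (real n)\<^sup>2)
          \<le> (\<Sum>m\<in>(UNIV::'m set). (2 * b)\<^sup>2 / real n)"
        by (intro sum_mono)
      then show ?thesis
        unfolding \<delta>sq by (simp add: int_comp del: norm_scaleR scaleR_scaleR) (simp add: comp_eq[OF n])
    qed
    show "norm (T n \<omega>) \<le> K * (sqrt (real n) * \<delta> n \<omega>)" for n \<omega>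
      using mult_left_mono[OF K(2)[of "Vbar n \<omega> - v"], of "sqrt (real n)"]
      by (simp add: T_def \<delta>_def mult_ac)
    fix \<eta> :: real assume "\<eta> > 0"
    then obtain d where d: "d > 0" "\<And>w t. norm (w - v) < d \<Longrightarrow> t \<in> \<Theta> \<Longrightarrow> (\<forall>s\<in>\<Theta>. \<Psi> t \<bullet> w \<le> \<Psi> s \<bullet> w) \<Longrightarrow>
        norm (t - \<theta>0 + B *v G (w - v) \<theta>0) \<le> \<eta> * norm (w - v)"
      using det(2) by blast
    have "AE \<omega> in M. \<delta> n \<omega> < d \<longrightarrow> norm (sqrt (real n) *\<^sub>R (\<theta>n n \<omega> - \<theta>0) - T n \<omega>) \<le> \<eta> * (sqrt (real n) * \<delta> n \<omega>)"
      if n: "n \<ge> 1" for n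
      using est_min[OF n]
    proof eventually_elim
      case (elim \<omega>)
      have "sqrt (real n) *\<^sub>R (\<theta>n n \<omega> - \<theta>0) - T n \<omega> = sqrt (real n) *\<^sub>R (\<theta>n n \<omega> - \<theta>0 + B *v G (Vbar n \<omega> - v) \<theta>0)"
        by (simp add: T_def \<Lambda>_def scaleR_add_right)
      then have eq: "norm (sqrt (real n) *\<^sub>R (\<theta>n n \<omega> - \<theta>0) - T n \<omega>) = sqrt (real n) * norm (\<theta>n n \<omega> - \<theta>0 + B *v G (Vbar n \<omega> - v) \<theta>0)"
        by simp
      show ?case
      proof
        assume "\<delta> n \<omega> < d"
        then have "norm (\<theta>n n \<omega> - \<theta>0 + B *v G (Vbar n \<omega> - v) \<theta>0) \<le> \<eta> * \<delta> n \<omega>"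
          unfolding \<delta>_def using elim by (intro d(2)) auto
        then show "norm (sqrt (real n) *\<^sub>R (\<theta>n n \<omega> - \<theta>0) - T n \<omega>) \<le> \<eta> * (sqrt (real n) * \<delta> n \<omega>)"
          unfolding eq using mult_left_mono[of "norm (\<theta>n n \<omega> - \<theta>0 + B *v G (Vbar n \<omega> - v) \<theta>0)" "\<eta> * \<delta> n \<omega>" "sqrt (real n)"]
          by (simp add: mult.left_commute)
      qed
    qed
    then show "\<exists>d>0. \<forall>n\<ge>1. AE \<omega> in M. \<delta> n \<omega> < d \<longrightarrow>
        norm (sqrt (real n) *\<^sub>R (\<theta>n n \<omega> - \<theta>0) - T n \<omega>) \<le> \<eta> * (sqrt (real n) * \<delta> n \<omega>)"
      using d(1) by blast
  next
    fix t :: "real^'p" and a :: real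
    have "(\<lambda>n. expectation (\<lambda>\<omega>. cos ((\<Sum>i<n. - (t \<bullet> \<Lambda> (\<chi> m. g m (\<xi> i \<omega>)))) / sqrt (real n) + a)))
        \<longlonglongrightarrow> (\<integral>y. cos (y + a) \<partial>normal1 (t \<bullet> (A *v t)))"
    proof (rule clt_cos)
      show "indep_vars (\<lambda>_. borel) (\<lambda>i \<omega>. - (t \<bullet> \<Lambda> (\<chi> m. g m (\<xi> i \<omega>)))) UNIV"
        by (rule indep_vars_compose2[OF ind, where Y="\<lambda>_ x. - (t \<bullet> \<Lambda> (\<chi> m. g m x))"]) simp
      show "distr M borel (\<lambda>\<omega>. - (t \<bullet> \<Lambda> (\<chi> m. g m (\<xi> i \<omega>)))) = distr \<mu> borel (\<lambda>x. - (t \<bullet> \<Lambda> (\<chi> m. g m x)))" for i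
        by (subst law[of i, symmetric]) (simp add: distr_distr comp_def)
      show "\<bar>- (t \<bullet> \<Lambda> (\<chi> m. g m (\<xi> i \<omega>)))\<bar> \<le> norm t * (real CARD('m) * b * K)" for i \<omega>
        using tZb by simp
      show "expectation (\<lambda>\<omega>. (- (t \<bullet> \<Lambda> (\<chi> m. g m (\<xi> i \<omega>))))\<^sup>2) = t \<bullet> (A *v t)" for i
        unfolding A' by (simp add: E\<mu>[of "\<lambda>x. (t \<bullet> \<Lambda> (\<chi> m. g m x))\<^sup>2" i])
      fix i
      define u where "u = (\<Sum>j\<in>UNIV. (t v* B) $ j *\<^sub>R D1 \<theta>0 (axis j 1))"
      have "(\<integral>x. t \<bullet> \<Lambda> (\<chi> m. g m x) \<partial>\<mu>) = u \<bullet> v"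
        unfolding \<Lambda>_adj u_def[symmetric] by (simp add: inner_vec_def v_def gint)
      also have "\<dots> = t \<bullet> \<Lambda> v" unfolding \<Lambda>_adj u_def ..
      finally show "expectation (\<lambda>\<omega>. - (t \<bullet> \<Lambda> (\<chi> m. g m (\<xi> i \<omega>)))) = 0"
        by (simp add: E\<mu>[of "\<lambda>x. t \<bullet> \<Lambda> (\<chi> m. g m x)" i] \<Lambda>v)
    qed
    moreover have "(\<integral>y. cos (y + a) \<partial>normal1 (t \<bullet> (A *v t))) = (\<integral>x. cos (t \<bullet> x + a) \<partial>N)"
      unfolding Nt[symmetric] by (subst integral_distr) auto
    ultimately show "(\<lambda>n. expectation (\<lambda>\<omega>. cos (t \<bullet> T n \<omega> + a))) \<longlonglongrightarrow> (\<integral>x. cos (t \<bullet> x + a) \<partial>N)"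
      by (simp add: T_sum)
  qed (use pN sN in auto)
  with N show ?thesis by blast
qed

section \<open>Gradients, Hessians and covariances of the MMD criterion\<close>

text \<open>Entries lie in an arbitrary normed space, so the vector is written as a sum of the
  bounded linear embeddings \<open>axis i\<close> of its entries.\<close>

lemma has_derivative_vec_lambda:
  fixes f :: "'n::finite \<Rightarrow> 'a::real_normed_vector \<Rightarrow> 'b::real_normed_vector"
  assumes "\<And>i. (f i has_derivative f' i) (at x within S)"
  shows "((\<lambda>x. \<chi> i. f i x) has_derivative (\<lambda>h. \<chi> i. f' i h)) (at x within S)"
proof -
  have ax: "bounded_linear (axis i :: 'b \<Rightarrow> 'b^'n)" for i
  proof (rule bounded_linear_intro[where K=1])
    show "norm (axis i y :: 'b^'n) \<le> norm y * 1" for y :: 'b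
      using L2_set_le_sum[of UNIV "\<lambda>j. norm ((axis i y :: 'b^'n) $ j)"]
      by (simp add: norm_vec_def axis_def if_distrib cong: if_cong)
  qed (simp_all add: vec_eq_iff axis_def)
  have eq: "(\<chi> i. y i) = (\<Sum>i\<in>UNIV. axis i (y i))" for y :: "'n \<Rightarrow> 'b"
    by (simp add: vec_eq_iff axis_def if_distrib cong: if_cong)
  show ?thesis
    unfolding eq by (intro has_derivative_sum bounded_linear.has_derivative[OF ax] assms)
qed

lemma linear_functional_eq_inner:
  fixes l :: "real^('p::finite) \<Rightarrow> real"
  assumes "linear l"
  shows "l h = (\<chi> j. l (axis j 1)) \<bullet> h"
proof -
  interpret linear l by fact
  have h: "h = (\<Sum>j\<in>UNIV. h $ j *\<^sub>R axis j 1)"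
    by (simp add: vec_eq_iff axis_def if_distrib cong: if_cong)
  show ?thesis
    by (subst h) (simp add: sum scale inner_vec_def mult.commute)
qed

lemma gradient_eq:
  assumes "(f has_derivative (\<lambda>h. g \<bullet> h)) (at t)"
  shows "gradient f t = g"
  unfolding gradient_def
proof (rule the_equality)
  show "(f has_derivative (\<lambda>h. g \<bullet> h)) (at t)" by (rule assms)
  fix g' assume "(f has_derivative (\<lambda>h. g' \<bullet> h)) (at t)"
  then have "(\<lambda>h. g' \<bullet> h) = (\<lambda>h. g \<bullet> h)"
    by (rule has_derivative_unique[OF _ assms])
  then show "g' = g" by (metis vector_eq_rdot)
qed

text \<open>\<open>gradient\<close> and \<open>hessian\<close> are definite descriptions; uniqueness
  of derivatives identifies them, the openness of \<open>U\<close> allowing \<open>G\<close> to be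
  replaced by \<open>gradient f\<close> near \<open>t\<close>.\<close>

lemma hessian_has_derivative:
  assumes "open U" "t \<in> U" and f: "\<And>s. s \<in> U \<Longrightarrow> (f has_derivative (\<lambda>h. G s \<bullet> h)) (at s)"
    and G: "(G has_derivative A) (at t)"
  shows "(G has_derivative (\<lambda>h. hessian f t *v h)) (at t)"
proof -
  have grad: "G s = gradient f s" if "s \<in> U" for s
    using gradient_eq[OF f[OF that]] by simp
  have "(gradient f has_derivative A) (at t)"
    by (rule has_derivative_transform_within_open[OF G assms(1,2) grad])
  moreover have A: "A = (\<lambda>h. matrix A *v h)"
    using matrix_works[of A] has_derivative_linear[OF G] by (simp add: fun_eq_iff)
  ultimately have der: "(gradient f has_derivative (\<lambda>h. matrix A *v h)) (at t)" by simp
  have "hessian f t = matrix A"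
    unfolding hessian_def
  proof (rule the_equality)
    fix H assume "((\<lambda>s. gradient f s) has_derivative (\<lambda>h. H *v h)) (at t)"
    then have "(\<lambda>h. H *v h) = (\<lambda>h. matrix A *v h)"
      by (rule has_derivative_unique[OF _ der])
    then show "H = matrix A" by (metis matrix_eq)
  qed (use der in simp)
  then show ?thesis using G A by simp
qed

lemma mult_sandwich_quadratic_form:
  fixes B S :: "real^'p^('p::finite)"
  assumes "\<And>x y. x \<bullet> (B *v y) = (B *v x) \<bullet> y"
  shows "t \<bullet> ((B ** S ** B) *v t) = (B *v t) \<bullet> (S *v (B *v t))"
  by (simp add: matrix_vector_mul_assoc[symmetric] assms)

lemma matrix_inv_self_adjoint:
  fixes H :: "real^'p^('p::finite)"
  assumes "invertible H" and "\<And>x y. x \<bullet> (H *v y) = (H *v x) \<bullet> y"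
  shows "x \<bullet> (matrix_inv H *v y) = (matrix_inv H *v x) \<bullet> y"
proof -
  have "H *v (matrix_inv H *v z) = z" for z
    using someI_ex[OF assms(1)[unfolded invertible_def]] by (simp add: matrix_inv_def matrix_vector_mul_assoc)
  then show ?thesis using assms(2)[of "matrix_inv H *v x" "matrix_inv H *v y"] by simp
qed

lemma has_derivative_norm_diff_sq:
  fixes \<Phi> :: "real^('p::finite) \<Rightarrow> 'h::real_inner"
  assumes "(\<Phi> has_derivative D) (at t)"
  shows "((\<lambda>t. (norm (\<Phi> t - c))\<^sup>2) has_derivative (\<lambda>h. (\<chi> j. 2 * ((\<Phi> t - c) \<bullet> D (axis j 1))) \<bullet> h)) (at t)"
proof -
  interpret linear D by (rule has_derivative_linear[OF assms])
  have lin: "linear (\<lambda>h. 2 * ((\<Phi> t - c) \<bullet> D h))"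
    by (rule linearI) (simp_all add: add scale inner_add_right algebra_simps)
  have "((\<lambda>t. (\<Phi> t - c) \<bullet> (\<Phi> t - c)) has_derivative (\<lambda>h. 2 * ((\<Phi> t - c) \<bullet> D h))) (at t)"
    by (rule has_derivative_eq_rhs[OF has_derivative_inner[OF has_derivative_diff[OF assms has_derivative_const] has_derivative_diff[OF assms has_derivative_const]]])
       (simp add: fun_eq_iff inner_commute)
  moreover have "(\<lambda>h. 2 * ((\<Phi> t - c) \<bullet> D h)) = (\<lambda>h. (\<chi> j. 2 * ((\<Phi> t - c) \<bullet> D (axis j 1))) \<bullet> h)"
    by (rule ext) (rule linear_functional_eq_inner[OF lin])
  ultimately show ?thesis by (simp only: power2_norm_eq_inner)
qed

text \<open>Both sides are the variance of the scalar \<open>u \<bullet> g\<close>; the common bound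
  on the coordinates supplies all integrability.\<close>

lemma quadratic_form_cov_mat:
  fixes g :: "'a \<Rightarrow> real^('p::finite)"
  assumes Q: "prob_space Q" and [measurable]: "\<And>j. (\<lambda>x. g x $ j) \<in> borel_measurable Q" and b: "\<And>x j. \<bar>g x $ j\<bar> \<le> b"
  shows "u \<bullet> (cov_mat Q g *v u) = (\<integral>x. (u \<bullet> g x)\<^sup>2 \<partial>Q) - (\<integral>x. u \<bullet> g x \<partial>Q)\<^sup>2"
proof -
  interpret Q: prob_space Q by (rule Q)
  have b0: "b \<ge> 0" using order.trans[OF abs_ge_zero b] .
  have i1: "integrable Q (\<lambda>x. g x $ j)" for j
    by (rule Q.integrable_const_bound[of _ b]) (use b in auto)
  define c where "c j = (\<integral>x. g x $ j \<partial>Q)" for j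
  have i2: "integrable Q (\<lambda>x. (g x $ i - c i) * (g x $ j - c j))" for i j
  proof (rule Q.integrable_const_bound[of _ "(b + \<bar>c i\<bar>) * (b + \<bar>c j\<bar>)"])
    have "\<bar>g x $ j - c j\<bar> \<le> b + \<bar>c j\<bar>" for x j using b[of x j] by linarith
    then show "AE x in Q. norm ((g x $ i - c i) * (g x $ j - c j)) \<le> (b + \<bar>c i\<bar>) * (b + \<bar>c j\<bar>)"
      using b0 by (auto simp: abs_mult intro!: mult_mono)
  qed simp
  have ug: "u \<bullet> g x = (\<Sum>j\<in>UNIV. u $ j * g x $ j)" for x by (simp add: inner_vec_def)
  have m: "(\<integral>x. u \<bullet> g x \<partial>Q) = (\<Sum>j\<in>UNIV. u $ j * c j)"
    unfolding ug c_def by (simp add: i1)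
  have i3: "integrable Q (\<lambda>x. u \<bullet> g x)" unfolding ug by (simp add: i1)
  have ub: "\<bar>u \<bullet> g x\<bar> \<le> (\<Sum>j\<in>UNIV. \<bar>u $ j\<bar> * b)" for x
    unfolding ug by (rule order.trans[OF sum_abs]) (auto simp: abs_mult intro!: sum_mono mult_left_mono b)
  have i4: "integrable Q (\<lambda>x. (u \<bullet> g x)\<^sup>2)"
  proof (rule Q.integrable_const_bound[of _ "(\<Sum>j\<in>UNIV. \<bar>u $ j\<bar> * b)\<^sup>2"])
    show "AE x in Q. norm ((u \<bullet> g x)\<^sup>2) \<le> (\<Sum>j\<in>UNIV. \<bar>u $ j\<bar> * b)\<^sup>2"
      using power_mono[OF ub abs_ge_zero, where n=2] by simp
  qed (simp add: ug)
  have "u \<bullet> (cov_mat Q g *v u) = (\<Sum>i\<in>UNIV. \<Sum>j\<in>UNIV. \<integral>x. (u $ i * (g x $ i - c i)) * (u $ j * (g x $ j - c j)) \<partial>Q)"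
  proof -
    have "u \<bullet> (cov_mat Q g *v u) = (\<Sum>i\<in>UNIV. \<Sum>j\<in>UNIV. u $ i * (cov_mat Q g $ i $ j * u $ j))"
      by (simp add: inner_vec_def matrix_vector_mult_def sum_distrib_left)
    moreover have "u $ i * (cov_mat Q g $ i $ j * u $ j) = (\<integral>x. (u $ i * (g x $ i - c i)) * (u $ j * (g x $ j - c j)) \<partial>Q)" for i j
    proof -
      have "(\<integral>x. (u $ i * (g x $ i - c i)) * (u $ j * (g x $ j - c j)) \<partial>Q)
          = (\<integral>x. (u $ i * u $ j) * ((g x $ i - c i) * (g x $ j - c j)) \<partial>Q)"
        by (simp add: mult_ac)
      also have "\<dots> = (u $ i * u $ j) * cov_mat Q g $ i $ j"
        by (simp add: cov_mat_def c_def)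
      finally show ?thesis by simp
    qed
    ultimately show ?thesis by simp
  qed
  also have "\<dots> = (\<integral>x. (\<Sum>i\<in>UNIV. \<Sum>j\<in>UNIV. (u $ i * (g x $ i - c i)) * (u $ j * (g x $ j - c j))) \<partial>Q)"
  proof -
    have "integrable Q (\<lambda>x. (u $ i * (g x $ i - c i)) * (u $ j * (g x $ j - c j)))" for i j
      using integrable_mult_right[OF i2[of i j], of "u $ i * u $ j"] by (simp add: mult_ac)
    then show ?thesis by simp
  qed
  also have "\<dots> = (\<integral>x. (u \<bullet> g x - (\<integral>x. u \<bullet> g x \<partial>Q))\<^sup>2 \<partial>Q)"
  proof -
    have "(\<Sum>i\<in>UNIV. \<Sum>j\<in>UNIV. (u $ i * (g x $ i - c i)) * (u $ j * (g x $ j - c j))) = (u \<bullet> g x - (\<Sum>j\<in>UNIV. u $ j * c j))\<^sup>2" for x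
    proof -
      have "u \<bullet> g x - (\<Sum>j\<in>UNIV. u $ j * c j) = (\<Sum>j\<in>UNIV. u $ j * (g x $ j - c j))"
        by (simp add: ug sum_subtractf[symmetric] right_diff_distrib)
      then show ?thesis by (simp only: power2_eq_square sum_product)
    qed
    then show ?thesis by (simp add: m)
  qed
  also have "\<dots> = (\<integral>x. (u \<bullet> g x)\<^sup>2 \<partial>Q) - (\<integral>x. u \<bullet> g x \<partial>Q)\<^sup>2"
    by (rule Q.variance_eq[OF i3 i4])
  finally show ?thesis .
qed

section \<open>Conditional laws given the mask\<close>

lemma integral_condX:
  fixes f :: "real^('d::finite) \<Rightarrow> 'e::{banach,second_countable_topology}"
  assumes "prob_space PXM" and sets_PXM[measurable_cong]: "sets PXM = sets (borel \<Otimes>\<^sub>M count_space UNIV)"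
    and [measurable]: "f \<in> borel_measurable borel" and pos: "pM PXM m > 0"
  shows "(\<integral>x. f x \<partial>condX PXM m) = (1 / pM PXM m) *\<^sub>R (\<integral>z. indicator {m} (snd z) *\<^sub>R f (fst z) \<partial>PXM)"
proof -
  interpret prob_space PXM by fact
  let ?A = "UNIV \<times> {m} :: ((real^'d) \<times> ('d \<Rightarrow> bool)) set"
  have em: "emeasure PXM ?A = ennreal (pM PXM m)" by (simp add: emeasure_eq_measure pM_def)
  have [measurable]: "?A \<in> sets PXM" unfolding sets_PXM by (intro pair_measureI) auto
  have dens: "indicator ?A z / emeasure PXM ?A = ennreal (indicator ?A z / pM PXM m)" for z
    unfolding em using pos by (auto simp: indicator_def divide_ennreal[symmetric] ennreal_1[symmetric] simp del: ennreal_1)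
  have m1: "fst \<in> measurable PXM borel" by measurable
  have "(\<integral>x. f x \<partial>condX PXM m) = (\<integral>z. f (fst z) \<partial>uniform_measure PXM ?A)"
    unfolding condX_def using m1 by (subst integral_distr) (simp_all add: uniform_measure_def)
  also have "\<dots> = (\<integral>z. (indicator ?A z / pM PXM m) *\<^sub>R f (fst z) \<partial>PXM)"
    unfolding uniform_measure_def dens
    by (subst integral_density) (use pos in auto)
  also have "\<dots> = (\<integral>z. (1 / pM PXM m) *\<^sub>R (indicator {m} (snd z) *\<^sub>R f (fst z)) \<partial>PXM)"
    by (intro Bochner_Integration.integral_cong refl) (auto simp: indicator_def)
  also have "\<dots> = (1 / pM PXM m) *\<^sub>R (\<integral>z. indicator {m} (snd z) *\<^sub>R f (fst z) \<partial>PXM)"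
    by (rule integral_scaleR_right)
  finally show ?thesis .
qed

lemma prob_space_condX:
  assumes "prob_space PXM" and sets_PXM[measurable_cong]: "sets PXM = sets (borel \<Otimes>\<^sub>M count_space UNIV)"
    and pos: "pM PXM m > 0"
  shows "prob_space (condX PXM m)"
proof -
  interpret prob_space PXM by fact
  let ?A = "UNIV \<times> {m}"
  have "prob_space (uniform_measure PXM ?A)"
    by (rule prob_space_uniform_measure) (use pos in \<open>auto simp: emeasure_eq_measure pM_def\<close>)
  moreover have "fst \<in> measurable (uniform_measure PXM ?A) borel"
    by (simp add: uniform_measure_def) 
  ultimately show ?thesis
    unfolding condX_def by (rule prob_space.prob_space_distr)
qed

section \<open>Asymptotic normality of the MMD estimator\<close>

theorem theorem4:
  fixes \<Omega> :: "'w measure"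
    and X :: "nat \<Rightarrow> 'w \<Rightarrow> (real, 'd::{finite,linorder}) vec"
    and M :: "nat \<Rightarrow> 'w \<Rightarrow> ('d \<Rightarrow> bool)"
    and \<phi> :: "real list \<Rightarrow> 'h::{real_inner,banach,second_countable_topology}"
    and P :: "real^('p::finite) \<Rightarrow> ((real, 'd) vec) measure"
    and \<Theta> :: "(real^'p) set"
    and \<theta>inf :: "real^'p"
    and \<theta>n :: "nat \<Rightarrow> 'w \<Rightarrow> real^'p"
    and PXM :: "(((real, 'd) vec) \<times> ('d \<Rightarrow> bool)) measure"
  assumes prob: "prob_space \<Omega>"
    and iid_indep: "prob_space.indep_vars \<Omega> (\<lambda>_. borel \<Otimes>\<^sub>M count_space UNIV)
                      (\<lambda>i \<omega>. (X i \<omega>, M i \<omega>)) UNIV"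
    and iid_law: "\<And>i. distr \<Omega> (borel \<Otimes>\<^sub>M count_space UNIV) (\<lambda>\<omega>. (X i \<omega>, M i \<omega>)) = PXM"
    \<comment> \<open>kernel k(u,v) = inner (phi u) (phi v): bounded by 1, measurable, characteristic\<close>
    and kbound: "\<And>u. norm (\<phi> u) \<le> 1"
    and kmeas: "\<And>m :: 'd \<Rightarrow> bool. (\<lambda>x. \<phi> (subvec m x)) \<in> borel_measurable borel"
    and kchar: "\<And>(m :: 'd \<Rightarrow> bool) \<mu> \<nu>. prob_space \<mu> \<Longrightarrow> prob_space \<nu> \<Longrightarrow> sets \<mu> = sets borel \<Longrightarrow>
                  sets \<nu> = sets borel \<Longrightarrow> emb \<phi> m \<mu> = emb \<phi> m \<nu> \<Longrightarrow>
                  distr \<mu> borel (zpad m) = distr \<nu> borel (zpad m)"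
    \<comment> \<open>the model\<close>
    and model: "\<And>\<theta>. \<theta> \<in> \<Theta> \<Longrightarrow> prob_space (P \<theta>) \<and> sets (P \<theta>) = sets borel"
    \<comment> \<open>the estimator: a measurable minimizer of the empirical risk\<close>
    and est_meas: "\<And>n. \<theta>n n \<in> borel_measurable \<Omega>"
    and est_min: "\<And>n \<omega> \<theta>. n \<ge> 1 \<Longrightarrow> \<omega> \<in> space \<Omega> \<Longrightarrow>
                    \<theta>n n \<omega> \<in> \<Theta> \<and> (\<theta> \<in> \<Theta> \<longrightarrow> emp_risk \<phi> P X M n (\<theta>n n \<omega>) \<omega> \<le> emp_risk \<phi> P X M n \<theta> \<omega>)"
    \<comment> \<open>(1)\<close>
    and A1: "compact \<Theta>" "\<theta>inf \<in> \<Theta>"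
            "\<And>\<theta>. \<theta> \<in> \<Theta> \<Longrightarrow> \<theta> \<noteq> \<theta>inf \<Longrightarrow> pop_risk \<phi> P PXM \<theta>inf < pop_risk \<phi> P PXM \<theta>"
    \<comment> \<open>(2)\<close>
    and A2: "\<And>m. pM PXM m > 0 \<Longrightarrow> continuous_on \<Theta> (\<lambda>\<theta>. emb \<phi> m (P \<theta>))"
    \<comment> \<open>(3)\<close>
    and A3: "\<theta>inf \<in> interior \<Theta>"
    \<comment> \<open>(4) and (5)\<close>
    and A45: "\<exists>U K. open U \<and> U \<subseteq> \<Theta> \<and> \<theta>inf \<in> U \<and> compact K \<and> K \<subseteq> U \<and> \<theta>inf \<in> interior K \<and>
              (\<forall>m. pM PXM m > 0 \<longrightarrow>
                 (\<exists>(D1 :: (real, 'p) vec \<Rightarrow> ((real, 'p) vec \<Rightarrow>\<^sub>L 'h)) (D2 :: (real, 'p) vec \<Rightarrow> ((real, 'p) vec \<Rightarrow>\<^sub>L ((real, 'p) vec \<Rightarrow>\<^sub>L 'h))).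
                    (\<forall>t\<in>U. ((\<lambda>\<theta>. emb \<phi> m (P \<theta>)) has_derivative blinfun_apply (D1 t)) (at t)) \<and>
                    (\<forall>t\<in>U. (D1 has_derivative blinfun_apply (D2 t)) (at t)) \<and>
                    continuous_on U D2 \<and>
                    (\<forall>j k. bounded ((\<lambda>t. blinfun_apply (blinfun_apply (D2 t) (axis j 1)) (axis k 1)) ` K))))"
    \<comment> \<open>(6)\<close>
    and A6: "invertible (Hmat \<phi> P PXM \<theta>inf)"
    \<comment> \<open>(7)\<close>
    and A7: "invertible (Sigma1 \<phi> P PXM \<theta>inf)" "invertible (Sigma2 \<phi> P PXM \<theta>inf)"
  shows "\<exists>N. is_mvnormal N
              (matrix_inv (Hmat \<phi> P PXM \<theta>inf) ** Sigma1 \<phi> P PXM \<theta>inf ** matrix_inv (Hmat \<phi> P PXM \<theta>inf)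
             + matrix_inv (Hmat \<phi> P PXM \<theta>inf) ** Sigma2 \<phi> P PXM \<theta>inf ** matrix_inv (Hmat \<phi> P PXM \<theta>inf))
           \<and> conv_in_law \<Omega> (\<lambda>n \<omega>. sqrt (real n) *\<^sub>R (\<theta>n n \<omega> - \<theta>inf)) N"
proof -
  interpret prob_space \<Omega> by (rule prob)
  define \<xi> where "\<xi> = (\<lambda>i \<omega>. (X i \<omega>, M i \<omega>))"
  let ?S = "borel \<Otimes>\<^sub>M count_space UNIV :: (((real, 'd) vec) \<times> ('d \<Rightarrow> bool)) measure"
  have ind: "indep_vars (\<lambda>_. ?S) \<xi> UNIV" using iid_indep by (simp add: \<xi>_def)
  have law: "distr \<Omega> ?S (\<xi> i) = PXM" for i using iid_law by (simp add: \<xi>_def)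
  have \<xi>m[measurable]: "\<xi> i \<in> measurable \<Omega> ?S" for i
    using ind by (simp add: indep_vars_def)
  have sets_PXM[measurable_cong]: "sets PXM = sets ?S" using law[of 0] by auto
  have pPXM: "prob_space PXM" using prob_space_distr[OF \<xi>m[of 0]] by (simp add: law)
  interpret PXM: prob_space PXM by (rule pPXM)

  \<comment> \<open>The risks as linear contrasts\<close>
  define obs where "obs = obs_patterns PXM"
  define p where "p = pM PXM"
  define \<Phi> where "\<Phi> m t = emb \<phi> m (P t)" for m t
  define c where "c m = emb \<phi> m (condX PXM m)" for m
  have obs: "p m > 0" "m \<noteq> (\<lambda>_. True)" if "m \<in> obs" for m
    using that by (auto simp: obs_def obs_patterns_def p_def)
  have emb_return: "emb \<phi> m (return borel x) = \<phi> (subvec m x)" for m :: "'d \<Rightarrow> bool" and x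
    unfolding emb_def by (rule integral_return) (auto simp: kmeas)
  have k2[measurable]: "(\<lambda>x. \<phi> (subvec m x)) \<in> borel_measurable borel" for m :: "'d \<Rightarrow> bool" by (rule kmeas)
  \<comment> \<open>The first entry counts occurrences of the mask and so weights the squared norm
    in \<open>\<Psi>\<close>; zero outside \<open>obs\<close> keeps embeddings without regularity
    assumptions out of the contrast.\<close>
  define g :: "('d \<Rightarrow> bool) \<Rightarrow> ((real, 'd) vec) \<times> ('d \<Rightarrow> bool) \<Rightarrow> real \<times> 'h"
    where "g m z = (if m \<in> obs \<and> snd z = m then (1, \<phi> (subvec m (fst z))) else 0)" for m z
  define \<Psi> :: "(real, 'p) vec \<Rightarrow> (real \<times> 'h, 'd \<Rightarrow> bool) vec"
    where "\<Psi> t = (\<chi> m. if m \<in> obs then ((norm (\<Phi> m t))\<^sup>2, - 2 *\<^sub>R \<Phi> m t) else 0)" for t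
  have gm: "g m \<in> borel_measurable ?S" for m
  proof -
    have [measurable]: "(\<lambda>z. \<phi> (subvec m (fst z))) \<in> borel_measurable ?S"
      by (rule measurable_compose[OF measurable_fst k2])
    show ?thesis unfolding g_def by measurable
  qed
  have gb: "norm (g m z) \<le> 2" for m z
    using norm_Pair_le[of "1::real" "\<phi> (subvec m (fst z))"] kbound[of "subvec m (fst z)"] by (auto simp: g_def)
  have norm_diff: "(norm (a - b))\<^sup>2 = (norm a)\<^sup>2 - 2 * (a \<bullet> b) + (norm b)\<^sup>2" for a b :: 'h
    by (simp add: power2_norm_eq_inner inner_diff_left inner_diff_right inner_commute)
  have sum_obs: "(\<Sum>m\<in>UNIV. if m \<in> obs then f m else 0) = (\<Sum>m\<in>obs. f m)" for f :: "('d \<Rightarrow> bool) \<Rightarrow> real"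
    by (simp add: sum.If_cases)
  \<comment> \<open>Only the summand of the observed mask survives, and completing the square
    recovers the loss up to a term free of \<open>t\<close>.\<close>
  have \<Psi>_g: "\<Psi> t \<bullet> (\<chi> m. g m z) = (if snd z \<in> obs then (norm (\<Phi> (snd z) t - \<phi> (subvec (snd z) (fst z))))\<^sup>2 - (norm (\<phi> (subvec (snd z) (fst z))))\<^sup>2 else 0)"
    for t z
  proof -
    have "\<Psi> t \<bullet> (\<chi> m. g m z) = (\<Sum>m\<in>UNIV. if snd z = m then (if m \<in> obs then (norm (\<Phi> m t))\<^sup>2 - 2 * (\<Phi> m t \<bullet> \<phi> (subvec m (fst z))) else 0) else 0)"
      unfolding inner_vec_def by (intro sum.cong refl) (auto simp: \<Psi>_def g_def)
    then show ?thesis by (simp add: norm_diff)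
  qed
  define v where "v = (\<chi> m. \<integral>z. g m z \<partial>PXM)"
  have v: "v $ m = (if m \<in> obs then (p m, p m *\<^sub>R c m) else 0)" for m
  proof (cases "m \<in> obs")
    case True
    interpret C: prob_space "condX PXM m"
      by (rule prob_space_condX[OF pPXM sets_PXM]) (use obs(1)[OF True] in \<open>simp add: p_def\<close>)
    have sC[measurable_cong]: "sets (condX PXM m) = sets borel" by (simp add: condX_def)
    have int: "integrable (condX PXM m) (\<lambda>x. (1::real, \<phi> (subvec m x)))"
    proof (rule C.integrable_const_bound[of _ 2])
      show "AE x in condX PXM m. norm (1::real, \<phi> (subvec m x)) \<le> 2"
      proof (rule AE_I2)
        fix x
        show "norm (1::real, \<phi> (subvec m x)) \<le> 2"
          using norm_Pair_le[of "1::real" "\<phi> (subvec m x)"] kbound[of "subvec m x"] by simp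
      qed
    qed simp
    have pair: "(\<integral>x. (1::real, \<phi> (subvec m x)) \<partial>condX PXM m) = (1, c m)"
      using integral_fst[OF int] integral_snd[OF int] by (intro prod_eqI) (simp_all add: C.prob_space c_def emb_def)
    have "v $ m = (\<integral>z. indicator {m} (snd z) *\<^sub>R (1, \<phi> (subvec m (fst z))) \<partial>PXM)"
      using True by (auto simp: v_def g_def indicator_def zero_prod_def intro!: Bochner_Integration.integral_cong)
    also have "\<dots> = p m *\<^sub>R (\<integral>x. (1, \<phi> (subvec m x)) \<partial>condX PXM m)"
      using obs(1)[OF True] by (subst integral_condX[OF pPXM sets_PXM]) (simp_all add: p_def)
    finally show ?thesis using True by (simp add: pair)
  qed (simp add: v_def g_def)
  have \<Psi>_v: "\<Psi> t \<bullet> v = (\<Sum>m\<in>obs. p m * ((norm (\<Phi> m t))\<^sup>2 - 2 * (\<Phi> m t \<bullet> c m)))" for t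
    unfolding inner_vec_def sum_obs[symmetric]
    by (intro sum.cong refl) (auto simp: \<Psi>_def v algebra_simps)
  have pop: "pop_risk \<phi> P PXM t = \<Psi> t \<bullet> v + (\<Sum>m\<in>obs. p m * (norm (c m))\<^sup>2)" for t
    unfolding \<Psi>_v pop_risk_def mmd2_def
    by (simp add: obs_def[symmetric] p_def[symmetric] \<Phi>_def[symmetric] c_def[symmetric] norm_diff sum.distrib[symmetric] algebra_simps)
  define Vbar where "Vbar = (\<lambda>n \<omega>. \<chi> m. (1 / real n) *\<^sub>R (\<Sum>i<n. g m (\<xi> i \<omega>)))"
  have \<Psi>_Vbar: "\<Psi> t \<bullet> Vbar n \<omega> = (1 / real n) * (\<Sum>i<n. \<Psi> t \<bullet> (\<chi> m. g m (\<xi> i \<omega>)))" for t n \<omega>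
  proof -
    have "Vbar n \<omega> = (1 / real n) *\<^sub>R (\<Sum>i<n. \<chi> m. g m (\<xi> i \<omega>))"
      by (simp add: Vbar_def vec_eq_iff)
    then show ?thesis by (simp add: inner_sum_right)
  qed
  \<comment> \<open>There are finitely many masks, so those of probability zero together occur with
    probability zero.\<close>
  have mask_pos: "AE \<omega> in \<Omega>. p (M i \<omega>) > 0" for i
  proof -
    have "AE z in PXM. \<forall>m\<in>{m. p m = 0}. snd z \<noteq> m"
    proof (subst AE_finite_all)
      show "\<forall>m\<in>{m. p m = 0}. AE z in PXM. snd z \<noteq> m"
      proof
        fix m assume "m \<in> {m. p m = 0}"
        then have "UNIV \<times> {m} \<in> null_sets PXM"
          by (auto simp: null_sets_def p_def pM_def PXM.emeasure_eq_measure sets_PXM)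
        then show "AE z in PXM. snd z \<noteq> m"
          by (rule AE_I') auto
      qed
    qed simp
    then have "AE z in distr \<Omega> ?S (\<xi> i). p (snd z) \<noteq> 0"
      unfolding law by eventually_elim auto
    then have "AE \<omega> in \<Omega>. p (snd (\<xi> i \<omega>)) \<noteq> 0"
      by (rule AE_distrD[OF \<xi>m])
    then show ?thesis
      by eventually_elim (auto simp: \<xi>_def p_def pM_def less_le)
  qed
  \<comment> \<open>An observation with all coordinates missing contributes zero: both embeddings equal \<open>\<phi> []\<close>.\<close>
  have emp: "emp_risk \<phi> P X M n t \<omega> = \<Psi> t \<bullet> Vbar n \<omega> +
      (1 / real n) * (\<Sum>i<n. if M i \<omega> \<in> obs then (norm (\<phi> (subvec (M i \<omega>) (X i \<omega>))))\<^sup>2 else 0)"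
    if t: "t \<in> \<Theta>" and pos: "\<And>i. p (M i \<omega>) > 0" for n t \<omega>
  proof -
    have "mmd2 \<phi> (M i \<omega>) (P t) (return borel (X i \<omega>)) = \<Psi> t \<bullet> (\<chi> m. g m (\<xi> i \<omega>)) +
        (if M i \<omega> \<in> obs then (norm (\<phi> (subvec (M i \<omega>) (X i \<omega>))))\<^sup>2 else 0)" for i
    proof (cases "M i \<omega> \<in> obs")
      case True
      then show ?thesis by (simp add: \<Psi>_g mmd2_def emb_return \<xi>_def \<Phi>_def)
    next
      case False
      then have MT: "M i \<omega> = (\<lambda>_. True)" using pos[of i] by (auto simp: obs_def obs_patterns_def p_def)
      interpret Pt: prob_space "P t" using model[OF t] by simp
      have "emb \<phi> (\<lambda>_. True) (P t) = \<phi> []"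
        by (simp add: emb_def subvec_def Pt.prob_space)
      then show ?thesis using False by (simp add: MT \<Psi>_g mmd2_def emb_return \<xi>_def subvec_def)
    qed
    then show ?thesis
      by (simp add: emp_risk_def \<Psi>_Vbar sum.distrib distrib_left)
  qed
  \<comment> \<open>On \<open>\<Theta>\<close> the empirical risk and the contrast differ by a
    quantity that does not depend on the parameter, so they have the same minimisers.\<close>
  have est: "AE \<omega> in \<Omega>. \<theta>n n \<omega> \<in> \<Theta> \<and> (\<forall>s\<in>\<Theta>. \<Psi> (\<theta>n n \<omega>) \<bullet> Vbar n \<omega> \<le> \<Psi> s \<bullet> Vbar n \<omega>)" if n: "n \<ge> 1" for n
  proof -
    have "AE \<omega> in \<Omega>. \<forall>i. p (M i \<omega>) > 0" using mask_pos by (simp add: AE_all_countable)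
    then show ?thesis
      using AE_space
    proof eventually_elim
      case (elim \<omega>)
      have "\<theta>n n \<omega> \<in> \<Theta>" using est_min[OF n elim(2)] by blast
      moreover have "\<Psi> (\<theta>n n \<omega>) \<bullet> Vbar n \<omega> \<le> \<Psi> s \<bullet> Vbar n \<omega>" if "s \<in> \<Theta>" for s
        using est_min[OF n elim(2), of s] that emp[OF \<open>\<theta>n n \<omega> \<in> \<Theta>\<close>, of \<omega> n] emp[OF that, of \<omega> n] elim(1) by simp
      ultimately show ?case by blast
    qed
  qed
  have cont\<Psi>: "continuous_on \<Theta> \<Psi>"
    unfolding \<Psi>_def
  proof (rule continuous_on_vec_lambda)
    fix m
    show "continuous_on \<Theta> (\<lambda>t. if m \<in> obs then ((norm (\<Phi> m t))\<^sup>2, - 2 *\<^sub>R \<Phi> m t) else 0)"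
    proof (cases "m \<in> obs")
      case True
      then have "continuous_on \<Theta> (\<Phi> m)" using A2[of m] obs(1)[of m] by (simp add: \<Phi>_def[abs_def] p_def)
      then show ?thesis using True by (auto intro!: continuous_intros)
    qed simp
  qed
  have uniq: "\<Psi> \<theta>inf \<bullet> v < \<Psi> t \<bullet> v" if "t \<in> \<Theta>" "t \<noteq> \<theta>inf" for t
    using A1(3)[OF that] by (simp add: pop)

  \<comment> \<open>Derivatives of the contrast\<close>
  from A45 obtain U K where U: "open U" "U \<subseteq> \<Theta>" "\<theta>inf \<in> U" and UD: "\<forall>m. pM PXM m > 0 \<longrightarrow>
      (\<exists>(D1 :: (real, 'p) vec \<Rightarrow> ((real, 'p) vec \<Rightarrow>\<^sub>L 'h)) (D2 :: (real, 'p) vec \<Rightarrow> ((real, 'p) vec \<Rightarrow>\<^sub>L ((real, 'p) vec \<Rightarrow>\<^sub>L 'h))).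
        (\<forall>t\<in>U. ((\<lambda>\<theta>. emb \<phi> m (P \<theta>)) has_derivative blinfun_apply (D1 t)) (at t)) \<and>
        (\<forall>t\<in>U. (D1 has_derivative blinfun_apply (D2 t)) (at t)) \<and>
        continuous_on U D2 \<and>
        (\<forall>j k. bounded ((\<lambda>t. blinfun_apply (blinfun_apply (D2 t) (axis j 1)) (axis k 1)) ` K)))"
    by (elim exE conjE) (rule that; assumption)
  \<comment> \<open>Derivatives are given mask by mask; placing the implication under the
    existential makes choice produce a family indexed by all masks.\<close>
  have "\<forall>m. \<exists>D1 :: (real, 'p) vec \<Rightarrow> ((real, 'p) vec \<Rightarrow>\<^sub>L 'h). m \<in> obs \<longrightarrow>
      (\<forall>t\<in>U. (\<Phi> m has_derivative blinfun_apply (D1 t)) (at t)) \<and> (\<exists>A. (D1 has_derivative A) (at \<theta>inf))"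
  proof
    fix m
    show "\<exists>D1 :: (real, 'p) vec \<Rightarrow> ((real, 'p) vec \<Rightarrow>\<^sub>L 'h). m \<in> obs \<longrightarrow>
      (\<forall>t\<in>U. (\<Phi> m has_derivative blinfun_apply (D1 t)) (at t)) \<and> (\<exists>A. (D1 has_derivative A) (at \<theta>inf))"
    proof (cases "m \<in> obs")
      case True
      then have "pM PXM m > 0" using obs(1) by (simp add: p_def)
      from UD[rule_format, OF this]
      obtain D1 :: "(real, 'p) vec \<Rightarrow> ((real, 'p) vec \<Rightarrow>\<^sub>L 'h)" and D2 :: "(real, 'p) vec \<Rightarrow> ((real, 'p) vec \<Rightarrow>\<^sub>L ((real, 'p) vec \<Rightarrow>\<^sub>L 'h))"
        where D1: "\<forall>t\<in>U. ((\<lambda>\<theta>. emb \<phi> m (P \<theta>)) has_derivative blinfun_apply (D1 t)) (at t)"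
          and D2: "\<forall>t\<in>U. (D1 has_derivative blinfun_apply (D2 t)) (at t)"
        by (elim exE conjE) (rule that; assumption)
      have "(D1 has_derivative blinfun_apply (D2 \<theta>inf)) (at \<theta>inf)"
        using D2 U(3) by (rule bspec)
      then show ?thesis using D1 by (intro exI[of _ D1]) (auto simp: \<Phi>_def[abs_def])
    qed simp
  qed
  from choice[OF this] obtain D :: "('d \<Rightarrow> bool) \<Rightarrow> (real, 'p) vec \<Rightarrow> ((real, 'p) vec \<Rightarrow>\<^sub>L 'h)"
    where D: "\<And>m t. m \<in> obs \<Longrightarrow> t \<in> U \<Longrightarrow> (\<Phi> m has_derivative D m t) (at t)"
      and "\<forall>m. m \<in> obs \<longrightarrow> (\<exists>A. (D m has_derivative A) (at \<theta>inf))" by blast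
  then have "\<forall>m. \<exists>A. m \<in> obs \<longrightarrow> (D m has_derivative A) (at \<theta>inf)" by blast
  from choice[OF this] obtain A where A: "\<And>m. m \<in> obs \<Longrightarrow> (D m has_derivative A m) (at \<theta>inf)" by blast
  \<comment> \<open>Evaluation at a fixed \<open>h\<close> is bounded linear on the space of bounded
    linear maps, so the second derivative can be read direction by direction.\<close>
  have Dapp: "((\<lambda>t. D m t h) has_derivative (\<lambda>k. A m k h)) (at \<theta>inf)" if "m \<in> obs" for m h
    by (rule bounded_linear.has_derivative[OF blinfun.bounded_linear_left A[OF that]])
  define D\<Psi> :: "(real, 'p) vec \<Rightarrow> (real, 'p) vec \<Rightarrow> (real \<times> 'h, 'd \<Rightarrow> bool) vec"
    where "D\<Psi> t h = (\<chi> m. if m \<in> obs then (2 * (\<Phi> m t \<bullet> D m t h), - 2 *\<^sub>R D m t h) else 0)" for t h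
  have D\<Psi>: "(\<Psi> has_derivative D\<Psi> t) (at t)" if "t \<in> U" for t
    unfolding \<Psi>_def[abs_def] D\<Psi>_def[abs_def]
  proof (rule has_derivative_vec_lambda)
    fix m
    show "((\<lambda>t. if m \<in> obs then ((norm (\<Phi> m t))\<^sup>2, - 2 *\<^sub>R \<Phi> m t) else 0) has_derivative
        (\<lambda>h. if m \<in> obs then (2 * (\<Phi> m t \<bullet> D m t h), - 2 *\<^sub>R D m t h) else 0)) (at t)"
    proof (cases "m \<in> obs")
      case True
      have "((\<lambda>t. (\<Phi> m t \<bullet> \<Phi> m t, - 2 *\<^sub>R \<Phi> m t)) has_derivative
          (\<lambda>h. (\<Phi> m t \<bullet> D m t h + D m t h \<bullet> \<Phi> m t, - 2 *\<^sub>R D m t h))) (at t)"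
        using D[OF True that] by (intro has_derivative_Pair has_derivative_inner has_derivative_scaleR_right)
      then show ?thesis using True by (simp add: power2_norm_eq_inner inner_commute)
    qed simp
  qed
  have D2: "((\<lambda>t. \<chi> j. D\<Psi> t (axis j 1)) has_derivative
      (\<lambda>k. \<chi> j m. if m \<in> obs then (2 * (\<Phi> m \<theta>inf \<bullet> A m k (axis j 1) + D m \<theta>inf k \<bullet> D m \<theta>inf (axis j 1)), - 2 *\<^sub>R A m k (axis j 1)) else 0)) (at \<theta>inf)"
    unfolding D\<Psi>_def
  proof (intro has_derivative_vec_lambda)
    fix j m
    show "((\<lambda>t. if m \<in> obs then (2 * (\<Phi> m t \<bullet> D m t (axis j 1)), - 2 *\<^sub>R D m t (axis j 1)) else 0) has_derivative
      (\<lambda>k. if m \<in> obs then (2 * (\<Phi> m \<theta>inf \<bullet> A m k (axis j 1) + D m \<theta>inf k \<bullet> D m \<theta>inf (axis j 1)), - 2 *\<^sub>R A m k (axis j 1)) else 0)) (at \<theta>inf)"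
    proof (cases "m \<in> obs")
      case True
      have "((\<lambda>t. (2 * (\<Phi> m t \<bullet> D m t (axis j 1)), - 2 *\<^sub>R D m t (axis j 1))) has_derivative
        (\<lambda>k. (2 * (\<Phi> m \<theta>inf \<bullet> A m k (axis j 1) + D m \<theta>inf k \<bullet> D m \<theta>inf (axis j 1)), - 2 *\<^sub>R A m k (axis j 1)))) (at \<theta>inf)"
        by (intro has_derivative_Pair has_derivative_mult_right has_derivative_inner has_derivative_scaleR_right D[OF True U(3)] Dapp[OF True])
      then show ?thesis using True by simp
    qed simp
  qed
  define Gm where "Gm m t = (\<chi> j. 2 * ((\<Phi> m t - c m) \<bullet> D m t (axis j 1)))" for m t
  have mmd2_der: "((\<lambda>t. mmd2 \<phi> m (P t) (condX PXM m)) has_derivative (\<lambda>h. Gm m t \<bullet> h)) (at t)" if "m \<in> obs" "t \<in> U" for m t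
    unfolding mmd2_def \<Phi>_def[symmetric] c_def[symmetric] Gm_def
    by (rule has_derivative_norm_diff_sq[OF D[OF that]])
  have Gm_der: "(Gm m has_derivative (\<lambda>h. hessian (\<lambda>t. mmd2 \<phi> m (P t) (condX PXM m)) \<theta>inf *v h)) (at \<theta>inf)" if "m \<in> obs" for m
  proof (rule hessian_has_derivative[OF U(1,3) mmd2_der[OF that]])
    show "(Gm m has_derivative (\<lambda>k. \<chi> j. 2 * ((\<Phi> m \<theta>inf - c m) \<bullet> A m k (axis j 1) + (D m \<theta>inf k - 0) \<bullet> D m \<theta>inf (axis j 1)))) (at \<theta>inf)"
      unfolding Gm_def[abs_def]
      by (intro has_derivative_vec_lambda has_derivative_mult_right has_derivative_inner has_derivative_diff has_derivative_const D[OF that U(3)] Dapp[OF that])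
  qed
  define G where "G = (\<lambda>w t. \<chi> j. D\<Psi> t (axis j 1) \<bullet> w)"
  have Gv: "G v t = (\<Sum>m\<in>obs. p m *\<^sub>R Gm m t)" for t
  proof -
    have "D\<Psi> t h \<bullet> v = (\<Sum>m\<in>obs. p m * (2 * ((\<Phi> m t - c m) \<bullet> D m t h)))" for h
      unfolding inner_vec_def sum_obs[symmetric]
      by (intro sum.cong refl) (auto simp: D\<Psi>_def v algebra_simps inner_commute)
    then show ?thesis by (simp add: G_def Gm_def vec_eq_iff)
  qed
  have msum: "(\<Sum>m\<in>I. a m *\<^sub>R B m) *v h = (\<Sum>m\<in>I. a m *\<^sub>R (B m *v h))" if "finite I"
    for I :: "('d \<Rightarrow> bool) set" and a and B :: "_ \<Rightarrow> ((real, 'p) vec, 'p) vec" and h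
    using that by induction (simp_all add: matrix_vector_mult_add_rdistrib scaleR_matrix_vector_assoc)
  define H where "H = Hmat \<phi> P PXM \<theta>inf"
  have Hder: "(G v has_derivative (\<lambda>h. H *v h)) (at \<theta>inf)"
  proof -
    have "((\<lambda>t. \<Sum>m\<in>obs. p m *\<^sub>R Gm m t) has_derivative
        (\<lambda>h. \<Sum>m\<in>obs. p m *\<^sub>R (hessian (\<lambda>t. mmd2 \<phi> m (P t) (condX PXM m)) \<theta>inf *v h))) (at \<theta>inf)"
      by (intro has_derivative_sum has_derivative_scaleR_right Gm_der)
    moreover have "H *v h = (\<Sum>m\<in>obs. p m *\<^sub>R (hessian (\<lambda>t. mmd2 \<phi> m (P t) (condX PXM m)) \<theta>inf *v h))" for h
      unfolding H_def Hmat_def obs_def[symmetric] p_def[symmetric] by (rule msum) simp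
    ultimately show ?thesis by (simp add: Gv[abs_def])
  qed
  have G_inner: "G w t \<bullet> h = D\<Psi> t h \<bullet> w" if "t \<in> U" for w t h
  proof -
    interpret linear "D\<Psi> t" by (rule has_derivative_linear[OF D\<Psi>[OF that]])
    have "linear (\<lambda>h. D\<Psi> t h \<bullet> w)"
      by (rule linearI) (simp_all add: add scale inner_add_left)
    from linear_functional_eq_inner[OF this, of h] show ?thesis by (simp add: G_def)
  qed
  \<comment> \<open>Symmetry of the Hessian is what makes the covariance the sandwich with
    \<open>H\<close> inverse on both sides, without a transpose.\<close>
  have Hsym: "x \<bullet> (H *v y) = (H *v x) \<bullet> y" for x y
  proof -
    have "((\<lambda>t. \<Psi> t \<bullet> v) has_derivative (\<lambda>h. G v t \<bullet> h)) (at t)" if "t \<in> U" for t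
      using has_derivative_inner_left[OF D\<Psi>[OF that], of v] by (simp add: G_inner[OF that])
    from hessian_symmetric[OF U(1,3) this Hder, of y x] show ?thesis by (simp add: inner_commute)
  qed
  have Gv0: "G v \<theta>inf = 0"
    unfolding G_def
    by (rule linear_contrast_argmin_expansion(1)[OF A1(1) cont\<Psi> uniq U D\<Psi> D2 Hder[unfolded G_def] A6[folded H_def]])
  \<comment> \<open>The gradient of the loss of one observation with mask \<open>m\<close>; its
    conditional mean given the mask is \<open>Gm m \<theta>inf\<close>.\<close>
  define \<zeta> where "\<zeta> m x = (\<chi> j. 2 * ((\<Phi> m \<theta>inf - \<phi> (subvec m x)) \<bullet> D m \<theta>inf (axis j 1)))" for m and x :: "(real, 'd) vec"
  have \<zeta>_grad: "gradient (\<lambda>t. mmd2 \<phi> m (P t) (return borel x)) \<theta>inf = \<zeta> m x" if "m \<in> obs" for m x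
    unfolding mmd2_def emb_return \<Phi>_def[symmetric] \<zeta>_def
    by (rule gradient_eq, rule has_derivative_norm_diff_sq[OF D[OF that U(3)]])
  have lin_D: "(\<chi> j. 2 * (a \<bullet> D m t (axis j 1))) \<bullet> u = 2 * (a \<bullet> D m t u)" for a m t u
  proof -
    have "linear (\<lambda>h. 2 * (a \<bullet> D m t h))"
      by (rule linearI) (simp_all add: blinfun.add_right blinfun.scaleR_right inner_add_right)
    from linear_functional_eq_inner[OF this, of u] show ?thesis by simp
  qed
  have G_g: "G (\<chi> m. g m z) \<theta>inf = (if snd z \<in> obs then \<zeta> (snd z) (fst z) else 0)" for z
  proof -
    have "D\<Psi> \<theta>inf h \<bullet> (\<chi> m. g m z) = (if snd z \<in> obs then 2 * ((\<Phi> (snd z) \<theta>inf - \<phi> (subvec (snd z) (fst z))) \<bullet> D (snd z) \<theta>inf h) else 0)" for h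
    proof -
      have "D\<Psi> \<theta>inf h \<bullet> (\<chi> m. g m z) = (\<Sum>m\<in>UNIV. if snd z = m then (if m \<in> obs then 2 * ((\<Phi> m \<theta>inf - \<phi> (subvec m (fst z))) \<bullet> D m \<theta>inf h) else 0) else 0)"
        unfolding inner_vec_def by (intro sum.cong refl) (auto simp: D\<Psi>_def g_def algebra_simps inner_commute)
      then show ?thesis by simp
    qed
    then show ?thesis by (simp add: G_def \<zeta>_def vec_eq_iff)
  qed

  \<comment> \<open>Splitting of the asymptotic covariance\<close>
  define S1 where "S1 = Sigma1 \<phi> P PXM \<theta>inf"
  define S2 where "S2 = Sigma2 \<phi> P PXM \<theta>inf"
  have \<zeta>m[measurable]: "(\<lambda>x. u \<bullet> \<zeta> m x) \<in> borel_measurable borel" for u m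
    by (simp add: inner_commute[of u] \<zeta>_def lin_D)
  \<comment> \<open>The squared conditional means
    \<open>(u \<bullet> Gm m \<theta>inf)\<^sup>2\<close> subtracted within \<open>S1\<close> are
    exactly those added in \<open>S2\<close>, whose centring term is zero by
    \<open>Gv0\<close>.\<close>
  have S12: "u \<bullet> (S1 *v u) + u \<bullet> (S2 *v u) = (\<integral>z. (u \<bullet> G (\<chi> m. g m z) \<theta>inf)\<^sup>2 \<partial>PXM)" for u
  proof -
    have cov: "u \<bullet> (cov_mat (condX PXM m) (\<lambda>x. gradient (\<lambda>t. mmd2 \<phi> m (P t) (return borel x)) \<theta>inf) *v u)
        = (\<integral>x. (u \<bullet> \<zeta> m x)\<^sup>2 \<partial>condX PXM m) - (u \<bullet> Gm m \<theta>inf)\<^sup>2" if m: "m \<in> obs" for m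
    proof -
      interpret C: prob_space "condX PXM m"
        by (rule prob_space_condX[OF pPXM sets_PXM]) (use obs(1)[OF m] in \<open>simp add: p_def\<close>)
      have sC[measurable_cong]: "sets (condX PXM m) = sets borel" by (simp add: condX_def)
      have int: "integrable (condX PXM m) (\<lambda>x. \<phi> (subvec m x))"
        by (rule C.integrable_const_bound[of _ 1]) (use kbound in auto)
      have "(\<integral>x. u \<bullet> \<zeta> m x \<partial>condX PXM m) = u \<bullet> Gm m \<theta>inf"
      proof -
        have "u \<bullet> \<zeta> m x = 2 * (\<Phi> m \<theta>inf \<bullet> D m \<theta>inf u) - 2 * (\<phi> (subvec m x) \<bullet> D m \<theta>inf u)" for x
          unfolding inner_commute[of u] \<zeta>_def lin_D by (simp add: inner_diff_left algebra_simps)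
        moreover have "u \<bullet> Gm m \<theta>inf = 2 * (\<Phi> m \<theta>inf \<bullet> D m \<theta>inf u) - 2 * (c m \<bullet> D m \<theta>inf u)"
          unfolding inner_commute[of u] Gm_def lin_D by (simp add: inner_diff_left algebra_simps)
        ultimately show ?thesis using int by (simp add: C.prob_space c_def emb_def)
      qed
      moreover have "u \<bullet> (cov_mat (condX PXM m) (\<zeta> m) *v u) = (\<integral>x. (u \<bullet> \<zeta> m x)\<^sup>2 \<partial>condX PXM m) - (\<integral>x. u \<bullet> \<zeta> m x \<partial>condX PXM m)\<^sup>2"
      proof (rule quadratic_form_cov_mat)
        show "(\<lambda>x. \<zeta> m x $ j) \<in> borel_measurable (condX PXM m)" for j
          using \<zeta>m[of "axis j 1" m] by (simp add: inner_axis')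
        \<comment> \<open>Summing over the coordinates gives one bound that serves for all of
          them.\<close>
        show "\<bar>\<zeta> m x $ j\<bar> \<le> (\<Sum>j\<in>UNIV. 2 * ((norm (\<Phi> m \<theta>inf) + 1) * norm (D m \<theta>inf (axis j 1))))" for x j
        proof -
          have "\<bar>\<zeta> m x $ j\<bar> \<le> 2 * (norm (\<Phi> m \<theta>inf - \<phi> (subvec m x)) * norm (D m \<theta>inf (axis j 1)))"
            using Cauchy_Schwarz_ineq2[of "\<Phi> m \<theta>inf - \<phi> (subvec m x)" "D m \<theta>inf (axis j 1)"] by (simp add: \<zeta>_def abs_mult)
          also have "norm (\<Phi> m \<theta>inf - \<phi> (subvec m x)) \<le> norm (\<Phi> m \<theta>inf) + 1"
            using norm_triangle_ineq4[of "\<Phi> m \<theta>inf" "\<phi> (subvec m x)"] kbound[of "subvec m x"] by linarith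
          also have "2 * ((norm (\<Phi> m \<theta>inf) + 1) * norm (D m \<theta>inf (axis j 1)))
              \<le> (\<Sum>j\<in>UNIV. 2 * ((norm (\<Phi> m \<theta>inf) + 1) * norm (D m \<theta>inf (axis j 1))))"
            by (rule member_le_sum) auto
          finally show ?thesis by (simp add: mult_right_mono)
        qed
      qed (rule C.prob_space_axioms)
      ultimately show ?thesis by (simp add: \<zeta>_grad[OF m])
    qed
    have q1: "u \<bullet> (S1 *v u) = (\<Sum>m\<in>obs. p m * ((\<integral>x. (u \<bullet> \<zeta> m x)\<^sup>2 \<partial>condX PXM m) - (u \<bullet> Gm m \<theta>inf)\<^sup>2))"
      unfolding S1_def Sigma1_def obs_def[symmetric] p_def[symmetric]
      by (simp add: msum inner_sum_right cov)
    have grad: "gradient (\<lambda>t. mmd2 \<phi> m (P t) (condX PXM m)) \<theta>inf = Gm m \<theta>inf" if "m \<in> obs" for m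
      by (rule gradient_eq, rule mmd2_der[OF that U(3)])
    have outer_quad: "u \<bullet> (outer a a *v u) = (u \<bullet> a)\<^sup>2" for a
      by (simp add: outer_def inner_vec_def matrix_vector_mult_def power2_eq_square sum_product sum_distrib_left mult_ac)
    have "S2 = (\<Sum>m\<in>obs. p m *\<^sub>R outer (Gm m \<theta>inf) (Gm m \<theta>inf)) - outer (G v \<theta>inf) (G v \<theta>inf)"
      unfolding S2_def Sigma2_def obs_def[symmetric] p_def[symmetric] Let_def Gv
      by (simp add: grad cong: sum.cong)
    then have "S2 = (\<Sum>m\<in>obs. p m *\<^sub>R outer (Gm m \<theta>inf) (Gm m \<theta>inf))"
      by (simp add: Gv0 outer_def vec_eq_iff)
    then have q2: "u \<bullet> (S2 *v u) = (\<Sum>m\<in>obs. p m * (u \<bullet> Gm m \<theta>inf)\<^sup>2)"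
      by (simp add: msum inner_sum_right outer_quad)
    \<comment> \<open>At most one mask matches \<open>snd z\<close>, so the square of the sum is the
      sum of the squares.\<close>
    have "(\<integral>z. (u \<bullet> G (\<chi> m. g m z) \<theta>inf)\<^sup>2 \<partial>PXM) = (\<integral>z. (\<Sum>m\<in>obs. indicator {m} (snd z) *\<^sub>R (u \<bullet> \<zeta> m (fst z))\<^sup>2) \<partial>PXM)"
    proof (intro Bochner_Integration.integral_cong refl)
      fix z
      have "(\<Sum>m\<in>obs. indicator {m} (snd z) *\<^sub>R (u \<bullet> \<zeta> m (fst z))\<^sup>2) = (\<Sum>m\<in>obs. if snd z = m then (u \<bullet> \<zeta> m (fst z))\<^sup>2 else 0)"
        by (intro sum.cong refl) (auto simp: indicator_def)
      then show "(u \<bullet> G (\<chi> m. g m z) \<theta>inf)\<^sup>2 = (\<Sum>m\<in>obs. indicator {m} (snd z) *\<^sub>R (u \<bullet> \<zeta> m (fst z))\<^sup>2)"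
        by (simp add: G_g)
    qed
    also have "\<dots> = (\<Sum>m\<in>obs. \<integral>z. indicator {m} (snd z) *\<^sub>R (u \<bullet> \<zeta> m (fst z))\<^sup>2 \<partial>PXM)"
    proof (rule Bochner_Integration.integral_sum)
      fix m
      define K where "K = 2 * ((norm (\<Phi> m \<theta>inf) + 1) * norm (D m \<theta>inf u))"
      have "\<bar>u \<bullet> \<zeta> m x\<bar> \<le> K" for x
      proof -
        have "\<bar>u \<bullet> \<zeta> m x\<bar> \<le> 2 * (norm (\<Phi> m \<theta>inf - \<phi> (subvec m x)) * norm (D m \<theta>inf u))"
          using Cauchy_Schwarz_ineq2[of "\<Phi> m \<theta>inf - \<phi> (subvec m x)" "D m \<theta>inf u"]
          by (simp add: inner_commute[of u] \<zeta>_def lin_D abs_mult)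
        also have "norm (\<Phi> m \<theta>inf - \<phi> (subvec m x)) \<le> norm (\<Phi> m \<theta>inf) + 1"
          using norm_triangle_ineq4[of "\<Phi> m \<theta>inf" "\<phi> (subvec m x)"] kbound[of "subvec m x"] by linarith
        finally show ?thesis by (simp add: K_def mult_right_mono)
      qed
      then have "norm (indicator {m} (snd z) *\<^sub>R (u \<bullet> \<zeta> m (fst z))\<^sup>2) \<le> K\<^sup>2" for z :: "(real, 'd) vec \<times> ('d \<Rightarrow> bool)"
        using power_mono[OF _ abs_ge_zero, of "u \<bullet> \<zeta> m (fst z)" K 2] by (simp add: indicator_def)
      then show "integrable PXM (\<lambda>z. indicator {m} (snd z) *\<^sub>R (u \<bullet> \<zeta> m (fst z))\<^sup>2)"
        by (intro PXM.integrable_const_bound[of _ "K\<^sup>2"]) auto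
    qed
    also have "\<dots> = (\<Sum>m\<in>obs. p m * (\<integral>x. (u \<bullet> \<zeta> m x)\<^sup>2 \<partial>condX PXM m))"
    proof (intro sum.cong refl)
      fix m assume "m \<in> obs"
      then show "(\<integral>z. indicator {m} (snd z) *\<^sub>R (u \<bullet> \<zeta> m (fst z))\<^sup>2 \<partial>PXM) = p m * (\<integral>x. (u \<bullet> \<zeta> m x)\<^sup>2 \<partial>condX PXM m)"
        using obs(1)[of m] by (subst integral_condX[OF pPXM sets_PXM]) (simp_all add: p_def)
    qed
    finally show ?thesis
      by (simp add: q1 q2 sum.distrib[symmetric] right_diff_distrib)
  qed
  define B where "B = matrix_inv H"
  have Bsym: "x \<bullet> (B *v y) = (B *v x) \<bullet> y" for x y
    unfolding B_def by (rule matrix_inv_self_adjoint[OF A6[folded H_def] Hsym])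
  \<comment> \<open>Self-adjointness of \<open>B\<close> moves it onto \<open>t\<close>, reducing
    the claim to \<open>S12\<close> at \<open>u = B *v t\<close>.\<close>
  have "t \<bullet> ((B ** S1 ** B + B ** S2 ** B) *v t) = (\<integral>z. (t \<bullet> (B *v G (\<chi> m. g m z) \<theta>inf))\<^sup>2 \<partial>PXM)" for t
    by (simp add: matrix_vector_mult_add_rdistrib inner_add_right mult_sandwich_quadratic_form[OF Bsym] S12 Bsym)
  then show ?thesis
    unfolding H_def[symmetric] S1_def[symmetric] S2_def[symmetric] B_def[symmetric]
    by (intro linear_contrast_argmin_clt[OF ind law gm gb A1(1) cont\<Psi> uniq[unfolded v_def] U D\<Psi> D2
          Hder[unfolded G_def v_def] A6[folded H_def] est_meas est[unfolded Vbar_def], folded B_def])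
       (simp_all add: G_def)
qed

end
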